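(* Let $(\mathcal{M},\otimes,I)$ be a monoidal category, regarded as a bicategory with one object. (i) There is an equivalence between $\mathbf{1}$-points of $(\mathcal{M},\mathrm{Iso}(\mathcal{M}))$ and monoids of $\mathcal{M}$, where $\mathrm{Iso}(\mathcal{M})$ is the class of all invertible morphisms of $\mathcal{M}$. (ii) Assume that $\mathcal{M}$ is equipped with a class $\mathcal{W}$ of morphisms (called homotopy equivalences) such that $(\mathcal{M},\mathcal{W})$ is a base of enrichment. Then there is an equivalence between $\mathbf{1}$-points of $(\mathcal{M},\mathcal{W})$ and up-to-homotopy monoids of $\mathcal{M}$ in the sense of Leinster (with respect to $\mathcal{W}$). (iii) If $\mathcal{M}$ has finite products and is considered as a monoidal category for the cartesian product, then there is an equivalence between $\mathbf{1}$-points of $(\mathcal{M},\mathrm{Mor}(\mathcal{M}))$ and simplicial objects of $\mathcal{M}$, where $\mathrm{Mor}(\mathcal{M})$ is the class of all morphisms of $\mathcal{M}$. In each case "equivalence" means an equivalence of categories, for the morphisms specified in the context.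
   Context: $\Delta$ is the category of all finite ordinals $n=\{0,\dots,n-1\}$, $n\ge0$, and nondecreasing maps, strict monoidal under ordinal addition $+$ with unit $0$. $\Delta^{+}$ is the full subcategory of nonempty ordinals. $\mathbf{1}$ is the category with one object $\mathbf{O}$ and only its identity arrow. Base of enrichment: a bicategory $\mathcal{M}$ with a class $\mathcal{W}$ of $2$-cells such that every invertible $2$-cell is in $\mathcal{W}$; $\mathcal{W}$ has the $3$-out-of-$2$ property for vertical composition (if two of $\alpha,\beta,\beta\alpha$ are in $\mathcal{W}$, so is the third); and $\mathcal{W}$ is stable under horizontal composition. A monoidal category is viewed as a bicategory with one object whose $1$-cells are the objects of $\mathcal{M}$, whose $2$-cells are its morphisms, and whose composition of $1$-cells is $\otimes$. For a small category $\mathcal{C}$, the $2$-path-category $\mathscr{P}_{\mathcal{C}}$ is the following strict $2$-category. Its objects are those of $\mathcal{C}$. Objects of $\mathscr{P}_{\mathcal{C}}(A,B)$ are pairs $[n,s]$ with $s=(A=A_0\xrightarrow{f_0}A_1\to\cdots\xrightarrow{f_{n-1}}A_n=B)$ a chain of $n\ge1$ composable arrows of $\mathcal{C}$, and also $[0,A]$ if $A=B$. A morphism $[n,s]\to[m,t]$ is a nondecreasing map $u:n\to m$ such that, for each $j<m$, the $j$-th arrow of $t$ is the composite, in order, of the arrows $f_i$ of $s$ with $u(i)=j$ (an identity if there are none). Composition of $1$-cells is concatenation, $t\otimes s=[n+m,\ s\text{ followed by }t]$, on $2$-cells it is the ordinal sum $u'\otimes u=u+u'$, and the identity of $A$ is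 $[0,A]$. A $\mathcal{C}$-point of $(\mathcal{M},\mathcal{W})$ is a colax morphism of bicategories $F=(F,\varphi):\mathscr{P}_{\mathcal{C}}\to\mathcal{M}$ (an oplax functor: functors $F_{AB}:\mathscr{P}_{\mathcal{C}}(A,B)\to\mathcal{M}(FA,FB)$, natural $2$-cells $\varphi(A,B,C)(t,s):F_{AC}(t\otimes s)\to F_{BC}(t)\otimes F_{AB}(s)$ and $2$-cells $\varphi_A:F_{AA}([0,A])\to I_{FA}$ satisfying the usual associativity and unit coherence axioms) such that all the $2$-cells $\varphi(A,B,C)(t,s)$ and $\varphi_A$ are in $\mathcal{W}$. A morphism from a $\mathcal{C}$-point $(F,\varphi)$ to a $\mathcal{C}$-point $(G,\psi)$ with $FA=GA$ for all $A$ is a transformation of colax morphisms whose $1$-cell components are identities, i.e. a family of natural transformations $\sigma:F_{AB}\to G_{AB}$ with $\psi(t,s)\circ\sigma_{t\otimes s}=(\sigma_t\otimes\sigma_s)\circ\varphi(t,s)$ and $\psi_A\circ\sigma_{[0,A]}=\varphi_A$. An up-to-homotopy monoid (Leinster) in a monoidal category $\mathcal{M}$ with class $\mathcal{W}$ is a colax monoidal functor $(Y,\xi):(\Delta,+,0)\to\mathcal{M}$, with maps $\xi_{mn}:Y(m+n)\to Y(m)\otimes Y(n)$ and $\xi_0:Y(0)\to I$ satisfying the usual naturality and coherence axioms, such that $\xi_0$ and all $\xi_{mn}$ are in $\mathcal{W}$; morphisms are the monoidal natural transformations. A simplicial object of $\mathcal{M}$ is a functor $(\Delta^{+})^{op}\to\mathcal{M}$;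 morphisms are natural transformations. Morphisms of monoids are as usual. *)

theory Defs
  imports "HOL-Library.FuncSet"
begin

section \<open>Categories, functors, equivalences\<close>

text \<open>Arrows know their domain and codomain, and composition is meaningful only for
  composable arrows. \<open>g \<cdot> f\<close> is \<open>g\<close> after \<open>f\<close>.\<close>

record ('o, 'a) cat =
  Obj :: "'o set"
  Arr :: "'a set"
  Dom :: "'a \<Rightarrow> 'o"
  Cod :: "'a \<Rightarrow> 'o"
  Ident :: "'o \<Rightarrow> 'a"
  Comp :: "'a \<Rightarrow> 'a \<Rightarrow> 'a"  (infixl \<open>\<cdot>\<index>\<close> 70)

definition hom :: "('o, 'a, 'm) cat_scheme \<Rightarrow> 'o \<Rightarrow> 'o \<Rightarrow> 'a set" where
  "hom C A B = {f \<in> Arr C. Dom C f = A \<and> Cod C f = B}"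

locale category =
  fixes C :: "('o, 'a, 'm) cat_scheme" (structure)
  assumes dom_obj: "f \<in> Arr C \<Longrightarrow> Dom C f \<in> Obj C"
    and cod_obj: "f \<in> Arr C \<Longrightarrow> Cod C f \<in> Obj C"
    and ident_hom: "A \<in> Obj C \<Longrightarrow> Ident C A \<in> hom C A A"
    and comp_hom: "f \<in> hom C X Y \<Longrightarrow> g \<in> hom C Y Z \<Longrightarrow> g \<cdot> f \<in> hom C X Z"
    and comp_ident: "f \<in> hom C X Y \<Longrightarrow> f \<cdot> Ident C X = f"
    and ident_comp: "f \<in> hom C X Y \<Longrightarrow> Ident C Y \<cdot> f = f"
    and comp_assoc: "f \<in> hom C X Y \<Longrightarrow> g \<in> hom C Y Z \<Longrightarrow> h \<in> hom C Z Z' \<Longrightarrow>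
      (h \<cdot> g) \<cdot> f = h \<cdot> (g \<cdot> f)"

definition isos :: "('o, 'a, 'm) cat_scheme \<Rightarrow> 'a set" where
  "isos C = {f \<in> Arr C. \<exists>g \<in> hom C (Cod C f) (Dom C f).
      g \<cdot>\<^bsub>C\<^esub> f = Ident C (Dom C f) \<and> f \<cdot>\<^bsub>C\<^esub> g = Ident C (Cod C f)}"

definition opposite :: "('o, 'a, 'm) cat_scheme \<Rightarrow> ('o, 'a) cat" where
  "opposite C = \<lparr>Obj = Obj C, Arr = Arr C, Dom = Cod C, Cod = Dom C,
     Ident = Ident C, Comp = (\<lambda>g f. f \<cdot>\<^bsub>C\<^esub> g)\<rparr>"

definition full_subcat :: "('o, 'a, 'm) cat_scheme \<Rightarrow> 'o set \<Rightarrow> ('o, 'a) cat" where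
  "full_subcat C S = \<lparr>Obj = Obj C \<inter> S, Arr = {f \<in> Arr C. Dom C f \<in> S \<and> Cod C f \<in> S},
     Dom = Dom C, Cod = Cod C, Ident = Ident C, Comp = Comp C\<rparr>"

definition one_cat :: "(unit, unit) cat" where
  "one_cat = \<lparr>Obj = {()}, Arr = {()}, Dom = (\<lambda>_. ()), Cod = (\<lambda>_. ()),
     Ident = (\<lambda>_. ()), Comp = (\<lambda>_ _. ())\<rparr>"

record ('o, 'a, 'p, 'b) func =
  FObj :: "'o \<Rightarrow> 'p"
  FArr :: "'a \<Rightarrow> 'b"

text \<open>Functors (and below all other families of data that serve as objects or arrows of a
  category) are required to be \<^const>\<open>extensional\<close>, so that equality of records is equality
  of the structures they represent.\<close>

locale cat_functor = dom: category C + cod: category D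
  for C :: "('o, 'a, 'm) cat_scheme" and D :: "('p, 'b, 'n) cat_scheme" +
  fixes F :: "('o, 'a, 'p, 'b, 'k) func_scheme"
  assumes fobj: "FObj F \<in> Obj C \<rightarrow>\<^sub>E Obj D"
    and farr_ext: "FArr F \<in> extensional (Arr C)"
    and farr_hom: "f \<in> hom C X Y \<Longrightarrow> FArr F f \<in> hom D (FObj F X) (FObj F Y)"
    and farr_ident: "A \<in> Obj C \<Longrightarrow> FArr F (Ident C A) = Ident D (FObj F A)"
    and farr_comp: "f \<in> hom C X Y \<Longrightarrow> g \<in> hom C Y Z \<Longrightarrow>
      FArr F (g \<cdot>\<^bsub>C\<^esub> f) = FArr F g \<cdot>\<^bsub>D\<^esub> FArr F f"

definition id_func :: "('o, 'a, 'm) cat_scheme \<Rightarrow> ('o, 'a, 'o, 'a) func" where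
  "id_func C = \<lparr>FObj = (\<lambda>A \<in> Obj C. A), FArr = (\<lambda>f \<in> Arr C. f)\<rparr>"

definition comp_func :: "('o, 'a, 'm) cat_scheme \<Rightarrow> ('p, 'b, 'q, 'c, 'l) func_scheme \<Rightarrow>
    ('o, 'a, 'p, 'b, 'k) func_scheme \<Rightarrow> ('o, 'a, 'q, 'c) func" where
  "comp_func C G F = \<lparr>FObj = compose (Obj C) (FObj G) (FObj F),
     FArr = compose (Arr C) (FArr G) (FArr F)\<rparr>"

locale nat_trans = src: cat_functor C D F + trg: cat_functor C D G
  for C :: "('o, 'a, 'm) cat_scheme" and D :: "('p, 'b, 'n) cat_scheme"
    and F :: "('o, 'a, 'p, 'b, 'k) func_scheme" and G :: "('o, 'a, 'p, 'b, 'l) func_scheme" +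
  fixes \<sigma> :: "'o \<Rightarrow> 'b"
  assumes component_ext: "\<sigma> \<in> extensional (Obj C)"
    and component_hom: "A \<in> Obj C \<Longrightarrow> \<sigma> A \<in> hom D (FObj F A) (FObj G A)"
    and natural: "f \<in> hom C X Y \<Longrightarrow> \<sigma> Y \<cdot>\<^bsub>D\<^esub> FArr F f = FArr G f \<cdot>\<^bsub>D\<^esub> \<sigma> X"

locale nat_iso = nat_trans +
  assumes component_iso: "A \<in> Obj C \<Longrightarrow> \<sigma> A \<in> isos D"

definition equivalent_cats ::
    "('o, 'a, 'm) cat_scheme \<Rightarrow> ('p, 'b, 'n) cat_scheme \<Rightarrow> bool" where
  "equivalent_cats C D \<longleftrightarrow>
     (\<exists>(F :: ('o, 'a, 'p, 'b) func) (G :: ('p, 'b, 'o, 'a) func) \<eta> \<epsilon>.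
        cat_functor C D F \<and> cat_functor D C G \<and>
        nat_iso C C (id_func C) (comp_func C G F) \<eta> \<and>
        nat_iso D D (comp_func D F G) (id_func D) \<epsilon>)"

definition functor_cat :: "('o, 'a, 'm) cat_scheme \<Rightarrow> ('p, 'b, 'n) cat_scheme \<Rightarrow>
    (('o, 'a, 'p, 'b) func,
     ('o, 'a, 'p, 'b) func \<times> ('o \<Rightarrow> 'b) \<times> ('o, 'a, 'p, 'b) func) cat" where
  "functor_cat C D = \<lparr>
     Obj = {F. cat_functor C D F},
     Arr = {(F, \<sigma>, G). nat_trans C D F G \<sigma>},
     Dom = (\<lambda>(F, \<sigma>, G). F),
     Cod = (\<lambda>(F, \<sigma>, G). G),
     Ident = (\<lambda>F. (F, \<lambda>A \<in> Obj C. Ident D (FObj F A), F)),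
     Comp = (\<lambda>(G', \<tau>, H) (F, \<sigma>, G). (F, \<lambda>A \<in> Obj C. \<tau> A \<cdot>\<^bsub>D\<^esub> \<sigma> A, H))\<rparr>"


section \<open>Monoidal categories and monoids\<close>

record ('o, 'a) moncat = "('o, 'a) cat" +
  TObj :: "'o \<Rightarrow> 'o \<Rightarrow> 'o"  (infixr \<open>\<otimes>\<index>\<close> 75)
  TArr :: "'a \<Rightarrow> 'a \<Rightarrow> 'a"  (infixr \<open>\<boxtimes>\<index>\<close> 75)
  TUnit :: "'o"  (\<open>\<I>\<index>\<close>)
  TAssoc :: "'o \<Rightarrow> 'o \<Rightarrow> 'o \<Rightarrow> 'a"
  TLUnit :: "'o \<Rightarrow> 'a"
  TRUnit :: "'o \<Rightarrow> 'a"

locale monoidal_category = category M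
  for M :: "('o, 'a, 'm) moncat_scheme" (structure) +
  assumes tobj: "A \<in> Obj M \<Longrightarrow> B \<in> Obj M \<Longrightarrow> A \<otimes> B \<in> Obj M"
    and tarr: "f \<in> hom M A A' \<Longrightarrow> g \<in> hom M B B' \<Longrightarrow> f \<boxtimes> g \<in> hom M (A \<otimes> B) (A' \<otimes> B')"
    and tarr_ident: "A \<in> Obj M \<Longrightarrow> B \<in> Obj M \<Longrightarrow>
      Ident M A \<boxtimes> Ident M B = Ident M (A \<otimes> B)"
    and tarr_comp: "f \<in> hom M A A' \<Longrightarrow> f' \<in> hom M A' A'' \<Longrightarrow>
      g \<in> hom M B B' \<Longrightarrow> g' \<in> hom M B' B'' \<Longrightarrow>
      (f' \<cdot> f) \<boxtimes> (g' \<cdot> g) = (f' \<boxtimes> g') \<cdot> (f \<boxtimes> g)"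
    and tunit: "\<I> \<in> Obj M"
    and assoc_hom: "A \<in> Obj M \<Longrightarrow> B \<in> Obj M \<Longrightarrow> E \<in> Obj M \<Longrightarrow>
      TAssoc M A B E \<in> hom M ((A \<otimes> B) \<otimes> E) (A \<otimes> (B \<otimes> E)) \<inter> isos M"
    and assoc_natural: "f \<in> hom M A A' \<Longrightarrow> g \<in> hom M B B' \<Longrightarrow> h \<in> hom M E E' \<Longrightarrow>
      TAssoc M A' B' E' \<cdot> ((f \<boxtimes> g) \<boxtimes> h) = (f \<boxtimes> (g \<boxtimes> h)) \<cdot> TAssoc M A B E"
    and lunit_hom: "A \<in> Obj M \<Longrightarrow> TLUnit M A \<in> hom M (\<I> \<otimes> A) A \<inter> isos M"
    and lunit_natural: "f \<in> hom M A A' \<Longrightarrow>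
      TLUnit M A' \<cdot> (Ident M \<I> \<boxtimes> f) = f \<cdot> TLUnit M A"
    and runit_hom: "A \<in> Obj M \<Longrightarrow> TRUnit M A \<in> hom M (A \<otimes> \<I>) A \<inter> isos M"
    and runit_natural: "f \<in> hom M A A' \<Longrightarrow>
      TRUnit M A' \<cdot> (f \<boxtimes> Ident M \<I>) = f \<cdot> TRUnit M A"
    and pentagon: "A \<in> Obj M \<Longrightarrow> B \<in> Obj M \<Longrightarrow> E \<in> Obj M \<Longrightarrow> K \<in> Obj M \<Longrightarrow>
      (Ident M A \<boxtimes> TAssoc M B E K) \<cdot> TAssoc M A (B \<otimes> E) K \<cdot> (TAssoc M A B E \<boxtimes> Ident M K) =
      TAssoc M A B (E \<otimes> K) \<cdot> TAssoc M (A \<otimes> B) E K"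
    and triangle: "A \<in> Obj M \<Longrightarrow> B \<in> Obj M \<Longrightarrow>
      (Ident M A \<boxtimes> TLUnit M B) \<cdot> TAssoc M A \<I> B = TRUnit M A \<boxtimes> Ident M B"

definition is_monoid :: "('o, 'a, 'm) moncat_scheme \<Rightarrow> 'o \<times> 'a \<times> 'a \<Rightarrow> bool" where
  "is_monoid M = (\<lambda>(A, \<mu>, \<iota>).
     A \<in> Obj M \<and> \<mu> \<in> hom M (A \<otimes>\<^bsub>M\<^esub> A) A \<and> \<iota> \<in> hom M \<I>\<^bsub>M\<^esub> A \<and>
     \<mu> \<cdot>\<^bsub>M\<^esub> (\<mu> \<boxtimes>\<^bsub>M\<^esub> Ident M A) = \<mu> \<cdot>\<^bsub>M\<^esub> (Ident M A \<boxtimes>\<^bsub>M\<^esub> \<mu>) \<cdot>\<^bsub>M\<^esub> TAssoc M A A A \<and>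
     \<mu> \<cdot>\<^bsub>M\<^esub> (\<iota> \<boxtimes>\<^bsub>M\<^esub> Ident M A) = TLUnit M A \<and>
     \<mu> \<cdot>\<^bsub>M\<^esub> (Ident M A \<boxtimes>\<^bsub>M\<^esub> \<iota>) = TRUnit M A)"

definition is_monoid_hom ::
    "('o, 'a, 'm) moncat_scheme \<Rightarrow> 'o \<times> 'a \<times> 'a \<Rightarrow> 'o \<times> 'a \<times> 'a \<Rightarrow> 'a \<Rightarrow> bool" where
  "is_monoid_hom M = (\<lambda>(A, \<mu>, \<iota>) (A', \<mu>', \<iota>') f.
     f \<in> hom M A A' \<and> f \<cdot>\<^bsub>M\<^esub> \<mu> = \<mu>' \<cdot>\<^bsub>M\<^esub> (f \<boxtimes>\<^bsub>M\<^esub> f) \<and> f \<cdot>\<^bsub>M\<^esub> \<iota> = \<iota>')"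

definition monoid_cat :: "('o, 'a, 'm) moncat_scheme \<Rightarrow>
    ('o \<times> 'a \<times> 'a, ('o \<times> 'a \<times> 'a) \<times> 'a \<times> ('o \<times> 'a \<times> 'a)) cat" where
  "monoid_cat M = \<lparr>
     Obj = {X. is_monoid M X},
     Arr = {(X, f, Y). is_monoid M X \<and> is_monoid M Y \<and> is_monoid_hom M X Y f},
     Dom = (\<lambda>(X, f, Y). X),
     Cod = (\<lambda>(X, f, Y). Y),
     Ident = (\<lambda>X. (X, Ident M (fst X), X)),
     Comp = (\<lambda>(Y', g, Z) (X, f, Y). (X, g \<cdot>\<^bsub>M\<^esub> f, Z))\<rparr>"


section \<open>Chosen finite products and the cartesian monoidal structure\<close>

definition is_terminal :: "('o, 'a, 'm) cat_scheme \<Rightarrow> 'o \<Rightarrow> bool" where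
  "is_terminal C T \<longleftrightarrow> T \<in> Obj C \<and> (\<forall>A \<in> Obj C. \<exists>!f. f \<in> hom C A T)"

definition is_product :: "('o, 'a, 'm) cat_scheme \<Rightarrow> 'o \<Rightarrow> 'o \<Rightarrow> 'o \<Rightarrow> 'a \<Rightarrow> 'a \<Rightarrow> bool" where
  "is_product C A B P p q \<longleftrightarrow> P \<in> Obj C \<and> p \<in> hom C P A \<and> q \<in> hom C P B \<and>
     (\<forall>X \<in> Obj C. \<forall>f \<in> hom C X A. \<forall>g \<in> hom C X B.
        \<exists>!h. h \<in> hom C X P \<and> p \<cdot>\<^bsub>C\<^esub> h = f \<and> q \<cdot>\<^bsub>C\<^esub> h = g)"

locale finite_products = category C
  for C :: "('o, 'a, 'm) cat_scheme" (structure) +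
  fixes T :: 'o
    and P :: "'o \<Rightarrow> 'o \<Rightarrow> 'o"
    and p :: "'o \<Rightarrow> 'o \<Rightarrow> 'a"
    and q :: "'o \<Rightarrow> 'o \<Rightarrow> 'a"
  assumes terminal: "is_terminal C T"
    and product: "A \<in> Obj C \<Longrightarrow> B \<in> Obj C \<Longrightarrow> is_product C A B (P A B) (p A B) (q A B)"

definition pairing :: "('o, 'a, 'm) cat_scheme \<Rightarrow> ('o \<Rightarrow> 'o \<Rightarrow> 'o) \<Rightarrow> ('o \<Rightarrow> 'o \<Rightarrow> 'a) \<Rightarrow>
    ('o \<Rightarrow> 'o \<Rightarrow> 'a) \<Rightarrow> 'a \<Rightarrow> 'a \<Rightarrow> 'a" where
  "pairing C P p q f g = (THE h. h \<in> hom C (Dom C f) (P (Cod C f) (Cod C g)) \<and>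
     p (Cod C f) (Cod C g) \<cdot>\<^bsub>C\<^esub> h = f \<and> q (Cod C f) (Cod C g) \<cdot>\<^bsub>C\<^esub> h = g)"

definition cartesian_moncat :: "('o, 'a, 'm) cat_scheme \<Rightarrow> 'o \<Rightarrow> ('o \<Rightarrow> 'o \<Rightarrow> 'o) \<Rightarrow>
    ('o \<Rightarrow> 'o \<Rightarrow> 'a) \<Rightarrow> ('o \<Rightarrow> 'o \<Rightarrow> 'a) \<Rightarrow> ('o, 'a) moncat" where
  "cartesian_moncat C T P p q = \<lparr>
     Obj = Obj C, Arr = Arr C, Dom = Dom C, Cod = Cod C, Ident = Ident C, Comp = Comp C,
     TObj = P,
     TArr = (\<lambda>f g. pairing C P p q (f \<cdot>\<^bsub>C\<^esub> p (Dom C f) (Dom C g)) (g \<cdot>\<^bsub>C\<^esub> q (Dom C f) (Dom C g))),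
     TUnit = T,
     TAssoc = (\<lambda>A B E. pairing C P p q
        (p A B \<cdot>\<^bsub>C\<^esub> p (P A B) E)
        (pairing C P p q (q A B \<cdot>\<^bsub>C\<^esub> p (P A B) E) (q (P A B) E))),
     TLUnit = (\<lambda>A. q T A),
     TRUnit = (\<lambda>A. p A T)\<rparr>"


section \<open>Finite ordinals, simplicial objects\<close>

definition mono_maps :: "nat \<Rightarrow> nat \<Rightarrow> (nat \<Rightarrow> nat) set" where
  "mono_maps n m = {u \<in> {..<n} \<rightarrow>\<^sub>E {..<m}. mono_on {..<n} u}"

text \<open>The ordinal sum \<open>u + u'\<close> of \<open>u : n \<rightarrow> m\<close> and \<open>u' : n' \<rightarrow> m'\<close> does not depend on \<open>m'\<close>.\<close>

definition ord_sum ::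
    "nat \<Rightarrow> nat \<Rightarrow> nat \<Rightarrow> (nat \<Rightarrow> nat) \<Rightarrow> (nat \<Rightarrow> nat) \<Rightarrow> nat \<Rightarrow> nat" where
  "ord_sum n m n' u u' = (\<lambda>i \<in> {..<n + n'}. if i < n then u i else m + u' (i - n))"

definition delta :: "(nat, nat \<times> (nat \<Rightarrow> nat) \<times> nat) moncat" where
  "delta = \<lparr>
     Obj = UNIV,
     Arr = {(n, u, m). u \<in> mono_maps n m},
     Dom = (\<lambda>(n, u, m). n),
     Cod = (\<lambda>(n, u, m). m),
     Ident = (\<lambda>n. (n, \<lambda>i \<in> {..<n}. i, n)),
     Comp = (\<lambda>(m', v, k) (n, u, m). (n, compose {..<n} v u, k)),
     TObj = (+),
     TArr = (\<lambda>(n, u, m) (n', u', m'). (n + n', ord_sum n m n' u u', m + m')),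
     TUnit = 0,
     TAssoc = (\<lambda>n m k. (n + m + k, \<lambda>i \<in> {..<n + m + k}. i, n + m + k)),
     TLUnit = (\<lambda>n. (n, \<lambda>i \<in> {..<n}. i, n)),
     TRUnit = (\<lambda>n. (n, \<lambda>i \<in> {..<n}. i, n))\<rparr>"

definition delta_plus :: "(nat, nat \<times> (nat \<Rightarrow> nat) \<times> nat) cat" where
  "delta_plus = full_subcat delta {n. n > 0}"

abbreviation simplicial_cat where
  "simplicial_cat C \<equiv> functor_cat (opposite delta_plus) C"


section \<open>Up-to-homotopy monoids\<close>

record ('o, 'a, 'p, 'b) colax_mon = "('o, 'a, 'p, 'b) func" +
  Xi :: "'o \<Rightarrow> 'o \<Rightarrow> 'b"
  Xi0 :: 'b

locale colax_monoidal_functor =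
  cat_functor C D Y + dom: monoidal_category C + cod: monoidal_category D
  for C :: "('o, 'a, 'm) moncat_scheme" and D :: "('p, 'b, 'n) moncat_scheme"
    and Y :: "('o, 'a, 'p, 'b) colax_mon" +
  assumes xi_ext: "(\<lambda>(A, B). Xi Y A B) \<in> extensional (Obj C \<times> Obj C)"
    and xi_hom: "A \<in> Obj C \<Longrightarrow> B \<in> Obj C \<Longrightarrow>
      Xi Y A B \<in> hom D (FObj Y (A \<otimes>\<^bsub>C\<^esub> B)) (FObj Y A \<otimes>\<^bsub>D\<^esub> FObj Y B)"
    and xi_natural: "f \<in> hom C A A' \<Longrightarrow> g \<in> hom C B B' \<Longrightarrow>
      Xi Y A' B' \<cdot>\<^bsub>D\<^esub> FArr Y (f \<boxtimes>\<^bsub>C\<^esub> g) = (FArr Y f \<boxtimes>\<^bsub>D\<^esub> FArr Y g) \<cdot>\<^bsub>D\<^esub> Xi Y A B"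
    and xi0_hom: "Xi0 Y \<in> hom D (FObj Y \<I>\<^bsub>C\<^esub>) \<I>\<^bsub>D\<^esub>"
    and xi_assoc: "A \<in> Obj C \<Longrightarrow> B \<in> Obj C \<Longrightarrow> E \<in> Obj C \<Longrightarrow>
      TAssoc D (FObj Y A) (FObj Y B) (FObj Y E) \<cdot>\<^bsub>D\<^esub>
        (Xi Y A B \<boxtimes>\<^bsub>D\<^esub> Ident D (FObj Y E)) \<cdot>\<^bsub>D\<^esub> Xi Y (A \<otimes>\<^bsub>C\<^esub> B) E =
      (Ident D (FObj Y A) \<boxtimes>\<^bsub>D\<^esub> Xi Y B E) \<cdot>\<^bsub>D\<^esub> Xi Y A (B \<otimes>\<^bsub>C\<^esub> E) \<cdot>\<^bsub>D\<^esub> FArr Y (TAssoc C A B E)"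
    and xi_lunit: "A \<in> Obj C \<Longrightarrow>
      TLUnit D (FObj Y A) \<cdot>\<^bsub>D\<^esub> (Xi0 Y \<boxtimes>\<^bsub>D\<^esub> Ident D (FObj Y A)) \<cdot>\<^bsub>D\<^esub> Xi Y \<I>\<^bsub>C\<^esub> A =
      FArr Y (TLUnit C A)"
    and xi_runit: "A \<in> Obj C \<Longrightarrow>
      TRUnit D (FObj Y A) \<cdot>\<^bsub>D\<^esub> (Ident D (FObj Y A) \<boxtimes>\<^bsub>D\<^esub> Xi0 Y) \<cdot>\<^bsub>D\<^esub> Xi Y A \<I>\<^bsub>C\<^esub> =
      FArr Y (TRUnit C A)"

locale monoidal_nat_trans =
  src: colax_monoidal_functor C D Y + trg: colax_monoidal_functor C D Z + nat_trans C D Y Z \<sigma>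
  for C :: "('o, 'a, 'm) moncat_scheme" and D :: "('p, 'b, 'n) moncat_scheme"
    and Y :: "('o, 'a, 'p, 'b) colax_mon" and Z :: "('o, 'a, 'p, 'b) colax_mon"
    and \<sigma> :: "'o \<Rightarrow> 'b" +
  assumes xi_comm: "A \<in> Obj C \<Longrightarrow> B \<in> Obj C \<Longrightarrow>
      Xi Z A B \<cdot>\<^bsub>D\<^esub> \<sigma> (A \<otimes>\<^bsub>C\<^esub> B) = (\<sigma> A \<boxtimes>\<^bsub>D\<^esub> \<sigma> B) \<cdot>\<^bsub>D\<^esub> Xi Y A B"
    and xi0_comm: "Xi0 Z \<cdot>\<^bsub>D\<^esub> \<sigma> \<I>\<^bsub>C\<^esub> = Xi0 Y"

definition is_homotopy_monoid ::
    "('p, 'b, 'n) moncat_scheme \<Rightarrow> 'b set \<Rightarrow>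
     (nat, nat \<times> (nat \<Rightarrow> nat) \<times> nat, 'p, 'b) colax_mon \<Rightarrow> bool" where
  "is_homotopy_monoid M W Y \<longleftrightarrow>
     colax_monoidal_functor delta M Y \<and> (\<forall>m n. Xi Y m n \<in> W) \<and> Xi0 Y \<in> W"

definition homotopy_monoid_cat where
  "homotopy_monoid_cat M W = \<lparr>
     Obj = {Y. is_homotopy_monoid M W Y},
     Arr = {(Y, \<sigma>, Z). is_homotopy_monoid M W Y \<and> is_homotopy_monoid M W Z \<and>
                        monoidal_nat_trans delta M Y Z \<sigma>},
     Dom = (\<lambda>(Y, \<sigma>, Z). Y),
     Cod = (\<lambda>(Y, \<sigma>, Z). Z),
     Ident = (\<lambda>Y. (Y, \<lambda>n. Ident M (FObj Y n), Y)),
     Comp = (\<lambda>(Y', \<tau>, Z) (X, \<sigma>, Y). (X, \<lambda>n. \<tau> n \<cdot>\<^bsub>M\<^esub> \<sigma> n, Z))\<rparr>"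


section \<open>Bicategories and colax morphisms\<close>

text \<open>The hom-categories are packaged into one category, their disjoint union: its objects are
  all 1-cells, its arrows all 2-cells, its composition the vertical one. The hom-category from
  \<open>A\<close> to \<open>B\<close> is the full subcategory on the 1-cells with source \<open>A\<close> and target \<open>B\<close>; 2-cells
  only exist between parallel 1-cells. A family of functors between hom-categories is thus one
  functor compatible with sources and targets.\<close>

record ('c, 'o, 'a) bicat = "('o, 'a) cat" +
  Cells0 :: "'c set"
  Src :: "'o \<Rightarrow> 'c"
  Trg :: "'o \<Rightarrow> 'c"
  HObj :: "'o \<Rightarrow> 'o \<Rightarrow> 'o"  (infixr \<open>\<odot>\<index>\<close> 75)
  HArr :: "'a \<Rightarrow> 'a \<Rightarrow> 'a"  (infixr \<open>\<star>\<index>\<close> 75)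
  HUnit :: "'c \<Rightarrow> 'o"
  HAssoc :: "'o \<Rightarrow> 'o \<Rightarrow> 'o \<Rightarrow> 'a"
  HLUnit :: "'o \<Rightarrow> 'a"
  HRUnit :: "'o \<Rightarrow> 'a"

definition hcomposable :: "('c, 'o, 'a, 'm) bicat_scheme \<Rightarrow> ('o \<times> 'o) set" where
  "hcomposable B = {(g, f). g \<in> Obj B \<and> f \<in> Obj B \<and> Src B g = Trg B f}"

locale bicategory = category B
  for B :: "('c, 'o, 'a, 'm) bicat_scheme" (structure) +
  assumes src: "f \<in> Obj B \<Longrightarrow> Src B f \<in> Cells0 B"
    and trg: "f \<in> Obj B \<Longrightarrow> Trg B f \<in> Cells0 B"
    and parallel: "\<alpha> \<in> hom B f f' \<Longrightarrow> Src B f = Src B f' \<and> Trg B f = Trg B f'"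
    and hobj: "(g, f) \<in> hcomposable B \<Longrightarrow>
      g \<odot> f \<in> Obj B \<and> Src B (g \<odot> f) = Src B f \<and> Trg B (g \<odot> f) = Trg B g"
    and harr: "(g, f) \<in> hcomposable B \<Longrightarrow> \<alpha> \<in> hom B f f' \<Longrightarrow> \<beta> \<in> hom B g g' \<Longrightarrow>
      \<beta> \<star> \<alpha> \<in> hom B (g \<odot> f) (g' \<odot> f')"
    and harr_ident: "(g, f) \<in> hcomposable B \<Longrightarrow> Ident B g \<star> Ident B f = Ident B (g \<odot> f)"
    and interchange: "(g, f) \<in> hcomposable B \<Longrightarrow>
      \<alpha> \<in> hom B f f' \<Longrightarrow> \<alpha>' \<in> hom B f' f'' \<Longrightarrow> \<beta> \<in> hom B g g' \<Longrightarrow> \<beta>' \<in> hom B g' g'' \<Longrightarrow>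
      (\<beta>' \<cdot> \<beta>) \<star> (\<alpha>' \<cdot> \<alpha>) = (\<beta>' \<star> \<alpha>') \<cdot> (\<beta> \<star> \<alpha>)"
    and hunit: "x \<in> Cells0 B \<Longrightarrow>
      HUnit B x \<in> Obj B \<and> Src B (HUnit B x) = x \<and> Trg B (HUnit B x) = x"
    and assoc_hom: "(h, g) \<in> hcomposable B \<Longrightarrow> (g, f) \<in> hcomposable B \<Longrightarrow>
      HAssoc B h g f \<in> hom B ((h \<odot> g) \<odot> f) (h \<odot> (g \<odot> f)) \<inter> isos B"
    and assoc_natural: "(h, g) \<in> hcomposable B \<Longrightarrow> (g, f) \<in> hcomposable B \<Longrightarrow>
      \<alpha> \<in> hom B f f' \<Longrightarrow> \<beta> \<in> hom B g g' \<Longrightarrow> \<gamma> \<in> hom B h h' \<Longrightarrow>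
      HAssoc B h' g' f' \<cdot> ((\<gamma> \<star> \<beta>) \<star> \<alpha>) = (\<gamma> \<star> (\<beta> \<star> \<alpha>)) \<cdot> HAssoc B h g f"
    and lunit_hom: "f \<in> Obj B \<Longrightarrow> HLUnit B f \<in> hom B (HUnit B (Trg B f) \<odot> f) f \<inter> isos B"
    and lunit_natural: "\<alpha> \<in> hom B f f' \<Longrightarrow>
      HLUnit B f' \<cdot> (Ident B (HUnit B (Trg B f)) \<star> \<alpha>) = \<alpha> \<cdot> HLUnit B f"
    and runit_hom: "f \<in> Obj B \<Longrightarrow> HRUnit B f \<in> hom B (f \<odot> HUnit B (Src B f)) f \<inter> isos B"
    and runit_natural: "\<alpha> \<in> hom B f f' \<Longrightarrow>
      HRUnit B f' \<cdot> (\<alpha> \<star> Ident B (HUnit B (Src B f))) = \<alpha> \<cdot> HRUnit B f"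
    and pentagon: "(k, h) \<in> hcomposable B \<Longrightarrow> (h, g) \<in> hcomposable B \<Longrightarrow>
      (g, f) \<in> hcomposable B \<Longrightarrow>
      (Ident B k \<star> HAssoc B h g f) \<cdot> HAssoc B k (h \<odot> g) f \<cdot> (HAssoc B k h g \<star> Ident B f) =
      HAssoc B k h (g \<odot> f) \<cdot> HAssoc B (k \<odot> h) g f"
    and triangle: "(g, f) \<in> hcomposable B \<Longrightarrow>
      (Ident B g \<star> HLUnit B f) \<cdot> HAssoc B g (HUnit B (Src B g)) f = HRUnit B g \<star> Ident B f"

definition one_object_bicat :: "('o, 'a, 'm) moncat_scheme \<Rightarrow> (unit, 'o, 'a) bicat" where
  "one_object_bicat M = \<lparr>
     Obj = Obj M, Arr = Arr M, Dom = Dom M, Cod = Cod M, Ident = Ident M, Comp = Comp M,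
     Cells0 = {()}, Src = (\<lambda>_. ()), Trg = (\<lambda>_. ()),
     HObj = TObj M, HArr = TArr M, HUnit = (\<lambda>_. TUnit M),
     HAssoc = TAssoc M, HLUnit = TLUnit M, HRUnit = TRUnit M\<rparr>"

locale base_of_enrichment = bicategory B
  for B :: "('c, 'o, 'a, 'm) bicat_scheme" (structure) +
  fixes W :: "'a set"
  assumes W_arr: "W \<subseteq> Arr B"
    and W_isos: "isos B \<subseteq> W"
    and W_comp: "\<alpha> \<in> hom B f g \<Longrightarrow> \<beta> \<in> hom B g h \<Longrightarrow> \<alpha> \<in> W \<Longrightarrow> \<beta> \<in> W \<Longrightarrow> \<beta> \<cdot> \<alpha> \<in> W"
    and W_cancel_left: "\<alpha> \<in> hom B f g \<Longrightarrow> \<beta> \<in> hom B g h \<Longrightarrow> \<beta> \<in> W \<Longrightarrow> \<beta> \<cdot> \<alpha> \<in> W \<Longrightarrow> \<alpha> \<in> W"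
    and W_cancel_right: "\<alpha> \<in> hom B f g \<Longrightarrow> \<beta> \<in> hom B g h \<Longrightarrow> \<alpha> \<in> W \<Longrightarrow> \<beta> \<cdot> \<alpha> \<in> W \<Longrightarrow> \<beta> \<in> W"
    and W_horizontal: "(g, f) \<in> hcomposable B \<Longrightarrow> \<alpha> \<in> hom B f f' \<Longrightarrow> \<beta> \<in> hom B g g' \<Longrightarrow>
      \<alpha> \<in> W \<Longrightarrow> \<beta> \<in> W \<Longrightarrow> \<beta> \<star> \<alpha> \<in> W"

record ('c, 'o, 'a, 'd, 'p, 'b) colax = "('o, 'a, 'p, 'b) func" +
  F0 :: "'c \<Rightarrow> 'd"
  Phi :: "'o \<Rightarrow> 'o \<Rightarrow> 'b"
  Phi0 :: "'c \<Rightarrow> 'b"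

locale colax_morphism = cat_functor B D F + dom: bicategory B + cod: bicategory D
  for B :: "('c, 'o, 'a, 'm) bicat_scheme" and D :: "('d, 'p, 'b, 'n) bicat_scheme"
    and F :: "('c, 'o, 'a, 'd, 'p, 'b) colax" +
  assumes f0: "F0 F \<in> Cells0 B \<rightarrow>\<^sub>E Cells0 D"
    and fobj_src: "f \<in> Obj B \<Longrightarrow> Src D (FObj F f) = F0 F (Src B f)"
    and fobj_trg: "f \<in> Obj B \<Longrightarrow> Trg D (FObj F f) = F0 F (Trg B f)"
    and phi_ext: "(\<lambda>(g, f). Phi F g f) \<in> extensional (hcomposable B)"
    and phi_hom: "(g, f) \<in> hcomposable B \<Longrightarrow>
      Phi F g f \<in> hom D (FObj F (g \<odot>\<^bsub>B\<^esub> f)) (FObj F g \<odot>\<^bsub>D\<^esub> FObj F f)"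
    and phi_natural: "(g, f) \<in> hcomposable B \<Longrightarrow> \<alpha> \<in> hom B f f' \<Longrightarrow> \<beta> \<in> hom B g g' \<Longrightarrow>
      Phi F g' f' \<cdot>\<^bsub>D\<^esub> FArr F (\<beta> \<star>\<^bsub>B\<^esub> \<alpha>) = (FArr F \<beta> \<star>\<^bsub>D\<^esub> FArr F \<alpha>) \<cdot>\<^bsub>D\<^esub> Phi F g f"
    and phi0_ext: "Phi0 F \<in> extensional (Cells0 B)"
    and phi0_hom: "x \<in> Cells0 B \<Longrightarrow>
      Phi0 F x \<in> hom D (FObj F (HUnit B x)) (HUnit D (F0 F x))"
    and phi_assoc: "(h, g) \<in> hcomposable B \<Longrightarrow> (g, f) \<in> hcomposable B \<Longrightarrow>
      HAssoc D (FObj F h) (FObj F g) (FObj F f) \<cdot>\<^bsub>D\<^esub>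
        (Phi F h g \<star>\<^bsub>D\<^esub> Ident D (FObj F f)) \<cdot>\<^bsub>D\<^esub> Phi F (h \<odot>\<^bsub>B\<^esub> g) f =
      (Ident D (FObj F h) \<star>\<^bsub>D\<^esub> Phi F g f) \<cdot>\<^bsub>D\<^esub> Phi F h (g \<odot>\<^bsub>B\<^esub> f) \<cdot>\<^bsub>D\<^esub> FArr F (HAssoc B h g f)"
    and phi_lunit: "f \<in> Obj B \<Longrightarrow>
      HLUnit D (FObj F f) \<cdot>\<^bsub>D\<^esub> (Phi0 F (Trg B f) \<star>\<^bsub>D\<^esub> Ident D (FObj F f)) \<cdot>\<^bsub>D\<^esub>
        Phi F (HUnit B (Trg B f)) f =
      FArr F (HLUnit B f)"
    and phi_runit: "f \<in> Obj B \<Longrightarrow>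
      HRUnit D (FObj F f) \<cdot>\<^bsub>D\<^esub> (Ident D (FObj F f) \<star>\<^bsub>D\<^esub> Phi0 F (Src B f)) \<cdot>\<^bsub>D\<^esub>
        Phi F f (HUnit B (Src B f)) =
      FArr F (HRUnit B f)"

text \<open>Transformations of colax morphisms whose 1-cell components are identities.\<close>

locale colax_transformation =
  src: colax_morphism B D F + trg: colax_morphism B D G + nat_trans B D F G \<sigma>
  for B :: "('c, 'o, 'a, 'm) bicat_scheme" and D :: "('d, 'p, 'b, 'n) bicat_scheme"
    and F :: "('c, 'o, 'a, 'd, 'p, 'b) colax" and G :: "('c, 'o, 'a, 'd, 'p, 'b) colax"
    and \<sigma> :: "'o \<Rightarrow> 'b" +
  assumes f0_eq: "F0 F = F0 G"
    and phi_comm: "(t, s) \<in> hcomposable B \<Longrightarrow>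
      Phi G t s \<cdot>\<^bsub>D\<^esub> \<sigma> (t \<odot>\<^bsub>B\<^esub> s) = (\<sigma> t \<star>\<^bsub>D\<^esub> \<sigma> s) \<cdot>\<^bsub>D\<^esub> Phi F t s"
    and phi0_comm: "x \<in> Cells0 B \<Longrightarrow> Phi0 G x \<cdot>\<^bsub>D\<^esub> \<sigma> (HUnit B x) = Phi0 F x"


section \<open>The 2-path-category and points\<close>

fun chain :: "('o, 'a, 'm) cat_scheme \<Rightarrow> 'o \<Rightarrow> 'a list \<Rightarrow> 'o \<Rightarrow> bool" where
  "chain C A [] B \<longleftrightarrow> A \<in> Obj C \<and> A = B"
| "chain C A (f # fs) B \<longleftrightarrow> f \<in> Arr C \<and> Dom C f = A \<and> chain C (Cod C f) fs B"

text \<open>The composite, in order, of a list of composable arrows; the object only matters for the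
  empty list.\<close>

fun composite :: "('o, 'a, 'm) cat_scheme \<Rightarrow> 'o \<Rightarrow> 'a list \<Rightarrow> 'a" where
  "composite C A [] = Ident C A"
| "composite C A (f # fs) = composite C (Cod C f) fs \<cdot>\<^bsub>C\<^esub> f"

text \<open>The chain \<open>[n, s]\<close> from \<open>A\<close> to \<open>B\<close> is represented by \<open>(A, [f\<^sub>0, \<dots>, f\<^sub>n\<^sub>-\<^sub>1], B)\<close>. When the
  fibre over \<open>j\<close> is empty, the condition on 2-cells says that the \<open>j\<close>-th arrow is an identity.\<close>

type_synonym ('o, 'a) path = "'o \<times> 'a list \<times> 'o"

fun path_arrows :: "('o, 'a) path \<Rightarrow> 'a list" where
  "path_arrows (A, fs, B) = fs"

abbreviation path_length :: "('o, 'a) path \<Rightarrow> nat" where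
  "path_length s \<equiv> length (path_arrows s)"

definition paths :: "('o, 'a, 'm) cat_scheme \<Rightarrow> ('o, 'a) path set" where
  "paths C = {(A, fs, B). chain C A fs B}"

fun path_src :: "('o, 'a) path \<Rightarrow> 'o" where
  "path_src (A, fs, B) = A"

fun path_trg :: "('o, 'a) path \<Rightarrow> 'o" where
  "path_trg (A, fs, B) = B"

fun path_concat :: "('o, 'a) path \<Rightarrow> ('o, 'a) path \<Rightarrow> ('o, 'a) path" where
  "path_concat (B, gs, D) (A, fs, B') = (A, fs @ gs, D)"

definition path_cell ::
    "('o, 'a, 'm) cat_scheme \<Rightarrow> ('o, 'a) path \<Rightarrow> (nat \<Rightarrow> nat) \<Rightarrow> ('o, 'a) path \<Rightarrow> bool" where
  "path_cell C s u t \<longleftrightarrow>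
     s \<in> paths C \<and> t \<in> paths C \<and> path_src s = path_src t \<and> path_trg s = path_trg t \<and>
     u \<in> mono_maps (path_length s) (path_length t) \<and>
     (\<forall>j < path_length t. path_arrows t ! j =
        composite C (Dom C (path_arrows t ! j))
          (map ((!) (path_arrows s)) (filter (\<lambda>i. u i = j) [0..<path_length s])))"

definition path_ident :: "('o, 'a) path \<Rightarrow> ('o, 'a) path \<times> (nat \<Rightarrow> nat) \<times> ('o, 'a) path" where
  "path_ident s = (s, \<lambda>i \<in> {..<path_length s}. i, s)"

definition path_bicat :: "('o, 'a, 'm) cat_scheme \<Rightarrow>
    ('o, ('o, 'a) path, ('o, 'a) path \<times> (nat \<Rightarrow> nat) \<times> ('o, 'a) path) bicat" where
  "path_bicat C = \<lparr>
     Obj = paths C,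
     Arr = {(s, u, t). path_cell C s u t},
     Dom = (\<lambda>(s, u, t). s),
     Cod = (\<lambda>(s, u, t). t),
     Ident = path_ident,
     Comp = (\<lambda>(t', v, r) (s, u, t). (s, compose {..<path_length s} v u, r)),
     Cells0 = Obj C,
     Src = path_src,
     Trg = path_trg,
     HObj = path_concat,
     HArr = (\<lambda>(t, u', t') (s, u, s'). (path_concat t s,
        ord_sum (path_length s) (path_length s') (path_length t) u u', path_concat t' s')),
     HUnit = (\<lambda>A. (A, [], A)),
     HAssoc = (\<lambda>r t s. path_ident (path_concat r (path_concat t s))),
     HLUnit = path_ident,
     HRUnit = path_ident\<rparr>"

definition is_point where
  "is_point C B W F \<longleftrightarrow> colax_morphism (path_bicat C) B F \<and>
     (\<forall>(t, s) \<in> hcomposable (path_bicat C). Phi F t s \<in> W) \<and>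
     (\<forall>A \<in> Cells0 (path_bicat C). Phi0 F A \<in> W)"

definition point_cat where
  "point_cat C B W = \<lparr>
     Obj = {F. is_point C B W F},
     Arr = {(F, \<sigma>, G). is_point C B W F \<and> is_point C B W G \<and>
                        colax_transformation (path_bicat C) B F G \<sigma>},
     Dom = (\<lambda>(F, \<sigma>, G). F),
     Cod = (\<lambda>(F, \<sigma>, G). G),
     Ident = (\<lambda>F. (F, \<lambda>s \<in> paths C. Ident B (FObj F s), F)),
     Comp = (\<lambda>(G', \<tau>, H) (F, \<sigma>, G). (F, \<lambda>s \<in> paths C. \<tau> s \<cdot>\<^bsub>B\<^esub> \<sigma> s, H))\<rparr>"

end

theory Submission
  imports Defs
begin

text \<open>The hom-category of the 2-path-category of \<open>\<one>\<close> is \<open>\<Delta>\<close>, with the ordinal sum taken in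
  reverse order; reversing the ordinals therefore turns points into colax monoidal functors
  \<open>\<Delta> \<rightarrow> M\<close>, which gives (ii). A strong monoidal functor on \<open>\<Delta>\<close> is determined by its value on the
  monoid \<open>1\<close>, because this monoid generates \<open>\<Delta>\<close>; conversely a monoid \<open>A\<close> acts on \<open>\<Delta>\<close> through its
  tensor powers, a nondecreasing map being the ordinal sum of maps to \<open>1\<close>. For (iii), the two
  projections of \<open>\<xi>\<^sub>m\<^sub>n : Y(m + n) \<rightarrow> Y(m) \<times> Y(n)\<close> are the front and back faces of a simplicial object with
  \<open>n\<close>-simplices \<open>Y(n)\<close>, whose remaining structure comes from the duality between \<open>\<Delta>\<close> and the category
  of nonempty ordinals with endpoint-preserving maps.\<close>

section \<open>Generalities on categories\<close>

text \<open>All equivalences are obtained as fully faithful, essentially surjective functors, which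
  compose and are inverted by choice. Passing from points to homotopy monoids is such a functor for
  any \<open>W\<close>; with \<open>W\<close> the isomorphisms or all arrows, (i) and (iii) become
  statements about colax functors on \<open>delta\<close>.

  In (i), \<open>M\<close> is not strict. Tensor powers are kept left-nested, so canonical
  rebracketings enter, controlled by the pentagon and by the unit coherence that follows from it and
  the triangle. Inductions over \<open>delta\<close> peel off the fibre over the last point, because
  this matches the left nesting.

  In (iii), the obstacle is the operators that do not preserve endpoints. A nondecreasing map of
  nonempty ordinals factors uniquely as an endpoint-preserving map followed by the inclusion of an
  interval. The former are dual to arrows of \<open>delta\<close>, with n+1 read as the set of cuts
  of n; the latter act through iterated projections of \<xi>. Functoriality amounts to factoring a
  composite of two such maps, which is done by splitting an arrow of \<open>delta\<close> into a sum
  of three.\<close>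

context category
begin

lemma homI: "f \<in> Arr C \<Longrightarrow> Dom C f = X \<Longrightarrow> Cod C f = Y \<Longrightarrow> f \<in> hom C X Y"
  by (simp add: hom_def)

lemma comp_simps [simp]:
  assumes "f \<in> Arr C" "g \<in> Arr C" "Cod C f = Dom C g"
  shows "g \<cdot> f \<in> Arr C" "Dom C (g \<cdot> f) = Dom C f" "Cod C (g \<cdot> f) = Cod C g"
  using comp_hom[of f "Dom C f" "Cod C f" g "Cod C g"] assms by (auto simp: hom_def)

lemma ident_simps [simp]:
  assumes "A \<in> Obj C"
  shows "Ident C A \<in> Arr C" "Dom C (Ident C A) = A" "Cod C (Ident C A) = A"
  using ident_hom[OF assms] by (auto simp: hom_def)

lemma comp_ident_simp [simp]: "f \<in> Arr C \<Longrightarrow> X = Dom C f \<Longrightarrow> f \<cdot> Ident C X = f"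
  using comp_ident by (auto simp: hom_def)

lemma ident_comp_simp [simp]: "f \<in> Arr C \<Longrightarrow> X = Cod C f \<Longrightarrow> Ident C X \<cdot> f = f"
  using ident_comp by (auto simp: hom_def)

lemma assoc [simp]:
  assumes "f \<in> Arr C" "g \<in> Arr C" "h \<in> Arr C" "Cod C f = Dom C g" "Cod C g = Dom C h"
  shows "(h \<cdot> g) \<cdot> f = h \<cdot> (g \<cdot> f)"
  using comp_assoc[of f "Dom C f" "Cod C f" g "Cod C g" h "Cod C h"] assms by (auto simp: hom_def)

lemma obj_simps [simp]: "f \<in> Arr C \<Longrightarrow> Dom C f \<in> Obj C" "f \<in> Arr C \<Longrightarrow> Cod C f \<in> Obj C"
  using dom_obj cod_obj by auto

text \<open>The simplifier nests composites to the right, so that an equation for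
  \<open>g \<cdot> f\<close> no longer matches once a further arrow \<open>k\<close> is composed.
  This rule restores the match.\<close>

lemma comp_reduce:
  assumes "g \<cdot> f = h" "f \<in> Arr C" "g \<in> Arr C" "Cod C f = Dom C g" "k \<in> Arr C" "Cod C k = Dom C f"
  shows "g \<cdot> (f \<cdot> k) = h \<cdot> k"
  unfolding assms(1)[symmetric] using assms(2-) by simp

definition inverse :: "'a \<Rightarrow> 'a" where
  "inverse f = (SOME g. g \<in> Arr C \<and> Dom C g = Cod C f \<and> Cod C g = Dom C f \<and>
     g \<cdot> f = Ident C (Dom C f) \<and> f \<cdot> g = Ident C (Cod C f))"

lemma isos_arr [simp]: "f \<in> isos C \<Longrightarrow> f \<in> Arr C"
  by (simp add: isos_def)

lemma isosI:
  assumes "f \<in> Arr C" "g \<in> Arr C" "Dom C g = Cod C f" "Cod C g = Dom C f"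
    "g \<cdot> f = Ident C (Dom C f)" "f \<cdot> g = Ident C (Cod C f)"
  shows "f \<in> isos C"
  unfolding isos_def hom_def mem_Collect_eq using assms by blast

lemma inverse_simps [simp]:
  assumes "f \<in> isos C"
  shows "inverse f \<in> Arr C" "Dom C (inverse f) = Cod C f" "Cod C (inverse f) = Dom C f"
    "inverse f \<cdot> f = Ident C (Dom C f)" "f \<cdot> inverse f = Ident C (Cod C f)"
proof -
  have "\<exists>g. g \<in> Arr C \<and> Dom C g = Cod C f \<and> Cod C g = Dom C f \<and>
     g \<cdot> f = Ident C (Dom C f) \<and> f \<cdot> g = Ident C (Cod C f)"
    using assms unfolding isos_def hom_def by blast
  from someI_ex[OF this, folded inverse_def]
  show "inverse f \<in> Arr C" "Dom C (inverse f) = Cod C f" "Cod C (inverse f) = Dom C f"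
    "inverse f \<cdot> f = Ident C (Dom C f)" "f \<cdot> inverse f = Ident C (Cod C f)"
    by blast+
qed

lemma inverse_comp_simps [simp]:
  assumes "f \<in> isos C" "k \<in> Arr C"
  shows "Cod C k = Dom C f \<Longrightarrow> inverse f \<cdot> (f \<cdot> k) = k"
    "Cod C k = Cod C f \<Longrightarrow> f \<cdot> (inverse f \<cdot> k) = k"
  using assms by (simp_all flip: assoc)

lemma inverse_isos [simp]: "f \<in> isos C \<Longrightarrow> inverse f \<in> isos C"
  by (rule isosI[of _ f]) auto

lemma isos_comp [simp]:
  assumes "f \<in> isos C" "g \<in> isos C" "Cod C f = Dom C g"
  shows "g \<cdot> f \<in> isos C"
  by (rule isosI[of _ "inverse f \<cdot> inverse g"]) (use assms in auto)

lemma isos_ident [simp]: "A \<in> Obj C \<Longrightarrow> Ident C A \<in> isos C"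
  by (rule isosI[of _ "Ident C A"]) auto

lemma iso_cancel_left:
  assumes "i \<cdot> f = i \<cdot> g" "i \<in> isos C" "f \<in> Arr C" "g \<in> Arr C" "Cod C f = Dom C i" "Cod C g = Dom C i"
  shows "f = g"
proof -
  have "inverse i \<cdot> (i \<cdot> f) = inverse i \<cdot> (i \<cdot> g)" using assms(1) by simp
  then show ?thesis using assms(2-) by (simp only: inverse_comp_simps)
qed

lemma iso_cancel_right:
  assumes "f \<cdot> i = g \<cdot> i" "i \<in> isos C" "f \<in> Arr C" "g \<in> Arr C" "Cod C i = Dom C f" "Cod C i = Dom C g"
  shows "f = g"
proof -
  have "(f \<cdot> i) \<cdot> inverse i = (g \<cdot> i) \<cdot> inverse i" using assms(1) by simp
  then show ?thesis using assms(2-) by (simp only: assoc inverse_simps comp_ident_simp isos_arr)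
qed

end

section \<open>Fully faithful, essentially surjective functors\<close>

definition weak_equivalence ::
  "('o, 'a, 'm) cat_scheme \<Rightarrow> ('p, 'b, 'n) cat_scheme \<Rightarrow> ('o, 'a, 'p, 'b) func \<Rightarrow> bool" where
  "weak_equivalence C D F \<longleftrightarrow> cat_functor C D F \<and>
     (\<forall>A \<in> Obj C. \<forall>B \<in> Obj C.
        bij_betw (FArr F) (hom C A B) (hom D (FObj F A) (FObj F B))) \<and>
     (\<forall>Y \<in> Obj D. \<exists>A \<in> Obj C. \<exists>i \<in> isos D. Dom D i = FObj F A \<and> Cod D i = Y)"

lemma weak_equivalence_bij:
  assumes "weak_equivalence C D F" "A \<in> Obj C" "B \<in> Obj C"
  shows "bij_betw (FArr F) (hom C A B) (hom D (FObj F A) (FObj F B))"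
  using assms by (simp add: weak_equivalence_def)

lemma weak_equivalence_eso:
  assumes "weak_equivalence C D F" "Y \<in> Obj D"
  obtains A i where "A \<in> Obj C" "i \<in> isos D" "Dom D i = FObj F A" "Cod D i = Y"
proof -
  have "\<forall>Y \<in> Obj D. \<exists>A \<in> Obj C. \<exists>i \<in> isos D. Dom D i = FObj F A \<and> Cod D i = Y"
    using assms(1) unfolding weak_equivalence_def by (elim conjE)
  then show ?thesis using assms(2) that by blast
qed

context cat_functor
begin

lemma fobj_simp [simp]: "A \<in> Obj C \<Longrightarrow> FObj F A \<in> Obj D"
  using fobj by auto

lemma farr_simps [simp]:
  assumes "f \<in> Arr C"
  shows "FArr F f \<in> Arr D" "Dom D (FArr F f) = FObj F (Dom C f)" "Cod D (FArr F f) = FObj F (Cod C f)"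
  using farr_hom[of f "Dom C f" "Cod C f"] assms by (auto simp: hom_def)

lemma farr_comp_simp:
  assumes "f \<in> Arr C" "g \<in> Arr C" "Cod C f = Dom C g"
  shows "FArr F (g \<cdot>\<^bsub>C\<^esub> f) = FArr F g \<cdot>\<^bsub>D\<^esub> FArr F f"
  using farr_comp[of f "Dom C f" "Cod C f" g "Cod C g"] assms by (auto simp: hom_def)

end

lemma cat_functorI:
  assumes "category C" "category D"
    and "\<And>A. A \<in> Obj C \<Longrightarrow> FObj F A \<in> Obj D" "FObj F \<in> extensional (Obj C)" "FArr F \<in> extensional (Arr C)"
    and "\<And>f. f \<in> Arr C \<Longrightarrow> FArr F f \<in> Arr D \<and> Dom D (FArr F f) = FObj F (Dom C f) \<and> Cod D (FArr F f) = FObj F (Cod C f)"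
    and "\<And>A. A \<in> Obj C \<Longrightarrow> FArr F (Ident C A) = Ident D (FObj F A)"
    and "\<And>f g. f \<in> Arr C \<Longrightarrow> g \<in> Arr C \<Longrightarrow> Cod C f = Dom C g \<Longrightarrow>
      FArr F (g \<cdot>\<^bsub>C\<^esub> f) = FArr F g \<cdot>\<^bsub>D\<^esub> FArr F f"
  shows "cat_functor C D F"
  using assms by (auto simp: cat_functor_def cat_functor_axioms_def hom_def PiE_def)

lemma id_functor: "category C \<Longrightarrow> cat_functor C C (id_func C)"
  by (rule cat_functorI)
    (auto simp: id_func_def category.comp_simps category.ident_simps category.obj_simps)

lemma comp_functor:
  assumes "cat_functor C D F" "cat_functor D E G"
  shows "cat_functor C E (comp_func C G F)"
proof -
  interpret F: cat_functor C D F by fact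
  interpret G: cat_functor D E G by fact
  show ?thesis
    by (rule cat_functorI)
      (auto simp: F.dom.category_axioms G.cod.category_axioms comp_func_def compose_eq compose_extensional
        F.farr_ident G.farr_ident F.farr_comp_simp G.farr_comp_simp)
qed

lemma nat_transI:
  assumes "cat_functor C D F" "cat_functor C D G" "\<sigma> \<in> extensional (Obj C)"
    and "\<And>A. A \<in> Obj C \<Longrightarrow> \<sigma> A \<in> Arr D \<and> Dom D (\<sigma> A) = FObj F A \<and> Cod D (\<sigma> A) = FObj G A"
    and "\<And>f. f \<in> Arr C \<Longrightarrow> \<sigma> (Cod C f) \<cdot>\<^bsub>D\<^esub> FArr F f = FArr G f \<cdot>\<^bsub>D\<^esub> \<sigma> (Dom C f)"
  shows "nat_trans C D F G \<sigma>"
  using assms by (auto simp: nat_trans_def nat_trans_axioms_def hom_def)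

context nat_trans
begin

lemma component_simps [simp]:
  assumes "A \<in> Obj C"
  shows "\<sigma> A \<in> Arr D" "Dom D (\<sigma> A) = FObj F A" "Cod D (\<sigma> A) = FObj G A"
  using component_hom[OF assms] by (auto simp: hom_def)

lemma natural_simp:
  assumes "f \<in> Arr C"
  shows "\<sigma> (Cod C f) \<cdot>\<^bsub>D\<^esub> FArr F f = FArr G f \<cdot>\<^bsub>D\<^esub> \<sigma> (Dom C f)"
  using natural[of f "Dom C f" "Cod C f"] assms by (auto simp: hom_def)

end

text \<open>A quasi-inverse is obtained by choosing, for each object \<open>Y\<close> of the target, an object \<open>g Y\<close> and
  an isomorphism \<open>e Y\<close> from its image to \<open>Y\<close>.\<close>

lemma weak_equivalence_equivalent:
  assumes "weak_equivalence C D F"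
  shows "equivalent_cats C D"
proof -
  interpret F: cat_functor C D F using assms by (simp add: weak_equivalence_def)
  note [simp] = F.farr_ident F.farr_comp_simp
  have bij: "\<And>A B. A \<in> Obj C \<Longrightarrow> B \<in> Obj C \<Longrightarrow> bij_betw (FArr F) (hom C A B) (hom D (FObj F A) (FObj F B))"
    using assms by (simp add: weak_equivalence_def)
  \<comment> \<open>Equations between arrows of \<open>C\<close> are checked after applying
    \<open>F\<close>, where the lifted arrows are known explicitly.\<close>
  have faithful: "f = g" if "FArr F f = FArr F g" "f \<in> Arr C" "g \<in> Arr C" "Dom C f = Dom C g"
    "Cod C f = Cod C g" for f g
    using bij[of "Dom C f" "Cod C f"] that by (auto simp: bij_betw_def inj_on_def hom_def)
  define lift where "lift A B h = inv_into (hom C A B) (FArr F) h" for A B h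
  have lift: "lift A B h \<in> Arr C" "Dom C (lift A B h) = A" "Cod C (lift A B h) = B" "FArr F (lift A B h) = h"
    if "A \<in> Obj C" "B \<in> Obj C" "h \<in> Arr D" "Dom D h = FObj F A" "Cod D h = FObj F B" for A B h
  proof -
    have h: "h \<in> FArr F ` hom C A B" using bij[of A B] that by (auto simp: bij_betw_def hom_def)
    show "FArr F (lift A B h) = h" using h by (simp add: lift_def f_inv_into_f)
    show "lift A B h \<in> Arr C" "Dom C (lift A B h) = A" "Cod C (lift A B h) = B"
      using inv_into_into[OF h] by (auto simp: lift_def hom_def)
  qed
  have "\<forall>Y \<in> Obj D. \<exists>A i. A \<in> Obj C \<and> i \<in> isos D \<and> Dom D i = FObj F A \<and> Cod D i = Y"
    using assms unfolding weak_equivalence_def by blast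
  then obtain g e where ge: "\<And>Y. Y \<in> Obj D \<Longrightarrow>
      g Y \<in> Obj C \<and> e Y \<in> isos D \<and> Dom D (e Y) = FObj F (g Y) \<and> Cod D (e Y) = Y"
    by metis
  have ge1 [simp]: "g Y \<in> Obj C" "e Y \<in> isos D" "e Y \<in> Arr D" "Dom D (e Y) = FObj F (g Y)"
    "Cod D (e Y) = Y" if "Y \<in> Obj D" for Y using ge[OF that] by auto
  \<comment> \<open>Conjugation by the chosen isomorphisms, lifted along the full functor
    \<open>F\<close>: this is the only choice that makes \<open>e\<close> natural.\<close>
  define ga where "ga h = lift (g (Dom D h)) (g (Cod D h)) (F.cod.inverse (e (Cod D h)) \<cdot>\<^bsub>D\<^esub> (h \<cdot>\<^bsub>D\<^esub> e (Dom D h)))" for h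
  have ga [simp]: "ga h \<in> Arr C" "Dom C (ga h) = g (Dom D h)" "Cod C (ga h) = g (Cod D h)"
    "FArr F (ga h) = F.cod.inverse (e (Cod D h)) \<cdot>\<^bsub>D\<^esub> (h \<cdot>\<^bsub>D\<^esub> e (Dom D h))"
    if "h \<in> Arr D" for h using that by (simp_all add: ga_def lift)
  define G where "G = \<lparr>FObj = (\<lambda>Y \<in> Obj D. g Y), FArr = (\<lambda>h \<in> Arr D. ga h)\<rparr>"
  have G: "cat_functor D C G"
  proof (rule cat_functorI)
    fix A assume "A \<in> Obj D"
    then show "FArr G (Ident D A) = Ident C (FObj G A)"
      by (auto simp: G_def intro!: faithful)
  next
    fix f g assume "f \<in> Arr D" "g \<in> Arr D" "Cod D f = Dom D g"
    then show "FArr G (g \<cdot>\<^bsub>D\<^esub> f) = FArr G g \<cdot>\<^bsub>C\<^esub> FArr G f"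
      by (auto simp: G_def intro!: faithful)
  qed (auto simp: G_def F.dom.category_axioms F.cod.category_axioms)
  define \<eta> where "\<eta> = (\<lambda>A \<in> Obj C. lift A (g (FObj F A)) (F.cod.inverse (e (FObj F A))))"
  have \<eta>: "\<eta> A \<in> Arr C" "Dom C (\<eta> A) = A" "Cod C (\<eta> A) = g (FObj F A)" "FArr F (\<eta> A) = F.cod.inverse (e (FObj F A))"
    if "A \<in> Obj C" for A using that by (simp_all add: \<eta>_def lift)
  define \<epsilon> where "\<epsilon> = (\<lambda>Y \<in> Obj D. e Y)"
  have "nat_trans C C (id_func C) (comp_func C G F) \<eta>"
    by (rule nat_transI[OF id_functor[OF F.dom.category_axioms] comp_functor[OF F.cat_functor_axioms G]])
      (auto simp: id_func_def comp_func_def compose_eq G_def \<eta>_def lift intro!: faithful)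
  moreover have "\<eta> A \<in> isos C" if "A \<in> Obj C" for A
  proof -
    have "lift (g (FObj F A)) A (e (FObj F A)) \<cdot>\<^bsub>C\<^esub> \<eta> A = Ident C A"
      "\<eta> A \<cdot>\<^bsub>C\<^esub> lift (g (FObj F A)) A (e (FObj F A)) = Ident C (g (FObj F A))"
      using that by (simp_all add: \<eta> lift faithful)
    then show ?thesis
      using that by (intro F.dom.isosI[of _ "lift (g (FObj F A)) A (e (FObj F A))"]) (simp_all add: \<eta> lift)
  qed
  ultimately have "nat_iso C C (id_func C) (comp_func C G F) \<eta>"
    by (simp add: nat_iso_def nat_iso_axioms_def)
  moreover have "nat_iso D D (comp_func D F G) (id_func D) \<epsilon>"
  proof -
    have "nat_trans D D (comp_func D F G) (id_func D) \<epsilon>"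
      by (rule nat_transI[OF comp_functor[OF G F.cat_functor_axioms] id_functor[OF F.cod.category_axioms]])
        (auto simp: id_func_def comp_func_def compose_eq G_def \<epsilon>_def)
    then show ?thesis by (simp add: nat_iso_def nat_iso_axioms_def \<epsilon>_def)
  qed
  ultimately show ?thesis
    unfolding equivalent_cats_def using F.cat_functor_axioms G by blast
qed

lemma weak_equivalence_comp:
  assumes "weak_equivalence C D F" "weak_equivalence D E G"
  shows "weak_equivalence C E (comp_func C G F)"
proof -
  interpret F: cat_functor C D F using assms by (simp add: weak_equivalence_def)
  interpret G: cat_functor D E G using assms by (simp add: weak_equivalence_def)
  have "cat_functor C E (comp_func C G F)"
    by (rule comp_functor) (rule F.cat_functor_axioms G.cat_functor_axioms)+
  moreover have "bij_betw (FArr (comp_func C G F)) (hom C A B)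
      (hom E (FObj (comp_func C G F) A) (FObj (comp_func C G F) B))" if AB: "A \<in> Obj C" "B \<in> Obj C" for A B
  proof -
    have "bij_betw (FArr F) (hom C A B) (hom D (FObj F A) (FObj F B))"
      and "bij_betw (FArr G) (hom D (FObj F A) (FObj F B)) (hom E (FObj G (FObj F A)) (FObj G (FObj F B)))"
      using weak_equivalence_bij[OF assms(1) AB] weak_equivalence_bij[OF assms(2)] AB by simp_all
    from bij_betw_trans[OF this]
    have *: "bij_betw (FArr G \<circ> FArr F) (hom C A B) (hom E (FObj G (FObj F A)) (FObj G (FObj F B)))" .
    have "bij_betw (FArr (comp_func C G F)) (hom C A B) (hom E (FObj G (FObj F A)) (FObj G (FObj F B)))"
      by (rule iffD1[OF bij_betw_cong *]) (auto simp: comp_func_def compose_eq hom_def)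
    then show ?thesis using AB by (simp add: comp_func_def compose_eq)
  qed
  moreover have "\<exists>A \<in> Obj C. \<exists>i \<in> isos E. Dom E i = FObj (comp_func C G F) A \<and> Cod E i = Z"
    if Z: "Z \<in> Obj E" for Z
  proof -
    obtain Y j where j: "Y \<in> Obj D" "j \<in> isos E" "Dom E j = FObj G Y" "Cod E j = Z"
      using weak_equivalence_eso[OF assms(2) Z] .
    obtain A i where i: "A \<in> Obj C" "i \<in> isos D" "Dom D i = FObj F A" "Cod D i = Y"
      using weak_equivalence_eso[OF assms(1) j(1)] .
    \<comment> \<open>Functors preserve isomorphisms, so the isomorphism \<open>i\<close> chosen in
      \<open>D\<close> can be carried to \<open>E\<close> and followed by \<open>j\<close>.\<close>
    have "FArr G (F.cod.inverse i) \<cdot>\<^bsub>E\<^esub> FArr G i = Ident E (FObj G (Dom D i))"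
      "FArr G i \<cdot>\<^bsub>E\<^esub> FArr G (F.cod.inverse i) = Ident E (FObj G (Cod D i))"
      using i(2) by (simp_all add: G.farr_ident flip: G.farr_comp_simp)
    then have "FArr G i \<in> isos E"
      using i(2) by (intro G.cod.isosI[of _ "FArr G (F.cod.inverse i)"]) simp_all
    then have "j \<cdot>\<^bsub>E\<^esub> FArr G i \<in> isos E"
      using i j by simp
    moreover have "Dom E (j \<cdot>\<^bsub>E\<^esub> FArr G i) = FObj (comp_func C G F) A" "Cod E (j \<cdot>\<^bsub>E\<^esub> FArr G i) = Z"
      using i j by (simp_all add: comp_func_def compose_eq)
    ultimately show ?thesis using i(1) by (intro bexI conjI)
  qed
  ultimately show ?thesis unfolding weak_equivalence_def by (intro conjI ballI)
qed

text \<open>The category laws of the source are a consequence: they can be checked in the target.\<close>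

lemma weak_equivalenceI:
  assumes D: "category D"
    and obj: "\<And>f. f \<in> Arr C \<Longrightarrow> Dom C f \<in> Obj C \<and> Cod C f \<in> Obj C"
    and ident: "\<And>A. A \<in> Obj C \<Longrightarrow> Ident C A \<in> hom C A A \<and> a (Ident C A) = Ident D (ob A)"
    and comp: "\<And>f g X Y Z. f \<in> hom C X Y \<Longrightarrow> g \<in> hom C Y Z \<Longrightarrow>
      g \<cdot>\<^bsub>C\<^esub> f \<in> hom C X Z \<and> a (g \<cdot>\<^bsub>C\<^esub> f) = a g \<cdot>\<^bsub>D\<^esub> a f"
    and ob: "\<And>A. A \<in> Obj C \<Longrightarrow> ob A \<in> Obj D"
    and bij: "\<And>A B. A \<in> Obj C \<Longrightarrow> B \<in> Obj C \<Longrightarrow> bij_betw a (hom C A B) (hom D (ob A) (ob B))"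
    and eso: "\<And>Y. Y \<in> Obj D \<Longrightarrow> \<exists>A \<in> Obj C. \<exists>i \<in> isos D. Dom D i = ob A \<and> Cod D i = Y"
  shows "weak_equivalence C D \<lparr>FObj = (\<lambda>A \<in> Obj C. ob A), FArr = (\<lambda>f \<in> Arr C. a f)\<rparr>"
    (is "weak_equivalence C D ?F")
proof -
  interpret D: category D by fact
  have a: "a f \<in> hom D (ob X) (ob Y)" "X \<in> Obj C" "Y \<in> Obj C" if "f \<in> hom C X Y" for f X Y
  proof -
    show XY: "X \<in> Obj C" "Y \<in> Obj C" using obj[of f] that by (auto simp: hom_def)
    show "a f \<in> hom D (ob X) (ob Y)" using bij[OF XY] that by (auto simp: bij_betw_def)
  qed
  have inj: "f = g" if "a f = a g" "f \<in> hom C X Y" "g \<in> hom C X Y" for f g X Y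
    using bij[OF a(2,3)[OF that(2)]] that by (auto simp: bij_betw_def inj_on_def)
  have C: "category C"
  proof
    fix f X Y assume f: "f \<in> hom C X Y"
    note af = a[OF f]
    show "f \<cdot>\<^bsub>C\<^esub> Ident C X = f"
      by (rule inj[OF _ _ f]) (use comp[OF _ f, of "Ident C X" X] ident[OF af(2)] af D.comp_ident in auto)
    show "Ident C Y \<cdot>\<^bsub>C\<^esub> f = f"
      by (rule inj[OF _ _ f]) (use comp[OF f, of "Ident C Y" Y] ident[OF af(3)] af D.ident_comp in auto)
    fix g h Z Z' assume g: "g \<in> hom C Y Z" and h: "h \<in> hom C Z Z'"
    show "h \<cdot>\<^bsub>C\<^esub> g \<cdot>\<^bsub>C\<^esub> f = h \<cdot>\<^bsub>C\<^esub> (g \<cdot>\<^bsub>C\<^esub> f)"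
    proof (rule inj)
      show "a (h \<cdot>\<^bsub>C\<^esub> g \<cdot>\<^bsub>C\<^esub> f) = a (h \<cdot>\<^bsub>C\<^esub> (g \<cdot>\<^bsub>C\<^esub> f))"
        using comp[OF f, of "h \<cdot>\<^bsub>C\<^esub> g"] comp[OF g h] comp[OF _ h, of "g \<cdot>\<^bsub>C\<^esub> f"] comp[OF f g]
          D.comp_assoc[OF a(1)[OF f] a(1)[OF g] a(1)[OF h]] by auto
    qed (use comp f g h in blast)+
  qed (use obj ident comp in auto)
  have 1: "cat_functor C D ?F"
  proof (rule cat_functorI[OF C D])
    fix f assume "f \<in> Arr C"
    then show "FArr ?F f \<in> Arr D \<and> Dom D (FArr ?F f) = FObj ?F (Dom C f) \<and> Cod D (FArr ?F f) = FObj ?F (Cod C f)"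
      using a[of f "Dom C f" "Cod C f"] by (auto simp: hom_def)
  next
    fix f g assume "f \<in> Arr C" "g \<in> Arr C" "Cod C f = Dom C g"
    then show "FArr ?F (g \<cdot>\<^bsub>C\<^esub> f) = FArr ?F g \<cdot>\<^bsub>D\<^esub> FArr ?F f"
      using comp[of f "Dom C f" "Cod C f" g "Cod C g"] by (auto simp: hom_def)
  next
    fix A assume "A \<in> Obj C"
    then show "FArr ?F (Ident C A) = Ident D (FObj ?F A)"
      using ident[of A] by (auto simp: hom_def)
  qed (use ob in auto)
  have 2: "bij_betw (FArr ?F) (hom C A B) (hom D (FObj ?F A) (FObj ?F B))" if "A \<in> Obj C" "B \<in> Obj C" for A B
  proof -
    have "bij_betw (FArr ?F) (hom C A B) (hom D (ob A) (ob B))"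
      by (rule iffD1[OF bij_betw_cong bij[OF that]]) (auto simp: hom_def)
    then show ?thesis using that by simp
  qed
  have 3: "\<exists>A \<in> Obj C. \<exists>i \<in> isos D. Dom D i = FObj ?F A \<and> Cod D i = Y" if "Y \<in> Obj D" for Y
    using eso[OF that] by auto
  show ?thesis unfolding weak_equivalence_def using 1 2 3 by (intro conjI ballI)
qed

lemma nat_trans_comp:
  assumes "nat_trans C D F G \<sigma>" "nat_trans C D G H \<tau>"
  shows "nat_trans C D F H (\<lambda>A \<in> Obj C. \<tau> A \<cdot>\<^bsub>D\<^esub> \<sigma> A)"
proof -
  interpret s: nat_trans C D F G \<sigma> by fact
  interpret t: nat_trans C D G H \<tau> by fact
  show ?thesis
  proof (rule nat_transI)
    fix f assume f: "f \<in> Arr C"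
    have "\<tau> (Cod C f) \<cdot>\<^bsub>D\<^esub> (\<sigma> (Cod C f) \<cdot>\<^bsub>D\<^esub> FArr F f) = (\<tau> (Cod C f) \<cdot>\<^bsub>D\<^esub> FArr G f) \<cdot>\<^bsub>D\<^esub> \<sigma> (Dom C f)"
      using f s.natural_simp[OF f] by simp
    also have "\<dots> = FArr H f \<cdot>\<^bsub>D\<^esub> (\<tau> (Dom C f) \<cdot>\<^bsub>D\<^esub> \<sigma> (Dom C f))"
      using f t.natural_simp[OF f] by simp
    finally show "(\<lambda>A \<in> Obj C. \<tau> A \<cdot>\<^bsub>D\<^esub> \<sigma> A) (Cod C f) \<cdot>\<^bsub>D\<^esub> FArr F f =
        FArr H f \<cdot>\<^bsub>D\<^esub> (\<lambda>A \<in> Obj C. \<tau> A \<cdot>\<^bsub>D\<^esub> \<sigma> A) (Dom C f)"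
      using f by simp
  qed (auto simp: s.src.cat_functor_axioms t.trg.cat_functor_axioms)
qed

lemma nat_trans_ident:
  assumes "cat_functor C D F"
  shows "nat_trans C D F F (\<lambda>A \<in> Obj C. Ident D (FObj F A))"
proof -
  interpret F: cat_functor C D F by fact
  show ?thesis by (rule nat_transI) (auto simp: F.cat_functor_axioms)
qed

lemma nat_trans_obj:
  "nat_trans C D F G \<sigma> \<Longrightarrow> cat_functor C D F" "nat_trans C D F G \<sigma> \<Longrightarrow> cat_functor C D G"
  by (simp_all add: nat_trans_def)

text \<open>That \<open>C\<close> and \<open>D\<close> are categories is part of the condition on
  objects and arrows. The identity laws rely on extensionality of the components: outside
  \<open>Obj C\<close> both sides have to be the same default value.\<close>

lemma functor_category:
  fixes C :: "('o, 'a, 'm) cat_scheme" and D :: "('p, 'b, 'n) cat_scheme"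
  shows "category (functor_cat C D)"
proof
  fix f A B assume "f \<in> hom (functor_cat C D) A B"
  then obtain \<sigma> where f: "f = (A, \<sigma>, B)" and s: "nat_trans C D A B \<sigma>"
    by (auto simp: hom_def functor_cat_def)
  interpret s: nat_trans C D A B \<sigma> by fact
  show "f \<cdot>\<^bsub>functor_cat C D\<^esub> Ident (functor_cat C D) A = f"
    using s.component_ext by (auto simp: f functor_cat_def fun_eq_iff extensional_def)
  show "Ident (functor_cat C D) B \<cdot>\<^bsub>functor_cat C D\<^esub> f = f"
    using s.component_ext by (auto simp: f functor_cat_def fun_eq_iff extensional_def)
  fix g h E E' assume "g \<in> hom (functor_cat C D) B E" "h \<in> hom (functor_cat C D) E E'"
  then obtain \<tau> \<rho> where g: "g = (B, \<tau>, E)" and t: "nat_trans C D B E \<tau>"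
     and h: "h = (E, \<rho>, E')" and r: "nat_trans C D E E' \<rho>"
    by (auto simp: hom_def functor_cat_def)
  interpret t: nat_trans C D B E \<tau> by fact
  interpret r: nat_trans C D E E' \<rho> by fact
  show "h \<cdot>\<^bsub>functor_cat C D\<^esub> g \<cdot>\<^bsub>functor_cat C D\<^esub> f = h \<cdot>\<^bsub>functor_cat C D\<^esub> (g \<cdot>\<^bsub>functor_cat C D\<^esub> f)"
    by (auto simp: f g h functor_cat_def fun_eq_iff)
qed (auto simp: functor_cat_def hom_def nat_trans_ident nat_trans_comp dest: nat_trans_obj)

section \<open>Monoidal categories\<close>

context monoidal_category
begin

lemma tobj_simp [simp]: "A \<in> Obj M \<Longrightarrow> B \<in> Obj M \<Longrightarrow> A \<otimes> B \<in> Obj M"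
  by (rule tobj)

lemma tunit_simp [simp]: "\<I> \<in> Obj M"
  by (rule tunit)

lemma tarr_simps [simp]:
  assumes "f \<in> Arr M" "g \<in> Arr M"
  shows "f \<boxtimes> g \<in> Arr M" "Dom M (f \<boxtimes> g) = Dom M f \<otimes> Dom M g" "Cod M (f \<boxtimes> g) = Cod M f \<otimes> Cod M g"
  using tarr[of f "Dom M f" "Cod M f" g "Dom M g" "Cod M g"] assms by (auto simp: hom_def)

lemma tarr_ident_simp [simp]: "A \<in> Obj M \<Longrightarrow> B \<in> Obj M \<Longrightarrow> Ident M A \<boxtimes> Ident M B = Ident M (A \<otimes> B)"
  by (rule tarr_ident)

lemma interchange:
  assumes "f \<in> Arr M" "f' \<in> Arr M" "Cod M f = Dom M f'" "g \<in> Arr M" "g' \<in> Arr M" "Cod M g = Dom M g'"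
  shows "(f' \<boxtimes> g') \<cdot> (f \<boxtimes> g) = (f' \<cdot> f) \<boxtimes> (g' \<cdot> g)"
  using tarr_comp[of f "Dom M f" "Cod M f" f' "Cod M f'" g "Dom M g" "Cod M g" g' "Cod M g'"] assms
  by (auto simp: hom_def)

lemma interchange':
  assumes "f \<in> Arr M" "f' \<in> Arr M" "Cod M f = Dom M f'" "g \<in> Arr M" "g' \<in> Arr M" "Cod M g = Dom M g'"
    "h \<in> Arr M" "Cod M h = Dom M f \<otimes> Dom M g"
  shows "(f' \<boxtimes> g') \<cdot> ((f \<boxtimes> g) \<cdot> h) = ((f' \<cdot> f) \<boxtimes> (g' \<cdot> g)) \<cdot> h"
  using assms by (simp flip: assoc interchange)

lemma isos_tarr [simp]:
  assumes "f \<in> isos M" "g \<in> isos M"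
  shows "f \<boxtimes> g \<in> isos M"
  by (rule isosI[of _ "inverse f \<boxtimes> inverse g"]) (use assms in \<open>simp_all add: interchange\<close>)

lemma tassoc_simps [simp]:
  assumes "A \<in> Obj M" "B \<in> Obj M" "E \<in> Obj M"
  shows "TAssoc M A B E \<in> isos M" "Dom M (TAssoc M A B E) = (A \<otimes> B) \<otimes> E"
    "Cod M (TAssoc M A B E) = A \<otimes> (B \<otimes> E)" "TAssoc M A B E \<in> Arr M"
  using assoc_hom[OF assms] by (auto simp: hom_def)

lemma lunit_simps [simp]:
  assumes "A \<in> Obj M"
  shows "TLUnit M A \<in> isos M" "Dom M (TLUnit M A) = \<I> \<otimes> A" "Cod M (TLUnit M A) = A" "TLUnit M A \<in> Arr M"
  using lunit_hom[OF assms] by (auto simp: hom_def)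

lemma runit_simps [simp]:
  assumes "A \<in> Obj M"
  shows "TRUnit M A \<in> isos M" "Dom M (TRUnit M A) = A \<otimes> \<I>" "Cod M (TRUnit M A) = A" "TRUnit M A \<in> Arr M"
  using runit_hom[OF assms] by (auto simp: hom_def)

lemma tassoc_nat:
  assumes "f \<in> Arr M" "g \<in> Arr M" "h \<in> Arr M"
  shows "TAssoc M (Cod M f) (Cod M g) (Cod M h) \<cdot> ((f \<boxtimes> g) \<boxtimes> h) =
    (f \<boxtimes> (g \<boxtimes> h)) \<cdot> TAssoc M (Dom M f) (Dom M g) (Dom M h)"
  by (rule assoc_natural) (use assms in \<open>auto intro: homI\<close>)

lemma lunit_nat: "f \<in> Arr M \<Longrightarrow> TLUnit M (Cod M f) \<cdot> (Ident M \<I> \<boxtimes> f) = f \<cdot> TLUnit M (Dom M f)"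
  by (rule lunit_natural) (auto intro: homI)

lemma runit_nat: "f \<in> Arr M \<Longrightarrow> TRUnit M (Cod M f) \<cdot> (f \<boxtimes> Ident M \<I>) = f \<cdot> TRUnit M (Dom M f)"
  by (rule runit_natural) (auto intro: homI)

end

section \<open>The category of finite ordinals\<close>

definition mono_map :: "nat \<Rightarrow> nat \<Rightarrow> (nat \<Rightarrow> nat) \<Rightarrow> bool" where
  "mono_map n m f \<longleftrightarrow> (\<forall>i<n. f i < m) \<and> (\<forall>i j. i \<le> j \<longrightarrow> j < n \<longrightarrow> f i \<le> f j)"

text \<open>Any function on the naturals may be packaged; it is restricted only at this point.
  Computations thus use plain functions, and equality of arrows becomes agreement below
  \<open>n\<close>.\<close>

definition delta_arr :: "nat \<Rightarrow> nat \<Rightarrow> (nat \<Rightarrow> nat) \<Rightarrow> nat \<times> (nat \<Rightarrow> nat) \<times> nat" where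
  "delta_arr n m f = (n, restrict f {..<n}, m)"

text \<open>The unrestricted counterpart of \<open>ord_sum\<close>, to be used under
  \<open>delta_arr\<close>.\<close>

definition osum :: "nat \<Rightarrow> nat \<Rightarrow> (nat \<Rightarrow> nat) \<Rightarrow> (nat \<Rightarrow> nat) \<Rightarrow> nat \<Rightarrow> nat" where
  "osum n m f g i = (if i < n then f i else m + g (i - n))"

lemma mono_mapI: "(\<And>i. i < n \<Longrightarrow> f i < m) \<Longrightarrow> (\<And>i j. i \<le> j \<Longrightarrow> j < n \<Longrightarrow> f i \<le> f j) \<Longrightarrow> mono_map n m f"
  by (simp add: mono_map_def)

lemma mono_map_less: "mono_map n m f \<Longrightarrow> i < n \<Longrightarrow> f i < m"
  by (simp add: mono_map_def)

lemma mono_map_mono: "mono_map n m f \<Longrightarrow> i \<le> j \<Longrightarrow> j < n \<Longrightarrow> f i \<le> f j"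
  by (simp add: mono_map_def)

lemma mono_map_comp: "mono_map n m f \<Longrightarrow> mono_map m k g \<Longrightarrow> mono_map n k (\<lambda>i. g (f i))"
  by (simp add: mono_map_def)

lemma mono_map_id [simp]: "mono_map n n (\<lambda>i. i)"
  by (simp add: mono_map_def)

lemma mono_map_osum: "mono_map n m f \<Longrightarrow> mono_map n' m' f' \<Longrightarrow> mono_map (n + n') (m + m') (osum n m f f')"
  by (auto simp: mono_map_def osum_def trans_less_add1 trans_le_add1 less_imp_le)

lemma mono_maps_iff: "restrict f {..<n} \<in> mono_maps n m \<longleftrightarrow> mono_map n m f"
  by (auto simp: mono_maps_def mono_map_def mono_on_def monotone_on_def)

lemma delta_arr_eq: "delta_arr n m f = delta_arr n' m' g \<longleftrightarrow> n = n' \<and> m = m' \<and> (\<forall>i<n. f i = g i)"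
  by (auto simp: delta_arr_def fun_eq_iff restrict_def)

lemma delta_simps [simp]:
  "Obj delta = UNIV" "delta_arr n m f \<in> Arr delta \<longleftrightarrow> mono_map n m f"
  "Dom delta (delta_arr n m f) = n" "Cod delta (delta_arr n m f) = m"
  "TObj delta = (+)" "TUnit delta = 0"
  by (auto simp: delta_def delta_arr_def mono_maps_iff)

lemma delta_ident: "Ident delta n = delta_arr n n (\<lambda>i. i)"
  by (simp add: delta_def delta_arr_def)

lemma delta_structure [simp]:
  "TAssoc delta n m k = Ident delta (n + m + k)"
  "TLUnit delta n = Ident delta n" "TRUnit delta n = Ident delta n"
  by (simp_all add: delta_def)

text \<open>Monotonicity of \<open>f\<close> provides \<open>f i < m\<close>, so the restriction of
  \<open>g\<close> to its domain is invisible in the composite.\<close>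

lemma delta_comp: "mono_map n m f \<Longrightarrow> delta_arr m' k g \<cdot>\<^bsub>delta\<^esub> delta_arr n m f = delta_arr n k (\<lambda>i. g (f i))"
  if "m = m'"
  using that by (auto simp: delta_def delta_arr_def compose_def mono_map_def fun_eq_iff)

lemma delta_tensor: "delta_arr n m f \<boxtimes>\<^bsub>delta\<^esub> delta_arr n' m' f' = delta_arr (n + n') (m + m') (osum n m f f')"
  by (auto simp: delta_def delta_arr_def ord_sum_def osum_def fun_eq_iff restrict_def)

lemma delta_arrE:
  assumes "x \<in> Arr delta"
  obtains f where "mono_map (Dom delta x) (Cod delta x) f" "x = delta_arr (Dom delta x) (Cod delta x) f"
proof -
  obtain n u m where x: "x = (n, u, m)" by (cases x)
  have u: "u \<in> mono_maps n m" using assms by (simp add: x delta_def)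
  then have "u = restrict u {..<n}" by (auto simp: mono_maps_def PiE_def extensional_restrict)
  with u that[of u] show ?thesis by (simp add: x delta_def delta_arr_def flip: mono_maps_iff)
qed

lemma delta_homE:
  assumes "x \<in> hom delta n m"
  obtains f where "mono_map n m f" "x = delta_arr n m f"
  using assms delta_arrE[of x] by (auto simp: hom_def)

lemma delta_hom [simp]: "delta_arr n m f \<in> hom delta n' m' \<longleftrightarrow> n = n' \<and> m = m' \<and> mono_map n m f"
  by (auto simp: hom_def)

lemma delta_category: "category delta"
proof
  fix f X Y assume f: "f \<in> hom delta X Y"
  show "f \<cdot>\<^bsub>delta\<^esub> Ident delta X = f" "Ident delta Y \<cdot>\<^bsub>delta\<^esub> f = f"
    using f by (auto elim!: delta_homE simp: delta_ident delta_comp)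
  fix g Z assume g: "g \<in> hom delta Y Z"
  show "g \<cdot>\<^bsub>delta\<^esub> f \<in> hom delta X Z"
    using f g by (auto elim!: delta_homE simp: delta_comp mono_map_comp)
  fix h Z' assume h: "h \<in> hom delta Z Z'"
  show "h \<cdot>\<^bsub>delta\<^esub> g \<cdot>\<^bsub>delta\<^esub> f = h \<cdot>\<^bsub>delta\<^esub> (g \<cdot>\<^bsub>delta\<^esub> f)"
    using f g h by (auto elim!: delta_homE simp: delta_comp mono_map_comp)
qed (auto simp: delta_ident)

interpretation delta: category delta by (rule delta_category)

lemma delta_tensor_ident: "Ident delta n \<boxtimes>\<^bsub>delta\<^esub> Ident delta m = Ident delta (n + m)"
  by (auto simp: delta_ident delta_tensor delta_arr_eq osum_def)

lemma delta_monoidal: "monoidal_category delta"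
proof
  fix A B :: nat
  show "Ident delta A \<boxtimes>\<^bsub>delta\<^esub> Ident delta B = Ident delta (A \<otimes>\<^bsub>delta\<^esub> B)"
    by (simp add: delta_tensor_ident)
next
  fix f g A A' B B' assume f: "f \<in> hom delta A A'" and g: "g \<in> hom delta B B'"
  show "f \<boxtimes>\<^bsub>delta\<^esub> g \<in> hom delta (A \<otimes>\<^bsub>delta\<^esub> B) (A' \<otimes>\<^bsub>delta\<^esub> B')"
    using f g by (auto elim!: delta_homE simp: delta_tensor mono_map_osum)
  fix f' A'' g' B'' assume f': "f' \<in> hom delta A' A''" and g': "g' \<in> hom delta B' B''"
  show "(f' \<cdot>\<^bsub>delta\<^esub> f) \<boxtimes>\<^bsub>delta\<^esub> (g' \<cdot>\<^bsub>delta\<^esub> g) = (f' \<boxtimes>\<^bsub>delta\<^esub> g') \<cdot>\<^bsub>delta\<^esub> (f \<boxtimes>\<^bsub>delta\<^esub> g)"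
    using f g f' g'
    by (auto elim!: delta_homE simp: delta_tensor delta_comp mono_map_osum mono_map_comp delta_arr_eq osum_def mono_map_less)
next
  fix f g h A A' B B' E E'
  assume f: "f \<in> hom delta A A'" and g: "g \<in> hom delta B B'" and h: "h \<in> hom delta E E'"
  show "TAssoc delta A' B' E' \<cdot>\<^bsub>delta\<^esub> ((f \<boxtimes>\<^bsub>delta\<^esub> g) \<boxtimes>\<^bsub>delta\<^esub> h) =
     (f \<boxtimes>\<^bsub>delta\<^esub> (g \<boxtimes>\<^bsub>delta\<^esub> h)) \<cdot>\<^bsub>delta\<^esub> TAssoc delta A B E"
  proof -
    obtain u v w where u: "mono_map A A' u" "f = delta_arr A A' u" and v: "mono_map B B' v" "g = delta_arr B B' v"
      and w: "mono_map E E' w" "h = delta_arr E E' w"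
      using f g h by (elim delta_homE)
    have "mono_map (A + B + E) (A' + B' + E') (osum (A + B) (A' + B') (osum A A' u v) w)"
      by (intro mono_map_osum u v w)
    then show ?thesis
      using u v w by (auto simp: delta_tensor delta_comp mono_map_osum delta_arr_eq osum_def delta_ident add.assoc)
  qed
next
  fix f A A' assume f: "f \<in> hom delta A A'"
  show "TLUnit delta A' \<cdot>\<^bsub>delta\<^esub> (Ident delta \<I>\<^bsub>delta\<^esub> \<boxtimes>\<^bsub>delta\<^esub> f) = f \<cdot>\<^bsub>delta\<^esub> TLUnit delta A"
    "TRUnit delta A' \<cdot>\<^bsub>delta\<^esub> (f \<boxtimes>\<^bsub>delta\<^esub> Ident delta \<I>\<^bsub>delta\<^esub>) = f \<cdot>\<^bsub>delta\<^esub> TRUnit delta A"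
    using f mono_map_osum[of 0 0 "\<lambda>i. i" A A'] mono_map_osum[of A A' _ 0 0 "\<lambda>i. i"]
    by (auto elim!: delta_homE simp: delta_tensor delta_comp delta_arr_eq osum_def delta_ident)
next
  fix A B E K :: nat
  show "(Ident delta A \<boxtimes>\<^bsub>delta\<^esub> TAssoc delta B E K) \<cdot>\<^bsub>delta\<^esub> TAssoc delta A (B \<otimes>\<^bsub>delta\<^esub> E) K \<cdot>\<^bsub>delta\<^esub>
      (TAssoc delta A B E \<boxtimes>\<^bsub>delta\<^esub> Ident delta K) =
      TAssoc delta A B (E \<otimes>\<^bsub>delta\<^esub> K) \<cdot>\<^bsub>delta\<^esub> TAssoc delta (A \<otimes>\<^bsub>delta\<^esub> B) E K"
    by (simp add: delta_tensor_ident add.assoc)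
  show "(Ident delta A \<boxtimes>\<^bsub>delta\<^esub> TLUnit delta B) \<cdot>\<^bsub>delta\<^esub> TAssoc delta A \<I>\<^bsub>delta\<^esub> B =
      TRUnit delta A \<boxtimes>\<^bsub>delta\<^esub> Ident delta B"
    by (simp add: delta_tensor_ident add.assoc)
qed (auto simp: hom_def add.assoc)

interpretation delta: monoidal_category delta by (rule delta_monoidal)

text \<open>If the last value is below \<open>a\<close>, monotonicity puts all values below
  \<open>a\<close>; otherwise the cut found for the shorter ordinal still works. All decompositions
  of arrows and both Galois relations further down rest on this cut.\<close>

lemma mono_cut:
  assumes "mono_map n m f"
  shows "\<exists>p\<le>n. \<forall>i<n. f i < a \<longleftrightarrow> i < p"
  using assms
proof (induction n)
  case (Suc n)
  then have "mono_map n m f" by (simp add: mono_map_def)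
  with Suc obtain p where p: "p \<le> n" "\<forall>i<n. f i < a \<longleftrightarrow> i < p" by auto
  show ?case
  proof (cases "f n < a")
    case True
    then have "\<forall>i<Suc n. f i < a"
      using mono_map_mono[OF Suc.prems, of _ n] by (meson le_less_trans less_Suc_eq_le lessI)
    then show ?thesis by auto
  next
    case False
    then show ?thesis using p by (intro exI[of _ p]) (auto simp: less_Suc_eq)
  qed
qed auto

text \<open>The cut of \<open>u\<close> at \<open>a\<close> divides the domain into the elements
  that land in the first summand and those that land in the second; the second piece is shifted back
  by \<open>p\<close> in the domain and by \<open>a\<close> in the codomain.\<close>

lemma delta_split:
  assumes "mono_map n (a + b) u"
  obtains p q f g where "n = p + q" "mono_map p a f" "mono_map q b g"
    "delta_arr n (a + b) u = delta_arr p a f \<boxtimes>\<^bsub>delta\<^esub> delta_arr q b g"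
proof -
  obtain p where p: "p \<le> n" "\<forall>i<n. u i < a \<longleftrightarrow> i < p" using mono_cut[OF assms] by blast
  define q g where "q = n - p" and "g = (\<lambda>i. u (p + i) - a)"
  have n: "n = p + q" using p by (simp add: q_def)
  have ge: "a \<le> u (p + i)" if "i < q" for i using p(2)[rule_format, of "p + i"] that n by auto
  have "mono_map p a u" using p assms by (auto simp: mono_map_def)
  moreover have "mono_map q b g"
  proof (rule mono_mapI)
    show "g i < b" if "i < q" for i
      using mono_map_less[OF assms, of "p + i"] ge[OF that] that n unfolding g_def by simp
    show "g i \<le> g j" if "i \<le> j" "j < q" for i j
      using mono_map_mono[OF assms, of "p + i" "p + j"] that n unfolding g_def by (simp add: diff_le_mono)
  qed
  moreover have "delta_arr n (a + b) u = delta_arr p a u \<boxtimes>\<^bsub>delta\<^esub> delta_arr q b g"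
  proof -
    have "u i = a + (u (p + (i - p)) - a)" if "i < n" "\<not> i < p" for i
      using that ge[of "i - p"] n by simp
    then show ?thesis by (auto simp: delta_tensor delta_arr_eq n osum_def g_def)
  qed
  ultimately show ?thesis using n that by blast
qed

lemma mono_map_bang [simp]: "mono_map k (Suc 0) (\<lambda>_. 0)"
  by (simp add: mono_map_def)

text \<open>The splitting with second summand 1 isolates the fibre over the last element, and a map
  to 1 can only be constant.\<close>

lemma delta_split_last:
  assumes "mono_map n (Suc m) u"
  obtains p k f where "n = p + k" "mono_map p m f"
    "delta_arr n (Suc m) u = delta_arr p m f \<boxtimes>\<^bsub>delta\<^esub> delta_arr k (Suc 0) (\<lambda>_. 0)"
proof -
  have "mono_map n (m + Suc 0) u" using assms by simp
  then obtain p k f g where *: "n = p + k" "mono_map p m f" "mono_map k (Suc 0) g"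
    "delta_arr n (m + Suc 0) u = delta_arr p m f \<boxtimes>\<^bsub>delta\<^esub> delta_arr k (Suc 0) g"
    by (rule delta_split)
  moreover have "delta_arr k (Suc 0) g = delta_arr k (Suc 0) (\<lambda>_. 0)"
    using *(3) by (auto simp: delta_arr_eq mono_map_def)
  ultimately show ?thesis using that[of p k f] by simp
qed

lemma mono_map_0_cod: "mono_map n 0 u \<longleftrightarrow> n = 0"
  by (auto simp: mono_map_def)

lemma delta_bang_Suc:
  "delta_arr (Suc k) (Suc 0) (\<lambda>_. 0) =
    delta_arr (Suc (Suc 0)) (Suc 0) (\<lambda>_. 0) \<cdot>\<^bsub>delta\<^esub> (delta_arr k (Suc 0) (\<lambda>_. 0) \<boxtimes>\<^bsub>delta\<^esub> Ident delta (Suc 0))"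
  using mono_map_osum[of k "Suc 0" "\<lambda>_. 0" "Suc 0" "Suc 0" "\<lambda>i. i"]
  by (simp add: delta_tensor delta_ident delta_comp)

text \<open>Repeated removal of the fibre over the last element writes an arrow as the ordinal sum
  of its fibres k -> 1; the induction runs over the codomain.\<close>

lemma delta_induct_last [consumes 1, case_names empty tensor]:
  assumes "x \<in> Arr delta"
    and empty: "P (Ident delta 0)"
    and tensor: "\<And>x k. x \<in> Arr delta \<Longrightarrow> P x \<Longrightarrow> P (x \<boxtimes>\<^bsub>delta\<^esub> delta_arr k (Suc 0) (\<lambda>_. 0))"
  shows "P x"
proof -
  have "P (delta_arr n m f)" if "mono_map n m f" for n m f
    using that
  proof (induction m arbitrary: n f)
    case 0
    then have "delta_arr n 0 f = Ident delta 0" by (simp add: mono_map_0_cod delta_ident delta_arr_eq)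
    then show ?case using empty by simp
  next
    case (Suc m)
    obtain p k g where "n = p + k" "mono_map p m g"
      "delta_arr n (Suc m) f = delta_arr p m g \<boxtimes>\<^bsub>delta\<^esub> delta_arr k (Suc 0) (\<lambda>_. 0)"
      using delta_split_last[OF Suc.prems] .
    then show ?case using Suc.IH[of p g] tensor by simp
  qed
  then show ?thesis using assms(1) by (metis delta_arrE)
qed

text \<open>\<open>\<Delta>\<close> is generated, as a monoidal category, by the monoid structure of \<open>1\<close>.\<close>

lemma delta_generated [consumes 1, case_names ident mult unit comp tensor]:
  assumes "x \<in> Arr delta"
    and ident: "\<And>n. P (Ident delta n)"
    and mult: "P (delta_arr (Suc (Suc 0)) (Suc 0) (\<lambda>_. 0))"
    and unit: "P (delta_arr 0 (Suc 0) (\<lambda>_. 0))"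
    and comp: "\<And>x y. x \<in> Arr delta \<Longrightarrow> y \<in> Arr delta \<Longrightarrow> Cod delta x = Dom delta y \<Longrightarrow> P x \<Longrightarrow> P y \<Longrightarrow>
      P (y \<cdot>\<^bsub>delta\<^esub> x)"
    and tensor: "\<And>x y. x \<in> Arr delta \<Longrightarrow> y \<in> Arr delta \<Longrightarrow> P x \<Longrightarrow> P y \<Longrightarrow> P (x \<boxtimes>\<^bsub>delta\<^esub> y)"
  shows "P x"
proof -
  \<comment> \<open>The map k -> 1 is an iterated multiplication starting from the unit 0 -> 1, by
    \<open>delta_bang_Suc\<close>.\<close>
  have bang: "P (delta_arr k (Suc 0) (\<lambda>_. 0))" for k
  proof (induction k)
    case (Suc k)
    show ?case
      by (subst delta_bang_Suc, rule comp) (use Suc mult ident tensor in simp_all)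
  qed (rule unit)
  show ?thesis
    using assms(1) by (induction x rule: delta_induct_last) (simp_all add: ident tensor bang)
qed

section \<open>Up-to-homotopy monoids\<close>

text \<open>The associator and the unitors of \<open>delta\<close> are identities, so the coherence
  laws of a colax functor on \<open>delta\<close> can be restated without their \<open>FArr\<close>
  factor; the lemmas ending in \<open>_delta\<close> do this.\<close>

locale colax_delta = colax_monoidal_functor delta M Y
  for M :: "('p, 'b, 'n) moncat_scheme" and Y :: "(nat, nat \<times> (nat \<Rightarrow> nat) \<times> nat, 'p, 'b) colax_mon"
begin

lemma xi_simps [simp]:
  "Xi Y m n \<in> Arr M" "Dom M (Xi Y m n) = FObj Y (m + n)" "Cod M (Xi Y m n) = FObj Y m \<otimes>\<^bsub>M\<^esub> FObj Y n"
  using xi_hom[of m n] by (auto simp: hom_def)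

lemma xi0_simps [simp]: "Xi0 Y \<in> Arr M" "Dom M (Xi0 Y) = FObj Y 0" "Cod M (Xi0 Y) = \<I>\<^bsub>M\<^esub>"
  using xi0_hom by (auto simp: hom_def)

lemma fobj_delta [simp]: "FObj Y n \<in> Obj M"
  by simp

lemma xi_nat:
  assumes "f \<in> Arr delta" "g \<in> Arr delta"
  shows "Xi Y (Cod delta f) (Cod delta g) \<cdot>\<^bsub>M\<^esub> FArr Y (f \<boxtimes>\<^bsub>delta\<^esub> g) =
    (FArr Y f \<boxtimes>\<^bsub>M\<^esub> FArr Y g) \<cdot>\<^bsub>M\<^esub> Xi Y (Dom delta f) (Dom delta g)"
  by (rule xi_natural) (use assms in \<open>auto intro: delta.homI\<close>)

lemma farr_ident_delta [simp]: "FArr Y (Ident delta n) = Ident M (FObj Y n)"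
  by (rule farr_ident) simp

lemma xi_assoc_delta:
  "TAssoc M (FObj Y m) (FObj Y n) (FObj Y k) \<cdot>\<^bsub>M\<^esub> (Xi Y m n \<boxtimes>\<^bsub>M\<^esub> Ident M (FObj Y k)) \<cdot>\<^bsub>M\<^esub> Xi Y (m + n) k =
   (Ident M (FObj Y m) \<boxtimes>\<^bsub>M\<^esub> Xi Y n k) \<cdot>\<^bsub>M\<^esub> Xi Y m (n + k)"
  using xi_assoc[of m n k] by (simp add: add.assoc)

lemma xi_lunit_delta:
  "TLUnit M (FObj Y n) \<cdot>\<^bsub>M\<^esub> (Xi0 Y \<boxtimes>\<^bsub>M\<^esub> Ident M (FObj Y n)) \<cdot>\<^bsub>M\<^esub> Xi Y 0 n = Ident M (FObj Y n)"
  using xi_lunit[of n] by simp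

lemma xi_runit_delta:
  "TRUnit M (FObj Y n) \<cdot>\<^bsub>M\<^esub> (Ident M (FObj Y n) \<boxtimes>\<^bsub>M\<^esub> Xi0 Y) \<cdot>\<^bsub>M\<^esub> Xi Y n 0 = Ident M (FObj Y n)"
  using xi_runit[of n] by simp

end

lemma colax_deltaI:
  assumes "cat_functor delta M Y" "monoidal_category M"
    and "\<And>m n. Xi Y m n \<in> Arr M \<and> Dom M (Xi Y m n) = FObj Y (m + n) \<and>
      Cod M (Xi Y m n) = FObj Y m \<otimes>\<^bsub>M\<^esub> FObj Y n"
    and "Xi0 Y \<in> Arr M \<and> Dom M (Xi0 Y) = FObj Y 0 \<and> Cod M (Xi0 Y) = \<I>\<^bsub>M\<^esub>"
    and "\<And>f g. f \<in> Arr delta \<Longrightarrow> g \<in> Arr delta \<Longrightarrow>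
      Xi Y (Cod delta f) (Cod delta g) \<cdot>\<^bsub>M\<^esub> FArr Y (f \<boxtimes>\<^bsub>delta\<^esub> g) =
      (FArr Y f \<boxtimes>\<^bsub>M\<^esub> FArr Y g) \<cdot>\<^bsub>M\<^esub> Xi Y (Dom delta f) (Dom delta g)"
    and "\<And>m n k. TAssoc M (FObj Y m) (FObj Y n) (FObj Y k) \<cdot>\<^bsub>M\<^esub> (Xi Y m n \<boxtimes>\<^bsub>M\<^esub> Ident M (FObj Y k)) \<cdot>\<^bsub>M\<^esub> Xi Y (m + n) k =
      (Ident M (FObj Y m) \<boxtimes>\<^bsub>M\<^esub> Xi Y n k) \<cdot>\<^bsub>M\<^esub> Xi Y m (n + k)"
    and "\<And>n. TLUnit M (FObj Y n) \<cdot>\<^bsub>M\<^esub> (Xi0 Y \<boxtimes>\<^bsub>M\<^esub> Ident M (FObj Y n)) \<cdot>\<^bsub>M\<^esub> Xi Y 0 n = Ident M (FObj Y n)"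
    and "\<And>n. TRUnit M (FObj Y n) \<cdot>\<^bsub>M\<^esub> (Ident M (FObj Y n) \<boxtimes>\<^bsub>M\<^esub> Xi0 Y) \<cdot>\<^bsub>M\<^esub> Xi Y n 0 = Ident M (FObj Y n)"
  shows "colax_delta M Y"
proof -
  interpret cat_functor delta M Y by fact
  interpret M: monoidal_category M by fact
  have [simp]: "FObj Y n \<in> Obj M" "FArr Y (Ident delta n) = Ident M (FObj Y n)" for n
    using farr_ident by simp_all
  show ?thesis
  proof (intro colax_delta.intro colax_monoidal_functor.intro colax_monoidal_functor_axioms.intro assms(1,2)
      delta_monoidal)
    fix f g A A' B B' assume "f \<in> hom delta A A'" "g \<in> hom delta B B'"
    then show "Xi Y A' B' \<cdot>\<^bsub>M\<^esub> FArr Y (f \<boxtimes>\<^bsub>delta\<^esub> g) = (FArr Y f \<boxtimes>\<^bsub>M\<^esub> FArr Y g) \<cdot>\<^bsub>M\<^esub> Xi Y A B"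
      using assms(5)[of f g] by (simp add: hom_def)
  next
    fix A B E
    show "TAssoc M (FObj Y A) (FObj Y B) (FObj Y E) \<cdot>\<^bsub>M\<^esub> (Xi Y A B \<boxtimes>\<^bsub>M\<^esub> Ident M (FObj Y E)) \<cdot>\<^bsub>M\<^esub>
        Xi Y (A \<otimes>\<^bsub>delta\<^esub> B) E = (Ident M (FObj Y A) \<boxtimes>\<^bsub>M\<^esub> Xi Y B E) \<cdot>\<^bsub>M\<^esub> Xi Y A (B \<otimes>\<^bsub>delta\<^esub> E) \<cdot>\<^bsub>M\<^esub>
        FArr Y (TAssoc delta A B E)"
      using assms(6)[of A B E] assms(3) by (simp add: add.assoc)
  next
    fix A
    show "TLUnit M (FObj Y A) \<cdot>\<^bsub>M\<^esub> (Xi0 Y \<boxtimes>\<^bsub>M\<^esub> Ident M (FObj Y A)) \<cdot>\<^bsub>M\<^esub> Xi Y \<I>\<^bsub>delta\<^esub> A = FArr Y (TLUnit delta A)"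
      "TRUnit M (FObj Y A) \<cdot>\<^bsub>M\<^esub> (Ident M (FObj Y A) \<boxtimes>\<^bsub>M\<^esub> Xi0 Y) \<cdot>\<^bsub>M\<^esub> Xi Y A \<I>\<^bsub>delta\<^esub> = FArr Y (TRUnit delta A)"
      using assms(7,8)[of A] by simp_all
  qed (use assms(3,4) in \<open>auto simp: hom_def\<close>)
qed

lemma homotopy_monoid_iff:
  "is_homotopy_monoid M W Y \<longleftrightarrow> colax_delta M Y \<and> (\<forall>m n. Xi Y m n \<in> W) \<and> Xi0 Y \<in> W"
  by (simp add: is_homotopy_monoid_def colax_delta_def)

locale colax_delta_trans = src: colax_delta M Y + trg: colax_delta M Z + nat_trans delta M Y Z \<sigma>
  for M :: "('p, 'b, 'n) moncat_scheme" and Y Z :: "(nat, nat \<times> (nat \<Rightarrow> nat) \<times> nat, 'p, 'b) colax_mon" and \<sigma> +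
  assumes xi_comm: "Xi Z m n \<cdot>\<^bsub>M\<^esub> \<sigma> (m + n) = (\<sigma> m \<boxtimes>\<^bsub>M\<^esub> \<sigma> n) \<cdot>\<^bsub>M\<^esub> Xi Y m n"
    and xi0_comm: "Xi0 Z \<cdot>\<^bsub>M\<^esub> \<sigma> 0 = Xi0 Y"
begin

lemma component_delta [simp]: "\<sigma> n \<in> Arr M" "Dom M (\<sigma> n) = FObj Y n" "Cod M (\<sigma> n) = FObj Z n"
  by simp_all

end

lemma monoidal_nat_trans_iff: "monoidal_nat_trans delta M Y Z \<sigma> \<longleftrightarrow> colax_delta_trans M Y Z \<sigma>"
  by (auto simp: monoidal_nat_trans_def colax_delta_trans_def colax_delta_def
      monoidal_nat_trans_axioms_def colax_delta_trans_axioms_def)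

lemma colax_delta_transI:
  assumes "colax_delta M Y" "colax_delta M Z"
    and "\<And>n. \<sigma> n \<in> Arr M \<and> Dom M (\<sigma> n) = FObj Y n \<and> Cod M (\<sigma> n) = FObj Z n"
    and "\<And>f. f \<in> Arr delta \<Longrightarrow> \<sigma> (Cod delta f) \<cdot>\<^bsub>M\<^esub> FArr Y f = FArr Z f \<cdot>\<^bsub>M\<^esub> \<sigma> (Dom delta f)"
    and "\<And>m n. Xi Z m n \<cdot>\<^bsub>M\<^esub> \<sigma> (m + n) = (\<sigma> m \<boxtimes>\<^bsub>M\<^esub> \<sigma> n) \<cdot>\<^bsub>M\<^esub> Xi Y m n"
    and "Xi0 Z \<cdot>\<^bsub>M\<^esub> \<sigma> 0 = Xi0 Y"
  shows "colax_delta_trans M Y Z \<sigma>"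
proof -
  interpret Y: colax_delta M Y by fact
  interpret Z: colax_delta M Z by fact
  have "nat_trans delta M Y Z \<sigma>"
    by (rule nat_transI[OF Y.cat_functor_axioms Z.cat_functor_axioms]) (use assms(3,4) in auto)
  then show ?thesis
    using assms by (auto simp: colax_delta_trans_def colax_delta_trans_axioms_def)
qed

lemma colax_delta_trans_comp:
  assumes "colax_delta_trans M X Y \<sigma>" "colax_delta_trans M Y Z \<tau>"
  shows "colax_delta_trans M X Z (\<lambda>n. \<tau> n \<cdot>\<^bsub>M\<^esub> \<sigma> n)"
proof -
  interpret s: colax_delta_trans M X Y \<sigma> by fact
  interpret t: colax_delta_trans M Y Z \<tau> by fact
  have "nat_trans delta M X Z (\<lambda>n. \<tau> n \<cdot>\<^bsub>M\<^esub> \<sigma> n)"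
    using nat_trans_comp[OF s.nat_trans_axioms t.nat_trans_axioms] by (simp add: restrict_UNIV)
  moreover have "Xi Z m n \<cdot>\<^bsub>M\<^esub> (\<tau> (m + n) \<cdot>\<^bsub>M\<^esub> \<sigma> (m + n)) =
      ((\<tau> m \<cdot>\<^bsub>M\<^esub> \<sigma> m) \<boxtimes>\<^bsub>M\<^esub> (\<tau> n \<cdot>\<^bsub>M\<^esub> \<sigma> n)) \<cdot>\<^bsub>M\<^esub> Xi X m n" for m n
  proof -
    have "Xi Z m n \<cdot>\<^bsub>M\<^esub> (\<tau> (m + n) \<cdot>\<^bsub>M\<^esub> \<sigma> (m + n)) = (Xi Z m n \<cdot>\<^bsub>M\<^esub> \<tau> (m + n)) \<cdot>\<^bsub>M\<^esub> \<sigma> (m + n)"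
      by simp
    also have "\<dots> = (\<tau> m \<boxtimes>\<^bsub>M\<^esub> \<tau> n) \<cdot>\<^bsub>M\<^esub> (Xi Y m n \<cdot>\<^bsub>M\<^esub> \<sigma> (m + n))"
      unfolding t.xi_comm by simp
    also have "\<dots> = ((\<tau> m \<cdot>\<^bsub>M\<^esub> \<sigma> m) \<boxtimes>\<^bsub>M\<^esub> (\<tau> n \<cdot>\<^bsub>M\<^esub> \<sigma> n)) \<cdot>\<^bsub>M\<^esub> Xi X m n"
      unfolding s.xi_comm by (simp add: s.src.cod.interchange')
    finally show ?thesis .
  qed
  moreover have "Xi0 Z \<cdot>\<^bsub>M\<^esub> (\<tau> 0 \<cdot>\<^bsub>M\<^esub> \<sigma> 0) = Xi0 X"
  proof -
    have "Xi0 Z \<cdot>\<^bsub>M\<^esub> (\<tau> 0 \<cdot>\<^bsub>M\<^esub> \<sigma> 0) = (Xi0 Z \<cdot>\<^bsub>M\<^esub> \<tau> 0) \<cdot>\<^bsub>M\<^esub> \<sigma> 0" by simp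
    then show ?thesis by (simp only: t.xi0_comm s.xi0_comm)
  qed
  ultimately show ?thesis
    by (simp add: colax_delta_trans_def colax_delta_trans_axioms_def s.src.colax_delta_axioms
        t.trg.colax_delta_axioms)
qed

lemma colax_delta_trans_ident:
  assumes "colax_delta M Y"
  shows "colax_delta_trans M Y Y (\<lambda>n. Ident M (FObj Y n))"
proof -
  interpret colax_delta M Y by fact
  show ?thesis by (rule colax_delta_transI[OF assms assms]) simp_all
qed

lemma homotopy_monoid_category: "category (homotopy_monoid_cat M W)"
proof -
  have eq: "Comp (homotopy_monoid_cat M W) (Y', \<tau>, Z) (X, \<sigma>, Y) = (X, \<lambda>n. \<tau> n \<cdot>\<^bsub>M\<^esub> \<sigma> n, Z)"
    "Ident (homotopy_monoid_cat M W) X = (X, \<lambda>n. Ident M (FObj X n), X)" for X Y Y' Z \<sigma> \<tau>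
    by (simp_all add: homotopy_monoid_cat_def)
  have homD: "\<exists>\<sigma>. f = (X, \<sigma>, Y) \<and> colax_delta_trans M X Y \<sigma>"
    if "f \<in> hom (homotopy_monoid_cat M W) X Y" for f X Y
    using that by (auto simp: homotopy_monoid_cat_def hom_def monoidal_nat_trans_iff)
  show ?thesis
  proof
    fix f X Y assume "f \<in> hom (homotopy_monoid_cat M W) X Y"
    then obtain \<sigma> where f: "f = (X, \<sigma>, Y)" and "colax_delta_trans M X Y \<sigma>" using homD by blast
    then interpret s: colax_delta_trans M X Y \<sigma> by simp
    show "f \<cdot>\<^bsub>homotopy_monoid_cat M W\<^esub> Ident (homotopy_monoid_cat M W) X = f"
      "Ident (homotopy_monoid_cat M W) Y \<cdot>\<^bsub>homotopy_monoid_cat M W\<^esub> f = f"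
      by (simp_all add: f eq)
    fix g h Z Z' assume "g \<in> hom (homotopy_monoid_cat M W) Y Z" "h \<in> hom (homotopy_monoid_cat M W) Z Z'"
    then obtain \<tau> \<rho> where g: "g = (Y, \<tau>, Z)" and "colax_delta_trans M Y Z \<tau>"
      and h: "h = (Z, \<rho>, Z')" and "colax_delta_trans M Z Z' \<rho>" using homD by meson
    then interpret t: colax_delta_trans M Y Z \<tau> + r: colax_delta_trans M Z Z' \<rho> by simp_all
    show "h \<cdot>\<^bsub>homotopy_monoid_cat M W\<^esub> g \<cdot>\<^bsub>homotopy_monoid_cat M W\<^esub> f =
        h \<cdot>\<^bsub>homotopy_monoid_cat M W\<^esub> (g \<cdot>\<^bsub>homotopy_monoid_cat M W\<^esub> f)"
      by (simp add: f g h eq)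
  qed (auto simp: homotopy_monoid_cat_def hom_def monoidal_nat_trans_iff homotopy_monoid_iff
      colax_delta_trans_ident colax_delta_trans_comp)
qed

section \<open>Points of the one-object category\<close>


text \<open>Conjugation by the order-reversing bijections of \<open>n\<close> and \<open>m\<close>,
  where \<open>n - Suc i\<close> is the mirror image of \<open>i\<close>. It is an involution of
  \<open>delta\<close>, the identity on objects, that exchanges the summands of an ordinal
  sum.\<close>

definition rev_arr :: "nat \<times> (nat \<Rightarrow> nat) \<times> nat \<Rightarrow> nat \<times> (nat \<Rightarrow> nat) \<times> nat" where
  "rev_arr = (\<lambda>(n, u, m). delta_arr n m (\<lambda>i. m - Suc (u (n - Suc i))))"

lemma rev_delta_arr: "rev_arr (delta_arr n m f) = delta_arr n m (\<lambda>i. m - Suc (f (n - Suc i)))"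
proof -
  have *: "restrict f {..<n} (n - Suc i) = f (n - Suc i)" if "i < n" for i
    using that by simp
  show ?thesis
    unfolding rev_arr_def delta_arr_def[of n m f] prod.case delta_arr_eq by (intro conjI refl allI impI) (simp only: *)
qed

lemma mono_map_rev:
  assumes f: "mono_map n m f"
  shows "mono_map n m (\<lambda>i. m - Suc (f (n - Suc i)))"
proof (rule mono_mapI)
  show "m - Suc (f (n - Suc i)) < m" if "i < n" for i
    using mono_map_less[OF f, of "n - Suc i"] that by simp
  show "m - Suc (f (n - Suc i)) \<le> m - Suc (f (n - Suc j))" if "i \<le> j" "j < n" for i j
  proof -
    have "f (n - Suc j) \<le> f (n - Suc i)" by (rule mono_map_mono[OF f]) (use that in simp_all)
    then show ?thesis by (simp add: diff_le_mono2)
  qed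
qed

lemma rev_simps:
  assumes "x \<in> Arr delta"
  shows "rev_arr x \<in> Arr delta" "Dom delta (rev_arr x) = Dom delta x" "Cod delta (rev_arr x) = Cod delta x"
    "rev_arr (rev_arr x) = x"
proof -
  obtain n m f where x: "mono_map n m f" "x = delta_arr n m f" using delta_arrE[OF assms] .
  show "rev_arr x \<in> Arr delta" "Dom delta (rev_arr x) = Dom delta x" "Cod delta (rev_arr x) = Cod delta x"
    using x(1) by (simp_all add: x(2) rev_delta_arr mono_map_rev)
  have "m - Suc (m - Suc (f (n - Suc (n - Suc i)))) = f i" if "i < n" for i
  proof -
    have "n - Suc (n - Suc i) = i" using that by simp
    then show ?thesis using mono_map_less[OF x(1) that] by simp
  qed
  then show "rev_arr (rev_arr x) = x"
    unfolding x(2) rev_delta_arr delta_arr_eq by blast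
qed

lemma rev_ident: "rev_arr (Ident delta n) = Ident delta n"
  by (auto simp: delta_ident rev_delta_arr delta_arr_eq)

lemma rev_comp:
  assumes "x \<in> Arr delta" "y \<in> Arr delta" "Cod delta x = Dom delta y"
  shows "rev_arr (y \<cdot>\<^bsub>delta\<^esub> x) = rev_arr y \<cdot>\<^bsub>delta\<^esub> rev_arr x"
proof -
  obtain f where f: "mono_map (Dom delta x) (Cod delta x) f" "x = delta_arr (Dom delta x) (Cod delta x) f"
    using assms(1) by (rule delta_arrE)
  obtain g where g: "mono_map (Cod delta x) (Cod delta y) g" "y = delta_arr (Cod delta x) (Cod delta y) g"
    using assms(2,3) by (metis delta_arrE)
  have "Cod delta x - Suc (Cod delta x - Suc (f (Dom delta x - Suc i))) = f (Dom delta x - Suc i)"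
    if "i < Dom delta x" for i
    using mono_map_less[OF f(1), of "Dom delta x - Suc i"] that by simp
  then show ?thesis
    using f(1) g(1) by (subst f(2), subst f(2), subst g(2), subst g(2))
      (simp add: delta_comp rev_delta_arr mono_map_rev delta_arr_eq)
qed

text \<open>Mirroring a sum puts the mirrored second block in front of the mirrored first block, in
  the domain and in the codomain alike.\<close>

lemma rev_tensor:
  assumes "x \<in> Arr delta" "y \<in> Arr delta"
  shows "rev_arr (x \<boxtimes>\<^bsub>delta\<^esub> y) = rev_arr y \<boxtimes>\<^bsub>delta\<^esub> rev_arr x"
proof -
  obtain n m f where f: "mono_map n m f" "x = delta_arr n m f" using assms(1) by (metis delta_arrE)
  obtain p q g where g: "mono_map p q g" "y = delta_arr p q g" using assms(2) by (metis delta_arrE)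
  have "m + q - Suc (osum n m f g (n + p - Suc i)) =
      osum p q (\<lambda>i. q - Suc (g (p - Suc i))) (\<lambda>i. m - Suc (f (n - Suc i))) i" if "i < n + p" for i
  proof (cases "i < p")
    case True
    then show ?thesis using mono_map_less[OF g(1), of "p - Suc i"] that
      by (simp add: osum_def)
  next
    case False
    then have "n - Suc (i - p) = n + p - Suc i" "n + p - Suc i < n" using that by auto
    then show ?thesis using False mono_map_less[OF f(1), of "n + p - Suc i"] by (simp add: osum_def)
  qed
  then show ?thesis by (simp add: f g delta_tensor rev_delta_arr delta_arr_eq add.commute)
qed

section \<open>Paths of the one-object category and arrows of \<open>delta\<close>\<close>

type_synonym one_path = "(unit, unit) path"

abbreviation one_paths :: "(unit, one_path, one_path \<times> (nat \<Rightarrow> nat) \<times> one_path) bicat" where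
  "one_paths \<equiv> path_bicat one_cat"

text \<open>With a single arrow available, a path carries no information beyond its length;
  \<open>pth\<close> and \<open>path_length\<close> are mutually inverse.\<close>

definition pth :: "nat \<Rightarrow> one_path" where
  "pth n = ((), replicate n (), ())"

lemma pth_length [simp]: "path_length (pth n) = n"
  by (simp add: pth_def)

lemma pth_of_length [simp]: "pth (path_length s) = s"
proof -
  have "replicate (length xs) () = xs" for xs :: "unit list" by (induction xs) auto
  then show ?thesis by (cases s) (simp add: pth_def)
qed

lemma one_path_eq: "s = t \<longleftrightarrow> path_length s = path_length t" for s t :: one_path
  by (metis pth_of_length)

text \<open>Horizontal composition of paths corresponds to the ordinal sum in reverse order, so the
  identification of \<open>one_paths\<close> with \<open>delta\<close> involves reversing the ordinals.\<close>

definition to_delta :: "one_path \<times> (nat \<Rightarrow> nat) \<times> one_path \<Rightarrow> nat \<times> (nat \<Rightarrow> nat) \<times> nat" where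
  "to_delta = (\<lambda>(s, u, t). rev_arr (path_length s, u, path_length t))"

definition of_delta :: "nat \<times> (nat \<Rightarrow> nat) \<times> nat \<Rightarrow> one_path \<times> (nat \<Rightarrow> nat) \<times> one_path" where
  "of_delta x = (case rev_arr x of (n, u, m) \<Rightarrow> (pth n, u, pth m))"

lemma chain_one [simp]: "chain one_cat A fs B"
  by (induction fs arbitrary: A) (auto simp: one_cat_def)

lemma paths_one [simp]: "paths one_cat = UNIV"
  by (auto simp: paths_def)

lemma obj_one [simp]: "Obj one_cat = UNIV"
  by (auto simp: one_cat_def)

text \<open>The condition on composites over the fibres is an equation in the unit type, hence
  always true; only the nondecreasing map remains.\<close>

lemma path_cell_one: "path_cell one_cat s u t \<longleftrightarrow> u \<in> mono_maps (path_length s) (path_length t)"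
  by (simp add: path_cell_def)

lemma path_length_concat [simp]: "path_length (path_concat t s) = path_length t + path_length s"
  for t s :: one_path
  by (cases t; cases s) auto

lemma one_paths_simps [simp]:
  "Obj one_paths = UNIV" "Cells0 one_paths = UNIV" "HObj one_paths = path_concat"
  "HAssoc one_paths r t s = Ident one_paths (path_concat r (path_concat t s))"
  "HLUnit one_paths = Ident one_paths" "HRUnit one_paths = Ident one_paths"
  "HUnit one_paths x = pth 0" "hcomposable one_paths = UNIV"
  by (auto simp: path_bicat_def hcomposable_def pth_def)

lemma arr_iff: "(n, u, m) \<in> Arr delta \<longleftrightarrow> u \<in> mono_maps n m"
  by (simp add: delta_def)

lemma one_paths_arr: "(s, u, t) \<in> Arr one_paths \<longleftrightarrow> (path_length s, u, path_length t) \<in> Arr delta"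
  by (simp add: arr_iff path_cell_one path_bicat_def)

lemma dom_cod_triple [simp]: "Dom delta (n, u, m) = n" "Cod delta (n, u, m) = m"
  by (simp_all add: delta_def)

lemma of_delta_simps:
  assumes "x \<in> Arr delta"
  shows "of_delta x \<in> Arr one_paths" "Dom one_paths (of_delta x) = pth (Dom delta x)"
    "Cod one_paths (of_delta x) = pth (Cod delta x)" "to_delta (of_delta x) = x"
proof -
  obtain n u m where r: "rev_arr x = (n, u, m)" by (cases "rev_arr x")
  note * = rev_simps[OF assms, unfolded r]
  show "of_delta x \<in> Arr one_paths" "Dom one_paths (of_delta x) = pth (Dom delta x)"
    "Cod one_paths (of_delta x) = pth (Cod delta x)" "to_delta (of_delta x) = x"
    using * by (simp_all add: of_delta_def r one_paths_arr to_delta_def)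
     (simp_all add: path_bicat_def)
qed

lemma to_delta_simps:
  assumes "x \<in> Arr one_paths"
  shows "to_delta x \<in> Arr delta" "Dom delta (to_delta x) = path_length (Dom one_paths x)"
    "Cod delta (to_delta x) = path_length (Cod one_paths x)" "of_delta (to_delta x) = x"
proof -
  obtain s u t where x: "x = (s, u, t)" by (cases x)
  have u: "(path_length s, u, path_length t) \<in> Arr delta" using assms by (simp add: x one_paths_arr)
  show "to_delta x \<in> Arr delta" "Dom delta (to_delta x) = path_length (Dom one_paths x)"
    "Cod delta (to_delta x) = path_length (Cod one_paths x)" "of_delta (to_delta x) = x"
    using rev_simps[OF u] by (simp_all add: x to_delta_def of_delta_def)
      (simp_all add: path_bicat_def)
qed

text \<open>Read from right to left, this moves an equation between 2-cells into
  \<open>delta\<close>. Since \<open>to_delta\<close> respects all operations, the category and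
  bicategory laws of \<open>one_paths\<close> follow from those of \<open>delta\<close>.\<close>

lemma to_delta_inject: "x \<in> Arr one_paths \<Longrightarrow> y \<in> Arr one_paths \<Longrightarrow> to_delta x = to_delta y \<longleftrightarrow> x = y"
  by (metis to_delta_simps(4))

lemma to_delta_ident: "Ident one_paths s \<in> Arr one_paths" "to_delta (Ident one_paths s) = Ident delta (path_length s)"
proof -
  have *: "Ident one_paths s = (s, fst (snd (Ident delta (path_length s))), s)"
    by (simp add: path_bicat_def delta_def path_ident_def)
  have d: "(path_length s, fst (snd (Ident delta (path_length s))), path_length s) = Ident delta (path_length s)"
    by (simp add: delta_def)
  show "Ident one_paths s \<in> Arr one_paths" "to_delta (Ident one_paths s) = Ident delta (path_length s)"
    unfolding * by (simp_all add: one_paths_arr d to_delta_def rev_ident)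
qed

lemma to_delta_comp:
  assumes "x \<in> Arr one_paths" "y \<in> Arr one_paths" "Cod one_paths x = Dom one_paths y"
  shows "y \<cdot>\<^bsub>one_paths\<^esub> x \<in> Arr one_paths" "to_delta (y \<cdot>\<^bsub>one_paths\<^esub> x) = to_delta y \<cdot>\<^bsub>delta\<^esub> to_delta x"
proof -
  obtain s u t where x: "x = (s, u, t)" by (cases x)
  obtain t' v r where y: "y = (t', v, r)" by (cases y)
  have t: "t' = t" using assms(3) by (simp add: x y path_bicat_def)
  let ?x = "(path_length s, u, path_length t)" and ?y = "(path_length t, v, path_length r)"
  have xy: "?x \<in> Arr delta" "?y \<in> Arr delta" using assms(1,2) by (simp_all add: x y t one_paths_arr)
  have c: "y \<cdot>\<^bsub>one_paths\<^esub> x = (s, compose {..<path_length s} v u, r)"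
    by (simp add: x y path_bicat_def)
  have d: "(path_length s, compose {..<path_length s} v u, path_length r) = ?y \<cdot>\<^bsub>delta\<^esub> ?x"
    by (simp add: delta_def)
  show "y \<cdot>\<^bsub>one_paths\<^esub> x \<in> Arr one_paths"
    using xy unfolding c by (simp add: one_paths_arr d)
  show "to_delta (y \<cdot>\<^bsub>one_paths\<^esub> x) = to_delta y \<cdot>\<^bsub>delta\<^esub> to_delta x"
    using xy unfolding c by (simp add: x y t to_delta_def d rev_comp)
qed

lemma to_delta_harr:
  assumes "x \<in> Arr one_paths" "y \<in> Arr one_paths"
  shows "y \<star>\<^bsub>one_paths\<^esub> x \<in> Arr one_paths" "to_delta (y \<star>\<^bsub>one_paths\<^esub> x) = to_delta y \<boxtimes>\<^bsub>delta\<^esub> to_delta x"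
proof -
  obtain s u t where x: "x = (s, u, t)" by (cases x)
  obtain s' v t' where y: "y = (s', v, t')" by (cases y)
  let ?x = "(path_length s, u, path_length t)" and ?y = "(path_length s', v, path_length t')"
  have xy: "?x \<in> Arr delta" "?y \<in> Arr delta" using assms(1,2) by (simp_all add: x y one_paths_arr)
  have c: "y \<star>\<^bsub>one_paths\<^esub> x =
      (path_concat s' s, ord_sum (path_length s) (path_length t) (path_length s') u v, path_concat t' t)"
    by (simp add: x y path_bicat_def)
  have d: "(path_length (path_concat s' s), ord_sum (path_length s) (path_length t) (path_length s') u v,
      path_length (path_concat t' t)) = ?x \<boxtimes>\<^bsub>delta\<^esub> ?y"
    by (simp add: delta_def add.commute)
  show "y \<star>\<^bsub>one_paths\<^esub> x \<in> Arr one_paths"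
    using xy unfolding c one_paths_arr d by simp
  show "to_delta (y \<star>\<^bsub>one_paths\<^esub> x) = to_delta y \<boxtimes>\<^bsub>delta\<^esub> to_delta x"
    using xy unfolding c by (simp only: x y to_delta_def prod.case d rev_tensor)
qed

lemma dom_cod_ident_path [simp]:
  "Dom one_paths (Ident one_paths s) = s" "Cod one_paths (Ident one_paths s) = s"
  by (simp_all add: path_bicat_def path_ident_def)

lemma one_paths_category: "category one_paths"
proof
  fix f X Y assume "f \<in> hom one_paths X Y"
  then have f: "f \<in> Arr one_paths" "Dom one_paths f = X" "Cod one_paths f = Y"
    by (auto simp: hom_def)
  show "f \<cdot>\<^bsub>one_paths\<^esub> Ident one_paths X = f" "Ident one_paths Y \<cdot>\<^bsub>one_paths\<^esub> f = f"
    using f by (simp_all add: to_delta_comp to_delta_ident to_delta_simps flip: to_delta_inject)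
  fix g Z assume "g \<in> hom one_paths Y Z"
  then have g: "g \<in> Arr one_paths" "Dom one_paths g = Y" "Cod one_paths g = Z"
    by (auto simp: hom_def)
  show gf: "g \<cdot>\<^bsub>one_paths\<^esub> f \<in> hom one_paths X Z"
  proof -
    have "Dom one_paths (g \<cdot>\<^bsub>one_paths\<^esub> f) = X" "Cod one_paths (g \<cdot>\<^bsub>one_paths\<^esub> f) = Z"
      using f g by (auto simp: path_bicat_def split: prod.splits)
    then show ?thesis using f g by (simp add: to_delta_comp hom_def)
  qed
  fix h Z' assume "h \<in> hom one_paths Z Z'"
  then have h: "h \<in> Arr one_paths" "Dom one_paths h = Z" "Cod one_paths h = Z'"
    by (auto simp: hom_def)
  have [simp]: "Dom one_paths (h \<cdot>\<^bsub>one_paths\<^esub> g) = Y" "Cod one_paths (g \<cdot>\<^bsub>one_paths\<^esub> f) = Z"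
    using f g h by (auto simp: path_bicat_def split: prod.splits)
  show "h \<cdot>\<^bsub>one_paths\<^esub> g \<cdot>\<^bsub>one_paths\<^esub> f = h \<cdot>\<^bsub>one_paths\<^esub> (g \<cdot>\<^bsub>one_paths\<^esub> f)"
    using f g h by (simp add: to_delta_comp to_delta_simps flip: to_delta_inject)
next
  show "Ident one_paths A \<in> hom one_paths A A" for A
    by (simp add: to_delta_ident hom_def)
qed simp_all

interpretation op: category one_paths by (rule one_paths_category)

lemma one_paths_dom_cod [simp]:
  assumes "x \<in> Arr one_paths" "y \<in> Arr one_paths"
  shows "Dom one_paths (y \<star>\<^bsub>one_paths\<^esub> x) = path_concat (Dom one_paths y) (Dom one_paths x)"
    "Cod one_paths (y \<star>\<^bsub>one_paths\<^esub> x) = path_concat (Cod one_paths y) (Cod one_paths x)"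
  using assms by (auto simp: path_bicat_def split: prod.splits)

lemma one_paths_bicategory: "bicategory one_paths"
proof -
  have homD: "x \<in> Arr one_paths \<and> Dom one_paths x = s \<and> Cod one_paths x = t" if "x \<in> hom one_paths s t" for x s t
    using that by (simp add: hom_def)
  note [simp] = to_delta_harr to_delta_comp to_delta_ident to_delta_simps
  show ?thesis
  proof
    show "\<beta> \<star>\<^bsub>one_paths\<^esub> \<alpha> \<in> hom one_paths (g \<odot>\<^bsub>one_paths\<^esub> f) (g' \<odot>\<^bsub>one_paths\<^esub> f')"
      if "\<alpha> \<in> hom one_paths f f'" "\<beta> \<in> hom one_paths g g'" for \<alpha> \<beta> f f' g g'
      using that[THEN homD] by (auto simp: hom_def)
    show "Ident one_paths g \<star>\<^bsub>one_paths\<^esub> Ident one_paths f = Ident one_paths (g \<odot>\<^bsub>one_paths\<^esub> f)" for f g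
      by (simp flip: to_delta_inject)
    show "(\<beta>' \<cdot>\<^bsub>one_paths\<^esub> \<beta>) \<star>\<^bsub>one_paths\<^esub> (\<alpha>' \<cdot>\<^bsub>one_paths\<^esub> \<alpha>) =
        (\<beta>' \<star>\<^bsub>one_paths\<^esub> \<alpha>') \<cdot>\<^bsub>one_paths\<^esub> (\<beta> \<star>\<^bsub>one_paths\<^esub> \<alpha>)"
      if "\<alpha> \<in> hom one_paths f f'" "\<alpha>' \<in> hom one_paths f' f''" "\<beta> \<in> hom one_paths g g'"
        "\<beta>' \<in> hom one_paths g' g''" for \<alpha> \<alpha>' \<beta> \<beta>' f f' f'' g g' g''
      using that[THEN homD] by (auto simp: delta.interchange simp flip: to_delta_inject)
    show "HAssoc one_paths h g f \<in> hom one_paths ((h \<odot>\<^bsub>one_paths\<^esub> g) \<odot>\<^bsub>one_paths\<^esub> f)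
        (h \<odot>\<^bsub>one_paths\<^esub> g \<odot>\<^bsub>one_paths\<^esub> f) \<inter> isos one_paths" for f g h
      by (simp add: hom_def one_path_eq)
    show "HAssoc one_paths h' g' f' \<cdot>\<^bsub>one_paths\<^esub> ((\<gamma> \<star>\<^bsub>one_paths\<^esub> \<beta>) \<star>\<^bsub>one_paths\<^esub> \<alpha>) =
        (\<gamma> \<star>\<^bsub>one_paths\<^esub> \<beta> \<star>\<^bsub>one_paths\<^esub> \<alpha>) \<cdot>\<^bsub>one_paths\<^esub> HAssoc one_paths h g f"
      if "\<alpha> \<in> hom one_paths f f'" "\<beta> \<in> hom one_paths g g'" "\<gamma> \<in> hom one_paths h h'" for \<alpha> \<beta> \<gamma> f f' g g' h h'
      using that[THEN homD] delta.tassoc_nat[of "to_delta \<gamma>" "to_delta \<beta>" "to_delta \<alpha>"]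
      by (auto simp: one_path_eq add.assoc simp flip: to_delta_inject)
    show "HLUnit one_paths f \<in> hom one_paths (HUnit one_paths (Trg one_paths f) \<odot>\<^bsub>one_paths\<^esub> f) f \<inter> isos one_paths" 
      "HRUnit one_paths f \<in> hom one_paths (f \<odot>\<^bsub>one_paths\<^esub> HUnit one_paths (Src one_paths f)) f \<inter> isos one_paths" for f
      by (simp_all add: hom_def one_path_eq)
    show "HLUnit one_paths f' \<cdot>\<^bsub>one_paths\<^esub> (Ident one_paths (HUnit one_paths (Trg one_paths f)) \<star>\<^bsub>one_paths\<^esub> \<alpha>) =
        \<alpha> \<cdot>\<^bsub>one_paths\<^esub> HLUnit one_paths f"
      "HRUnit one_paths f' \<cdot>\<^bsub>one_paths\<^esub> (\<alpha> \<star>\<^bsub>one_paths\<^esub> Ident one_paths (HUnit one_paths (Src one_paths f))) =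
        \<alpha> \<cdot>\<^bsub>one_paths\<^esub> HRUnit one_paths f"
      if "\<alpha> \<in> hom one_paths f f'" for \<alpha> f f'
      using that[THEN homD] delta.lunit_nat[of "to_delta \<alpha>"] delta.runit_nat[of "to_delta \<alpha>"]
      by (auto simp: one_path_eq simp flip: to_delta_inject)
    show "(Ident one_paths k \<star>\<^bsub>one_paths\<^esub> HAssoc one_paths h g f) \<cdot>\<^bsub>one_paths\<^esub>
        HAssoc one_paths k (h \<odot>\<^bsub>one_paths\<^esub> g) f \<cdot>\<^bsub>one_paths\<^esub> (HAssoc one_paths k h g \<star>\<^bsub>one_paths\<^esub> Ident one_paths f) =
      HAssoc one_paths k h (g \<odot>\<^bsub>one_paths\<^esub> f) \<cdot>\<^bsub>one_paths\<^esub> HAssoc one_paths (k \<odot>\<^bsub>one_paths\<^esub> h) g f" for f g h k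
      by (simp add: one_path_eq delta_tensor_ident add.assoc flip: to_delta_inject)
    show "(Ident one_paths g \<star>\<^bsub>one_paths\<^esub> HLUnit one_paths f) \<cdot>\<^bsub>one_paths\<^esub>
        HAssoc one_paths g (HUnit one_paths (Src one_paths g)) f =
      HRUnit one_paths g \<star>\<^bsub>one_paths\<^esub> Ident one_paths f" for f g
      by (simp add: one_path_eq delta_tensor_ident add.assoc flip: to_delta_inject)
  qed simp_all
qed

section \<open>Translation between points and colax monoidal functors on
  \<open>delta\<close>\<close>

lemma one_object_bicat_simps [simp]:
  "Obj (one_object_bicat M) = Obj M" "Arr (one_object_bicat M) = Arr M" "Dom (one_object_bicat M) = Dom M"
  "Cod (one_object_bicat M) = Cod M" "Ident (one_object_bicat M) = Ident M" "Comp (one_object_bicat M) = Comp M"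
  "Cells0 (one_object_bicat M) = UNIV" "Src (one_object_bicat M) f = ()" "Trg (one_object_bicat M) f = ()"
  "HObj (one_object_bicat M) = TObj M" "HArr (one_object_bicat M) = TArr M" "HUnit (one_object_bicat M) x = TUnit M"
  "HAssoc (one_object_bicat M) = TAssoc M" "HLUnit (one_object_bicat M) = TLUnit M"
  "HRUnit (one_object_bicat M) = TRUnit M"
  "hom (one_object_bicat M) = hom M" "isos (one_object_bicat M) = isos M"
  by (auto simp: one_object_bicat_def hom_def isos_def fun_eq_iff)

lemma one_object_bicategory:
  assumes "monoidal_category M"
  shows "bicategory (one_object_bicat M)"
proof -
  interpret monoidal_category M by fact
  have "category (one_object_bicat M)"
    by unfold_locales (simp_all add: comp_hom comp_ident ident_comp comp_assoc ident_hom)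
  moreover have "bicategory_axioms (one_object_bicat M)"
    using assoc_hom lunit_hom runit_hom tarr
    by unfold_locales (simp_all add: hcomposable_def tarr_comp assoc_natural lunit_natural runit_natural
        pentagon triangle del: assoc)
  ultimately show ?thesis by (simp add: bicategory_def)
qed

type_synonym ('p, 'b) point =
  "(unit, one_path, one_path \<times> (nat \<Rightarrow> nat) \<times> one_path, unit, 'p, 'b) colax"

text \<open>The order of the arguments of \<open>Phi\<close> is kept in \<open>Xi\<close> because
  the reversal is built into \<open>of_delta\<close>. The restriction of \<open>FArr\<close> makes
  the result extensional, as functors are required to be.\<close>

definition colax_of_point :: "('p, 'b) point \<Rightarrow> (nat, nat \<times> (nat \<Rightarrow> nat) \<times> nat, 'p, 'b) colax_mon" where
  "colax_of_point F = \<lparr>FObj = (\<lambda>n. FObj F (pth n)), FArr = (\<lambda>x \<in> Arr delta. FArr F (of_delta x)),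
     Xi = (\<lambda>m n. Phi F (pth m) (pth n)), Xi0 = Phi0 F ()\<rparr>"

definition point_of_colax :: "(nat, nat \<times> (nat \<Rightarrow> nat) \<times> nat, 'p, 'b) colax_mon \<Rightarrow> ('p, 'b) point" where
  "point_of_colax Y = \<lparr>FObj = (\<lambda>s. FObj Y (path_length s)),
     FArr = (\<lambda>x \<in> Arr one_paths. FArr Y (to_delta x)),
     F0 = (\<lambda>_. ()), Phi = (\<lambda>t s. Xi Y (path_length t) (path_length s)), Phi0 = (\<lambda>_. Xi0 Y)\<rparr>"

lemma colax_of_point_simps [simp]:
  "FObj (colax_of_point F) n = FObj F (pth n)"
  "Xi (colax_of_point F) m n = Phi F (pth m) (pth n)" "Xi0 (colax_of_point F) = Phi0 F ()"
  "x \<in> Arr delta \<Longrightarrow> FArr (colax_of_point F) x = FArr F (of_delta x)"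
  "FArr (colax_of_point F) \<in> extensional (Arr delta)"
  by (simp_all add: colax_of_point_def)

lemma of_delta_eqI: "x \<in> Arr one_paths \<Longrightarrow> to_delta x = y \<Longrightarrow> of_delta y = x"
  using to_delta_simps(4) by blast

lemma of_delta_ident: "of_delta (Ident delta n) = Ident one_paths (pth n)"
  by (rule of_delta_eqI) (simp_all add: to_delta_ident)

lemma of_delta_comp:
  assumes "x \<in> Arr delta" "y \<in> Arr delta" "Cod delta x = Dom delta y"
  shows "of_delta (y \<cdot>\<^bsub>delta\<^esub> x) = of_delta y \<cdot>\<^bsub>one_paths\<^esub> of_delta x"
  by (rule of_delta_eqI) (use assms in \<open>simp_all add: to_delta_comp of_delta_simps\<close>)

lemma of_delta_tensor:
  assumes "x \<in> Arr delta" "y \<in> Arr delta"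
  shows "of_delta (y \<boxtimes>\<^bsub>delta\<^esub> x) = of_delta y \<star>\<^bsub>one_paths\<^esub> of_delta x"
  by (rule of_delta_eqI) (use assms in \<open>simp_all add: to_delta_harr of_delta_simps\<close>)

lemma pth_concat: "path_concat (pth m) (pth n) = pth (m + n)"
  by (simp add: one_path_eq)

lemma path_concat_pth: "path_concat s t = pth (path_length s + path_length t)" for s t :: one_path
  by (simp add: one_path_eq)

lemma colax_delta_of_colax_morphism:
  assumes M: "monoidal_category M" and F: "colax_morphism one_paths (one_object_bicat M) F"
  shows "colax_delta M (colax_of_point F)"
proof -
  let ?Y = "colax_of_point F"
  interpret M: monoidal_category M by fact
  interpret F: colax_morphism one_paths "one_object_bicat M" F by fact
  have [simp]: "FObj F s \<in> Obj M" for s using F.fobj_simp[of s] by simp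
  have Farr [simp]: "FArr F x \<in> Arr M" "Dom M (FArr F x) = FObj F (Dom one_paths x)"
    "Cod M (FArr F x) = FObj F (Cod one_paths x)" if "x \<in> Arr one_paths" for x
    using F.farr_simps[OF that] by simp_all
  have Fid: "FArr F (Ident one_paths s) = Ident M (FObj F s)" for s
    using F.farr_ident[of s] by simp
  note [simp] = of_delta_simps of_delta_ident of_delta_comp of_delta_tensor pth_concat
  have "cat_functor delta M ?Y"
  proof (rule cat_functorI[OF delta_category M.category_axioms])
    fix f g assume "f \<in> Arr delta" "g \<in> Arr delta" "Cod delta f = Dom delta g"
    then show "FArr ?Y (g \<cdot>\<^bsub>delta\<^esub> f) = FArr ?Y g \<cdot>\<^bsub>M\<^esub> FArr ?Y f"
      using F.farr_comp_simp[of "of_delta f" "of_delta g"] by simp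
  qed (simp_all add: Fid)
  then show ?thesis
  proof (rule colax_deltaI[OF _ M])
    show "Xi ?Y m n \<in> Arr M \<and> Dom M (Xi ?Y m n) = FObj ?Y (m + n) \<and>
        Cod M (Xi ?Y m n) = FObj ?Y m \<otimes>\<^bsub>M\<^esub> FObj ?Y n" for m n
      using F.phi_hom[of "pth m" "pth n"] by (simp add: hom_def)
    show "Xi0 ?Y \<in> Arr M \<and> Dom M (Xi0 ?Y) = FObj ?Y 0 \<and>
        Cod M (Xi0 ?Y) = \<I>\<^bsub>M\<^esub>"
      using F.phi0_hom[of "()"] by (simp add: hom_def)
    show "Xi ?Y (Cod delta f) (Cod delta g) \<cdot>\<^bsub>M\<^esub> FArr ?Y (f \<boxtimes>\<^bsub>delta\<^esub> g) =
        (FArr ?Y f \<boxtimes>\<^bsub>M\<^esub> FArr ?Y g) \<cdot>\<^bsub>M\<^esub> Xi ?Y (Dom delta f) (Dom delta g)"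
      if "f \<in> Arr delta" "g \<in> Arr delta" for f g
      using F.phi_natural[of "pth (Dom delta f)" "pth (Dom delta g)" "of_delta g" "pth (Cod delta g)" "of_delta f"
          "pth (Cod delta f)"] that by (simp add: hom_def)
    show "TAssoc M (FObj ?Y m) (FObj ?Y n) (FObj ?Y k) \<cdot>\<^bsub>M\<^esub>
        (Xi ?Y m n \<boxtimes>\<^bsub>M\<^esub> Ident M (FObj ?Y k)) \<cdot>\<^bsub>M\<^esub> Xi ?Y (m + n) k =
      (Ident M (FObj ?Y m) \<boxtimes>\<^bsub>M\<^esub> Xi ?Y n k) \<cdot>\<^bsub>M\<^esub> Xi ?Y m (n + k)" for m n k
      using F.phi_assoc[of "pth m" "pth n" "pth k"] F.phi_hom[of "pth m" "pth n"] F.phi_hom[of "pth n" "pth k"]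
        F.phi_hom[of "pth m" "pth (n + k)"]
      by (simp add: Fid hom_def add.assoc)
    show "TLUnit M (FObj ?Y n) \<cdot>\<^bsub>M\<^esub> (Xi0 ?Y \<boxtimes>\<^bsub>M\<^esub> Ident M (FObj ?Y n)) \<cdot>\<^bsub>M\<^esub>
        Xi ?Y 0 n = Ident M (FObj ?Y n)"
      "TRUnit M (FObj ?Y n) \<cdot>\<^bsub>M\<^esub> (Ident M (FObj ?Y n) \<boxtimes>\<^bsub>M\<^esub> Xi0 ?Y) \<cdot>\<^bsub>M\<^esub>
        Xi ?Y n 0 = Ident M (FObj ?Y n)" for n
      using F.phi_lunit[of "pth n"] F.phi_runit[of "pth n"] by (simp_all add: Fid)
  qed
qed

text \<open>\<open>colax_of_point F\<close> sees \<open>FObj\<close>, \<open>Phi\<close> and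
  \<open>Phi0\<close> completely, but \<open>FArr F\<close> only on actual 2-cells; extensionality
  of \<open>FArr F\<close> is therefore a separate hypothesis. Each axiom for \<open>F\<close> is
  the corresponding axiom on \<open>delta\<close>, read at path lengths and at
  \<open>to_delta\<close> of the cells.\<close>

lemma colax_morphism_of_colax_delta:
  assumes M: "monoidal_category M" and F: "colax_delta M (colax_of_point F)"
    and ext: "FArr F \<in> extensional (Arr one_paths)"
  shows "colax_morphism one_paths (one_object_bicat M) F"
proof -
  let ?Y = "colax_of_point F" and ?B = "one_object_bicat M"
  interpret M: monoidal_category M by fact
  interpret Y: colax_delta M "colax_of_point F" by fact
  have [simp]: "FObj F s \<in> Obj M" for s using Y.fobj_simp[of "path_length s"] by simp
  have FY: "FArr F x = FArr ?Y (to_delta x)" if "x \<in> Arr one_paths" for x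
    using that by (simp add: to_delta_simps)
  have PhiY: "Phi F t s = Xi ?Y (path_length t) (path_length s)" for t s
    by simp
  have phi [simp]: "Phi F t s \<in> Arr M" "Dom M (Phi F t s) = FObj F (path_concat t s)"
    "Cod M (Phi F t s) = FObj F t \<otimes>\<^bsub>M\<^esub> FObj F s" for t s
    using Y.xi_simps[of "path_length t" "path_length s"] by (simp_all add: path_concat_pth)
  have farr [simp]: "FArr F x \<in> Arr M" "Dom M (FArr F x) = FObj F (Dom one_paths x)"
    "Cod M (FArr F x) = FObj F (Cod one_paths x)" if "x \<in> Arr one_paths" for x
    using Y.farr_simps[OF to_delta_simps(1)[OF that]] that by (simp_all add: to_delta_simps)
  have Fid: "FArr F (Ident one_paths s) = Ident M (FObj F s)" for s
    unfolding FY[OF to_delta_ident(1)] to_delta_ident(2) Y.farr_ident_delta by simp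
  have F_func: "cat_functor one_paths ?B F"
  proof (rule cat_functorI)
    show "category ?B" using one_object_bicategory[OF M] by (simp add: bicategory_def)
    fix f g assume *: "f \<in> Arr one_paths" "g \<in> Arr one_paths" "Cod one_paths f = Dom one_paths g"
    then show "FArr F (g \<cdot>\<^bsub>one_paths\<^esub> f) = FArr F g \<cdot>\<^bsub>?B\<^esub> FArr F f"
      using Y.farr_comp_simp[of "to_delta f" "to_delta g"]
      by (simp add: to_delta_simps to_delta_comp of_delta_comp)
  qed (simp_all add: one_paths_category Fid ext)
  show ?thesis
  proof (intro colax_morphism.intro colax_morphism_axioms.intro F_func one_paths_bicategory one_object_bicategory M)
    fix g f g' f' \<alpha> \<beta> assume "\<alpha> \<in> hom one_paths f f'" "\<beta> \<in> hom one_paths g g'"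
    then have *: "\<alpha> \<in> Arr one_paths" "Dom one_paths \<alpha> = f" "Cod one_paths \<alpha> = f'"
      "\<beta> \<in> Arr one_paths" "Dom one_paths \<beta> = g" "Cod one_paths \<beta> = g'"
      by (auto simp: hom_def)
    show "Phi F g' f' \<cdot>\<^bsub>?B\<^esub> FArr F (\<beta> \<star>\<^bsub>one_paths\<^esub> \<alpha>) =
        (FArr F \<beta> \<star>\<^bsub>?B\<^esub> FArr F \<alpha>) \<cdot>\<^bsub>?B\<^esub> Phi F g f"
      using Y.xi_nat[of "to_delta \<beta>" "to_delta \<alpha>"] *
      by (simp add: to_delta_simps of_delta_tensor)
  next
    fix h g f
    show "HAssoc ?B (FObj F h) (FObj F g) (FObj F f) \<cdot>\<^bsub>?B\<^esub>
        (Phi F h g \<star>\<^bsub>?B\<^esub> Ident ?B (FObj F f)) \<cdot>\<^bsub>?B\<^esub>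
        Phi F (h \<odot>\<^bsub>one_paths\<^esub> g) f =
      (Ident ?B (FObj F h) \<star>\<^bsub>?B\<^esub> Phi F g f) \<cdot>\<^bsub>?B\<^esub>
        Phi F h (g \<odot>\<^bsub>one_paths\<^esub> f) \<cdot>\<^bsub>?B\<^esub> FArr F (HAssoc one_paths h g f)"
      using Y.xi_assoc_delta[of "path_length h" "path_length g" "path_length f"]
      by (simp add: Fid flip: path_concat_pth)
  next
    fix f
    show "HLUnit ?B (FObj F f) \<cdot>\<^bsub>?B\<^esub>
        (Phi0 F (Trg one_paths f) \<star>\<^bsub>?B\<^esub> Ident ?B (FObj F f)) \<cdot>\<^bsub>?B\<^esub>
        Phi F (HUnit one_paths (Trg one_paths f)) f = FArr F (HLUnit one_paths f)"
      using Y.xi_lunit_delta[of "path_length f"] by (simp add: Fid)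
    show "HRUnit ?B (FObj F f) \<cdot>\<^bsub>?B\<^esub>
        (Ident ?B (FObj F f) \<star>\<^bsub>?B\<^esub> Phi0 F (Src one_paths f)) \<cdot>\<^bsub>?B\<^esub>
        Phi F f (HUnit one_paths (Src one_paths f)) = FArr F (HRUnit one_paths f)"
      using Y.xi_runit_delta[of "path_length f"] by (simp add: Fid)
  qed (use Y.xi0_simps in \<open>auto simp: hom_def extensional_def\<close>)
qed

lemma point_iff:
  assumes "monoidal_category M"
  shows "is_point one_cat (one_object_bicat M) W F \<longleftrightarrow>
    is_homotopy_monoid M W (colax_of_point F) \<and> FArr F \<in> extensional (Arr one_paths)"
proof -
  have "(\<forall>m n. Phi F (pth m) (pth n) \<in> W) \<longleftrightarrow> (\<forall>t s. Phi F t s \<in> W)"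
    by (metis pth_of_length)
  moreover have "FArr F \<in> extensional (Arr one_paths)" if "colax_morphism one_paths (one_object_bicat M) F"
    using that by (simp add: colax_morphism_def cat_functor_def cat_functor_axioms_def)
  ultimately show ?thesis
    using colax_delta_of_colax_morphism[OF assms] colax_morphism_of_colax_delta[OF assms]
    by (auto simp: is_point_def homotopy_monoid_iff)
qed

lemma colax_of_point_of_colax: "FArr Y \<in> extensional (Arr delta) \<Longrightarrow> colax_of_point (point_of_colax Y) = Y"
proof -
  assume ext: "FArr Y \<in> extensional (Arr delta)"
  have "(\<lambda>x \<in> Arr delta. FArr (point_of_colax Y) (of_delta x)) = FArr Y"
    using ext by (auto simp: point_of_colax_def of_delta_simps fun_eq_iff extensional_def restrict_def)
  then show ?thesis by (simp add: colax_of_point_def) (simp add: point_of_colax_def)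
qed

lemma colax_transformation_iff:
  assumes M: "monoidal_category M" and F: "colax_morphism one_paths (one_object_bicat M) F"
    and G: "colax_morphism one_paths (one_object_bicat M) G"
  shows "colax_transformation one_paths (one_object_bicat M) F G \<sigma> \<longleftrightarrow>
    colax_delta_trans M (colax_of_point F) (colax_of_point G) (\<lambda>n. \<sigma> (pth n))"
proof
  interpret M: monoidal_category M by fact
  assume "colax_transformation one_paths (one_object_bicat M) F G \<sigma>"
  then interpret s: colax_transformation one_paths "one_object_bicat M" F G \<sigma> .
  show "colax_delta_trans M (colax_of_point F) (colax_of_point G) (\<lambda>n. \<sigma> (pth n))"
  proof (rule colax_delta_transI[OF colax_delta_of_colax_morphism[OF M F] colax_delta_of_colax_morphism[OF M G]])
    fix n show "\<sigma> (pth n) \<in> Arr M \<and> Dom M (\<sigma> (pth n)) = FObj (colax_of_point F) n \<and>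
        Cod M (\<sigma> (pth n)) = FObj (colax_of_point G) n"
      using s.component_simps[of "pth n"] by simp
  next
    fix f assume "f \<in> Arr delta"
    then show "\<sigma> (pth (Cod delta f)) \<cdot>\<^bsub>M\<^esub> FArr (colax_of_point F) f =
        FArr (colax_of_point G) f \<cdot>\<^bsub>M\<^esub> \<sigma> (pth (Dom delta f))"
      using s.natural_simp[of "of_delta f"] by (simp add: of_delta_simps)
  next
    fix m n
    show "Xi (colax_of_point G) m n \<cdot>\<^bsub>M\<^esub> \<sigma> (pth (m + n)) =
        (\<sigma> (pth m) \<boxtimes>\<^bsub>M\<^esub> \<sigma> (pth n)) \<cdot>\<^bsub>M\<^esub> Xi (colax_of_point F) m n"
      using s.phi_comm[of "pth m" "pth n"] by (simp add: pth_concat)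
  next
    show "Xi0 (colax_of_point G) \<cdot>\<^bsub>M\<^esub> \<sigma> (pth 0) = Xi0 (colax_of_point F)"
      using s.phi0_comm[of "()"] by simp
  qed
next
  interpret F: colax_morphism one_paths "one_object_bicat M" F by fact
  interpret G: colax_morphism one_paths "one_object_bicat M" G by fact
  assume "colax_delta_trans M (colax_of_point F) (colax_of_point G) (\<lambda>n. \<sigma> (pth n))"
  then interpret s: colax_delta_trans M "colax_of_point F" "colax_of_point G" "\<lambda>n. \<sigma> (pth n)" .
  have "nat_trans one_paths (one_object_bicat M) F G \<sigma>"
  proof (rule nat_transI[OF F.cat_functor_axioms G.cat_functor_axioms])
    fix A show "\<sigma> A \<in> Arr (one_object_bicat M) \<and> Dom (one_object_bicat M) (\<sigma> A) = FObj F A \<and>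
        Cod (one_object_bicat M) (\<sigma> A) = FObj G A"
      using s.component_delta[of "path_length A"] by simp
  next
    fix f assume "f \<in> Arr one_paths"
    then show "\<sigma> (Cod one_paths f) \<cdot>\<^bsub>one_object_bicat M\<^esub> FArr F f =
        FArr G f \<cdot>\<^bsub>one_object_bicat M\<^esub> \<sigma> (Dom one_paths f)"
      using s.natural_simp[of "to_delta f"] by (simp add: to_delta_simps)
  qed (simp add: extensional_def)
  moreover have "Phi G t s \<cdot>\<^bsub>M\<^esub> \<sigma> (path_concat t s) = (\<sigma> t \<boxtimes>\<^bsub>M\<^esub> \<sigma> s) \<cdot>\<^bsub>M\<^esub> Phi F t s" for t s
    using s.xi_comm[of "path_length t" "path_length s"] by (simp add: path_concat_pth)
  moreover have "Phi0 G x \<cdot>\<^bsub>M\<^esub> \<sigma> (pth 0) = Phi0 F x" for x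
    using s.xi0_comm by simp
  ultimately show "colax_transformation one_paths (one_object_bicat M) F G \<sigma>"
    by (auto simp: colax_transformation_def colax_transformation_axioms_def F.colax_morphism_axioms
        G.colax_morphism_axioms fun_eq_iff)
qed

text \<open>The class \<open>W\<close> only selects objects, in the same way on both sides
  (\<open>point_iff\<close>), so one statement serves all three parts. Components at paths and at
  lengths correspond bijectively.\<close>

lemma points_weakly_equivalent:
  assumes M: "monoidal_category M"
  shows "\<exists>H. weak_equivalence (point_cat one_cat (one_object_bicat M) W) (homotopy_monoid_cat M W) H"
proof -
  let ?P = "point_cat one_cat (one_object_bicat M) W" and ?H = "homotopy_monoid_cat M W"
  interpret H: category ?H by (rule homotopy_monoid_category)
  let ?a = "\<lambda>(F, \<sigma>, G). (colax_of_point F, \<lambda>n. \<sigma> (pth n), colax_of_point G)"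
  have hom_P: "hom ?P F G = {(F, \<sigma>, G) |\<sigma>. is_point one_cat (one_object_bicat M) W F \<and>
      is_point one_cat (one_object_bicat M) W G \<and>
      colax_delta_trans M (colax_of_point F) (colax_of_point G) (\<lambda>n. \<sigma> (pth n))}" for F G
    using colax_transformation_iff[OF M] by (auto simp: hom_def point_cat_def is_point_def)
  have hom_H: "hom ?H X Y = {(X, \<sigma>, Y) |\<sigma>. is_homotopy_monoid M W X \<and> is_homotopy_monoid M W Y \<and>
      colax_delta_trans M X Y \<sigma>}" for X Y
    by (auto simp: hom_def homotopy_monoid_cat_def monoidal_nat_trans_iff)
  have obj: "Obj ?P = {F. is_point one_cat (one_object_bicat M) W F}" "Obj ?H = {Y. is_homotopy_monoid M W Y}"
    by (simp_all add: point_cat_def homotopy_monoid_cat_def)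
  have comp: "Comp ?P (G', \<tau>, H) (F, \<sigma>, G) = (F, \<lambda>s. \<tau> s \<cdot>\<^bsub>M\<^esub> \<sigma> s, H)"
    "Comp ?H (Y', \<tau>', Z) (X, \<sigma>', Y) = (X, \<lambda>n. \<tau>' n \<cdot>\<^bsub>M\<^esub> \<sigma>' n, Z)"
    "Ident ?P F = (F, \<lambda>s. Ident M (FObj F s), F)" "Ident ?H X = (X, \<lambda>n. Ident M (FObj X n), X)"
    for F G H G' \<sigma> \<tau> Y Y' X Z \<sigma>' \<tau>'
    by (simp_all add: point_cat_def homotopy_monoid_cat_def restrict_UNIV)
  have "weak_equivalence ?P ?H
      \<lparr>FObj = (\<lambda>A \<in> Obj ?P. colax_of_point A), FArr = (\<lambda>f \<in> Arr ?P. ?a f)\<rparr>"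
  proof (rule weak_equivalenceI[OF homotopy_monoid_category])
    fix f assume "f \<in> Arr ?P"
    then show "Dom ?P f \<in> Obj ?P \<and> Cod ?P f \<in> Obj ?P" by (auto simp: point_cat_def)
  next
    fix F assume F: "F \<in> Obj ?P"
    then have "colax_delta M (colax_of_point F)"
      using M by (simp add: obj point_iff homotopy_monoid_iff)
    from colax_delta_trans_ident[OF this]
    show "Ident ?P F \<in> hom ?P F F \<and> ?a (Ident ?P F) = Ident ?H (colax_of_point F)"
      using F by (simp add: comp hom_P obj)
    show "colax_of_point F \<in> Obj ?H" using F M by (simp add: obj point_iff)
  next
    fix f g F G H assume "f \<in> hom ?P F G" "g \<in> hom ?P G H"
    then obtain \<sigma> \<tau> where f: "f = (F, \<sigma>, G)" and g: "g = (G, \<tau>, H)"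
      and *: "is_point one_cat (one_object_bicat M) W F" "is_point one_cat (one_object_bicat M) W H"
      "colax_delta_trans M (colax_of_point F) (colax_of_point G) (\<lambda>n. \<sigma> (pth n))"
      "colax_delta_trans M (colax_of_point G) (colax_of_point H) (\<lambda>n. \<tau> (pth n))"
      by (auto simp: hom_P)
    show "g \<cdot>\<^bsub>?P\<^esub> f \<in> hom ?P F H \<and> ?a (g \<cdot>\<^bsub>?P\<^esub> f) = ?a g \<cdot>\<^bsub>?H\<^esub> ?a f"
      using colax_delta_trans_comp[OF *(3,4)] *(1,2) by (simp add: f g comp hom_P)
  next
    fix F G assume F: "F \<in> Obj ?P" and G: "G \<in> Obj ?P"
    show "bij_betw ?a (hom ?P F G) (hom ?H (colax_of_point F) (colax_of_point G))"
    proof (rule bij_betw_byWitness[where f' = "\<lambda>(_, \<sigma>, _). (F, \<lambda>s. \<sigma> (path_length s), G)"])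
      show "\<forall>a\<in>hom ?P F G. (\<lambda>(_, \<sigma>, _). (F, \<lambda>s. \<sigma> (path_length s), G)) (?a a) = a"
        by (auto simp: hom_P)
      show "\<forall>a\<in>hom ?H (colax_of_point F) (colax_of_point G). ?a ((\<lambda>(_, \<sigma>, _). (F, \<lambda>s. \<sigma> (path_length s), G)) a) = a"
        by (auto simp: hom_H)
      show "?a ` hom ?P F G \<subseteq> hom ?H (colax_of_point F) (colax_of_point G)"
        using M by (auto simp: hom_P hom_H point_iff)
      show "(\<lambda>(_, \<sigma>, _). (F, \<lambda>s. \<sigma> (path_length s), G)) ` hom ?H (colax_of_point F) (colax_of_point G) \<subseteq> hom ?P F G"
        using F G by (auto simp: hom_P hom_H obj)
    qed
  next
    fix Y assume Y: "Y \<in> Obj ?H"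
    then have "FArr Y \<in> extensional (Arr delta)"
      by (simp add: obj is_homotopy_monoid_def colax_monoidal_functor_def cat_functor_def cat_functor_axioms_def)
    \<comment> \<open>Every homotopy monoid is hit on the nose, so an identity is enough for
      essential surjectivity.\<close>
    then have eq: "colax_of_point (point_of_colax Y) = Y" by (rule colax_of_point_of_colax)
    have "point_of_colax Y \<in> Obj ?P" using Y M eq by (simp add: obj point_iff) (simp add: point_of_colax_def)
    moreover have "Ident ?H Y \<in> isos ?H" "Dom ?H (Ident ?H Y) = colax_of_point (point_of_colax Y)" "Cod ?H (Ident ?H Y) = Y"
      using Y by (simp_all add: eq)
    ultimately show "\<exists>A \<in> Obj ?P. \<exists>i \<in> isos ?H. Dom ?H i = colax_of_point A \<and> Cod ?H i = Y" by blast
  qed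
  then show ?thesis by blast
qed

section \<open>Coherence of the unit\<close>

context monoidal_category
begin

text \<open>Naturality of the right unitor identifies tensoring with \<open>\<I>\<close> with the
  identity functor, up to isomorphism.\<close>

lemma runit_faithful:
  assumes "f \<boxtimes> Ident M \<I> = g \<boxtimes> Ident M \<I>" "f \<in> Arr M" "g \<in> Arr M" "Dom M f = Dom M g" "Cod M f = Cod M g"
  shows "f = g"
proof (rule iso_cancel_right)
  show "f \<cdot> TRUnit M (Dom M f) = g \<cdot> TRUnit M (Dom M f)"
    using runit_nat[OF assms(2)] runit_nat[OF assms(3)] assms(1,4,5) by metis
qed (use assms(2-5) in simp_all)

lemma lunit_faithful:
  assumes "Ident M \<I> \<boxtimes> f = Ident M \<I> \<boxtimes> g" "f \<in> Arr M" "g \<in> Arr M" "Dom M f = Dom M g" "Cod M f = Cod M g"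
  shows "f = g"
proof (rule iso_cancel_right)
  show "f \<cdot> TLUnit M (Dom M f) = g \<cdot> TLUnit M (Dom M f)"
    using lunit_nat[OF assms(2)] lunit_nat[OF assms(3)] assms(1,4,5) by metis
qed (use assms(2-5) in simp_all)

lemma pentagon_comp:
  assumes "A \<in> Obj M" "B \<in> Obj M" "E \<in> Obj M" "K \<in> Obj M"
  shows "(Ident M A \<boxtimes> TAssoc M B E K) \<cdot> (TAssoc M A (B \<otimes> E) K \<cdot> (TAssoc M A B E \<boxtimes> Ident M K)) =
      TAssoc M A B (E \<otimes> K) \<cdot> TAssoc M (A \<otimes> B) E K"
  using pentagon[OF assms] assms by simp

lemma assoc_lwhisker:
  assumes "f \<in> Arr M" "B \<in> Obj M" "E \<in> Obj M"
  shows "TAssoc M (Cod M f) B E \<cdot> ((f \<boxtimes> Ident M B) \<boxtimes> Ident M E) =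
      (f \<boxtimes> Ident M (B \<otimes> E)) \<cdot> TAssoc M (Dom M f) B E"
  using tassoc_nat[of f "Ident M B" "Ident M E"] assms by simp

lemma assoc_mwhisker:
  assumes "f \<in> Arr M" "A \<in> Obj M" "E \<in> Obj M"
  shows "TAssoc M A (Cod M f) E \<cdot> ((Ident M A \<boxtimes> f) \<boxtimes> Ident M E) =
      (Ident M A \<boxtimes> (f \<boxtimes> Ident M E)) \<cdot> TAssoc M A (Dom M f) E"
  using tassoc_nat[of "Ident M A" f "Ident M E"] assms by simp

lemma assoc_rwhisker:
  assumes "f \<in> Arr M" "A \<in> Obj M" "B \<in> Obj M"
  shows "TAssoc M A B (Cod M f) \<cdot> (Ident M (A \<otimes> B) \<boxtimes> f) =
      (Ident M A \<boxtimes> (Ident M B \<boxtimes> f)) \<cdot> TAssoc M A B (Dom M f)"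
  using tassoc_nat[of "Ident M A" "Ident M B" f] assms by simp

text \<open>Kelly's argument: after tensoring with \<open>\<I>\<close> on the left, which is
  faithful, precompose with the isomorphism \<open>?i\<close> taken from the pentagon for
  \<open>\<I>\<close>, \<open>\<I>\<close>, \<open>A\<close>, \<open>B\<close>. The triangle, used
  once on each side, turns both composites into the same arrow.\<close>

lemma lunit_tensor:
  assumes A [simp]: "A \<in> Obj M" and B [simp]: "B \<in> Obj M"
  shows "TLUnit M (A \<otimes> B) \<cdot> TAssoc M \<I> A B = TLUnit M A \<boxtimes> Ident M B"
proof (rule lunit_faithful)
  let ?I = "Ident M \<I>" and ?i = "TAssoc M \<I> (\<I> \<otimes> A) B \<cdot> (TAssoc M \<I> \<I> A \<boxtimes> Ident M B)"
  show "?I \<boxtimes> (TLUnit M (A \<otimes> B) \<cdot> TAssoc M \<I> A B) = ?I \<boxtimes> (TLUnit M A \<boxtimes> Ident M B)"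
  proof (rule iso_cancel_right)
    have "(?I \<boxtimes> (TLUnit M (A \<otimes> B) \<cdot> TAssoc M \<I> A B)) \<cdot> ?i =
        (?I \<boxtimes> TLUnit M (A \<otimes> B)) \<cdot> ((?I \<boxtimes> TAssoc M \<I> A B) \<cdot> ?i)"
      by (simp add: interchange')
    also have "\<dots> = (?I \<boxtimes> TLUnit M (A \<otimes> B)) \<cdot> (TAssoc M \<I> \<I> (A \<otimes> B) \<cdot> TAssoc M (\<I> \<otimes> \<I>) A B)"
      by (subst pentagon_comp) simp_all
    also have "\<dots> = (TRUnit M \<I> \<boxtimes> Ident M (A \<otimes> B)) \<cdot> TAssoc M (\<I> \<otimes> \<I>) A B"
      using triangle[of \<I> "A \<otimes> B"] by (simp add: comp_reduce)
    also have "\<dots> = TAssoc M \<I> A B \<cdot> ((TRUnit M \<I> \<boxtimes> Ident M A) \<boxtimes> Ident M B)"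
      using assoc_lwhisker[of "TRUnit M \<I>" A B] by simp
    finally have 1: "(?I \<boxtimes> (TLUnit M (A \<otimes> B) \<cdot> TAssoc M \<I> A B)) \<cdot> ?i = \<dots>" .
    have "(?I \<boxtimes> (TLUnit M A \<boxtimes> Ident M B)) \<cdot> ?i =
        ((?I \<boxtimes> (TLUnit M A \<boxtimes> Ident M B)) \<cdot> TAssoc M \<I> (\<I> \<otimes> A) B) \<cdot> (TAssoc M \<I> \<I> A \<boxtimes> Ident M B)"
      by simp
    also have "\<dots> = (TAssoc M \<I> A B \<cdot> ((?I \<boxtimes> TLUnit M A) \<boxtimes> Ident M B)) \<cdot> (TAssoc M \<I> \<I> A \<boxtimes> Ident M B)"
      using assoc_mwhisker[of "TLUnit M A" \<I> B] by simp
    also have "\<dots> = TAssoc M \<I> A B \<cdot> (((?I \<boxtimes> TLUnit M A) \<cdot> TAssoc M \<I> \<I> A) \<boxtimes> Ident M B)"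
      by (simp add: interchange)
    also have "\<dots> = TAssoc M \<I> A B \<cdot> ((TRUnit M \<I> \<boxtimes> Ident M A) \<boxtimes> Ident M B)"
      using triangle[of \<I> A] by simp
    finally show "(?I \<boxtimes> (TLUnit M (A \<otimes> B) \<cdot> TAssoc M \<I> A B)) \<cdot> ?i = (?I \<boxtimes> (TLUnit M A \<boxtimes> Ident M B)) \<cdot> ?i"
      using 1 by simp
  qed simp_all
qed simp_all

text \<open>The analogue for the right unitor: tensor with \<open>\<I>\<close> on the right,
  postcompose with the associator, and use the pentagon for \<open>A\<close>, \<open>B\<close>,
  \<open>\<I>\<close>, \<open>\<I>\<close> together with the triangles at \<open>B\<close> and at
  \<open>A \<otimes> B\<close>.\<close>

lemma runit_tensor:
  assumes A [simp]: "A \<in> Obj M" and B [simp]: "B \<in> Obj M"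
  shows "(Ident M A \<boxtimes> TRUnit M B) \<cdot> TAssoc M A B \<I> = TRUnit M (A \<otimes> B)"
proof (rule runit_faithful)
  let ?I = "Ident M \<I>" and ?i = "TAssoc M A B \<I>"
  show "((Ident M A \<boxtimes> TRUnit M B) \<cdot> ?i) \<boxtimes> ?I = TRUnit M (A \<otimes> B) \<boxtimes> ?I"
  proof (rule iso_cancel_left)
    have "?i \<cdot> (((Ident M A \<boxtimes> TRUnit M B) \<cdot> ?i) \<boxtimes> ?I) =
        (?i \<cdot> ((Ident M A \<boxtimes> TRUnit M B) \<boxtimes> ?I)) \<cdot> (?i \<boxtimes> ?I)"
      by (simp add: interchange)
    also have "\<dots> = ((Ident M A \<boxtimes> (TRUnit M B \<boxtimes> ?I)) \<cdot> TAssoc M A (B \<otimes> \<I>) \<I>) \<cdot> (?i \<boxtimes> ?I)"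
      using assoc_mwhisker[of "TRUnit M B" A \<I>] by simp
    also have "\<dots> = (Ident M A \<boxtimes> ((Ident M B \<boxtimes> TLUnit M \<I>) \<cdot> TAssoc M B \<I> \<I>)) \<cdot> (TAssoc M A (B \<otimes> \<I>) \<I> \<cdot> (?i \<boxtimes> ?I))"
      using triangle[of B \<I>] by simp
    also have "\<dots> = (Ident M A \<boxtimes> (Ident M B \<boxtimes> TLUnit M \<I>)) \<cdot>
        ((Ident M A \<boxtimes> TAssoc M B \<I> \<I>) \<cdot> (TAssoc M A (B \<otimes> \<I>) \<I> \<cdot> (?i \<boxtimes> ?I)))"
      by (simp add: interchange')
    also have "\<dots> = (Ident M A \<boxtimes> (Ident M B \<boxtimes> TLUnit M \<I>)) \<cdot> (TAssoc M A B (\<I> \<otimes> \<I>) \<cdot> TAssoc M (A \<otimes> B) \<I> \<I>)"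
      by (subst pentagon_comp) simp_all
    also have "\<dots> = ((Ident M A \<boxtimes> (Ident M B \<boxtimes> TLUnit M \<I>)) \<cdot> TAssoc M A B (\<I> \<otimes> \<I>)) \<cdot> TAssoc M (A \<otimes> B) \<I> \<I>"
      by simp
    also have "\<dots> = (?i \<cdot> (Ident M (A \<otimes> B) \<boxtimes> TLUnit M \<I>)) \<cdot> TAssoc M (A \<otimes> B) \<I> \<I>"
      using assoc_rwhisker[of "TLUnit M \<I>" A B] by simp
    also have "\<dots> = ?i \<cdot> (TRUnit M (A \<otimes> B) \<boxtimes> ?I)"
      using triangle[of "A \<otimes> B" \<I>] by simp
    finally show "?i \<cdot> (((Ident M A \<boxtimes> TRUnit M B) \<cdot> ?i) \<boxtimes> ?I) = ?i \<cdot> (TRUnit M (A \<otimes> B) \<boxtimes> ?I)" .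
  qed simp_all
qed simp_all

text \<open>Naturality of the left unitor at its own component at \<open>\<I>\<close> shows that the
  component at \<open>\<I> \<otimes> \<I>\<close> is the tensor of \<open>Ident M \<I>\<close> with
  the one at \<open>\<I>\<close>. Then \<open>lunit_tensor\<close> and the triangle have a common
  side, and tensoring with \<open>\<I>\<close> is faithful.\<close>

lemma lunit_runit_unit: "TLUnit M \<I> = TRUnit M \<I>"
proof (rule runit_faithful)
  have "TLUnit M (\<I> \<otimes> \<I>) = Ident M \<I> \<boxtimes> TLUnit M \<I>"
  proof (rule iso_cancel_left)
    show "TLUnit M \<I> \<cdot> TLUnit M (\<I> \<otimes> \<I>) = TLUnit M \<I> \<cdot> (Ident M \<I> \<boxtimes> TLUnit M \<I>)"
      using lunit_nat[of "TLUnit M \<I>"] by simp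
  qed simp_all
  then show "TLUnit M \<I> \<boxtimes> Ident M \<I> = TRUnit M \<I> \<boxtimes> Ident M \<I>"
    using lunit_tensor[of \<I> \<I>] triangle[of \<I> \<I>] by simp
qed simp_all

end

section \<open>Monoids from strong monoidal functors on finite ordinals\<close>


abbreviation "delta_mult \<equiv> delta_arr (Suc (Suc 0)) (Suc 0) (\<lambda>_. 0)"
abbreviation "delta_unit \<equiv> delta_arr 0 (Suc 0) (\<lambda>_. 0)"
abbreviation "delta_one \<equiv> Ident delta (Suc 0)"

lemma mono_map_bang' [simp]: "mono_map (Suc (Suc 0)) (Suc 0) (\<lambda>_. 0)" "mono_map 0 m f"
  by (auto simp: mono_map_def)

text \<open>Both sides are arrows 3 -> 1, and 1 is terminal in \<open>delta\<close>. This and the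
  unit laws that follow make 1 a monoid.\<close>

lemma delta_mult_assoc: "delta_mult \<cdot>\<^bsub>delta\<^esub> (delta_mult \<boxtimes>\<^bsub>delta\<^esub> delta_one) = delta_mult \<cdot>\<^bsub>delta\<^esub> (delta_one \<boxtimes>\<^bsub>delta\<^esub> delta_mult)"
  using mono_map_osum[of "Suc (Suc 0)" "Suc 0" "\<lambda>_. 0" "Suc 0" "Suc 0" "\<lambda>i. i"]
    mono_map_osum[of "Suc 0" "Suc 0" "\<lambda>i. i" "Suc (Suc 0)" "Suc 0" "\<lambda>_. 0"]
  by (simp add: delta_ident delta_tensor delta_comp delta_arr_eq)

lemma delta_mult_lunit: "delta_mult \<cdot>\<^bsub>delta\<^esub> (delta_unit \<boxtimes>\<^bsub>delta\<^esub> delta_one) = delta_one"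
  and delta_mult_runit: "delta_mult \<cdot>\<^bsub>delta\<^esub> (delta_one \<boxtimes>\<^bsub>delta\<^esub> delta_unit) = delta_one"
  using mono_map_osum[of 0 "Suc 0" "\<lambda>_. 0" "Suc 0" "Suc 0" "\<lambda>i. i"]
    mono_map_osum[of "Suc 0" "Suc 0" "\<lambda>i. i" 0 "Suc 0" "\<lambda>_. 0"]
  by (simp_all add: delta_ident delta_tensor delta_comp delta_arr_eq)

locale strong_delta = colax_delta M Y
  for M :: "('p, 'b, 'n) moncat_scheme" (structure) and Y :: "(nat, nat \<times> (nat \<Rightarrow> nat) \<times> nat, 'p, 'b) colax_mon" +
  assumes xi_iso [simp]: "Xi Y m n \<in> isos M" and xi0_iso [simp]: "Xi0 Y \<in> isos M"
begin

text \<open>The multiplication 2 -> 1 of the monoid 1, transported to Y(1) along the inverse of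
  \<xi>; \<open>unit\<close> treats 0 -> 1 likewise.\<close>

definition mult where "mult = FArr Y delta_mult \<cdot> cod.inverse (Xi Y (Suc 0) (Suc 0))"
definition unit where "unit = FArr Y delta_unit \<cdot> cod.inverse (Xi0 Y)"

lemma mult_simps [simp]: "mult \<in> Arr M" "Dom M mult = FObj Y (Suc 0) \<otimes> FObj Y (Suc 0)" "Cod M mult = FObj Y (Suc 0)"
  by (simp_all add: mult_def)

lemma unit_simps [simp]: "unit \<in> Arr M" "Dom M unit = \<I>" "Cod M unit = FObj Y (Suc 0)"
  by (simp_all add: unit_def)

lemma mult_xi: "mult \<cdot> Xi Y (Suc 0) (Suc 0) = FArr Y delta_mult"
  by (simp add: mult_def)

lemma unit_xi: "unit \<cdot> Xi0 Y = FArr Y delta_unit"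
  by (simp add: unit_def)

abbreviation "one \<equiv> Ident M (FObj Y (Suc 0))"

text \<open>By naturality of \<xi> and \<open>mult_xi\<close>, a product of images, precomposed with
  \<xi>, is the image of a single arrow of \<open>delta\<close>. Each monoid law for Y(1) thereby
  becomes the image of a law for 1.\<close>

lemma mult_tensor:
  assumes "f \<in> Arr delta" "g \<in> Arr delta" "Cod delta f = Suc 0" "Cod delta g = Suc 0"
  shows "mult \<cdot> ((FArr Y f \<boxtimes> FArr Y g) \<cdot> Xi Y (Dom delta f) (Dom delta g)) =
    FArr Y (delta_mult \<cdot>\<^bsub>delta\<^esub> (f \<boxtimes>\<^bsub>delta\<^esub> g))"
proof -
  have "mult \<cdot> ((FArr Y f \<boxtimes> FArr Y g) \<cdot> Xi Y (Dom delta f) (Dom delta g)) =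
      mult \<cdot> (Xi Y (Suc 0) (Suc 0) \<cdot> FArr Y (f \<boxtimes>\<^bsub>delta\<^esub> g))"
    using xi_nat[OF assms(1,2)] assms(3,4) by simp
  also have "\<dots> = FArr Y delta_mult \<cdot> FArr Y (f \<boxtimes>\<^bsub>delta\<^esub> g)"
    by (rule cod.comp_reduce[OF mult_xi]) (use assms in simp_all)
  also have "\<dots> = FArr Y (delta_mult \<cdot>\<^bsub>delta\<^esub> (f \<boxtimes>\<^bsub>delta\<^esub> g))"
    by (rule farr_comp_simp[symmetric]) (use assms in simp_all)
  finally show ?thesis .
qed

lemma is_monoid: "is_monoid M (FObj Y (Suc 0), mult, unit)"
proof -
  let ?x = "Xi Y (Suc 0) (Suc 0)"
  have "mult \<cdot> (mult \<boxtimes> one) = mult \<cdot> ((one \<boxtimes> mult) \<cdot> TAssoc M (FObj Y (Suc 0)) (FObj Y (Suc 0)) (FObj Y (Suc 0)))"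
  proof (rule cod.iso_cancel_right)
    \<comment> \<open>An isomorphism from Y(3) to the left-nested triple tensor of Y(1); precomposed
      with it, both sides of associativity are images of arrows 3 -> 1.\<close>
    let ?i = "(?x \<boxtimes> one) \<cdot> Xi Y (Suc (Suc 0)) (Suc 0)"
    have "(mult \<cdot> (mult \<boxtimes> one)) \<cdot> ?i = mult \<cdot> ((FArr Y delta_mult \<boxtimes> FArr Y delta_one) \<cdot> Xi Y (Suc (Suc 0)) (Suc 0))"
      by (simp add: cod.interchange' mult_xi)
    also have "\<dots> = FArr Y (delta_mult \<cdot>\<^bsub>delta\<^esub> (delta_mult \<boxtimes>\<^bsub>delta\<^esub> delta_one))"
      using mult_tensor[of delta_mult delta_one] by simp
    finally have 1: "(mult \<cdot> (mult \<boxtimes> one)) \<cdot> ?i = \<dots>" .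
    have "(mult \<cdot> ((one \<boxtimes> mult) \<cdot> TAssoc M (FObj Y (Suc 0)) (FObj Y (Suc 0)) (FObj Y (Suc 0)))) \<cdot> ?i =
        mult \<cdot> ((one \<boxtimes> mult) \<cdot> (TAssoc M (FObj Y (Suc 0)) (FObj Y (Suc 0)) (FObj Y (Suc 0)) \<cdot> ?i))"
      by simp
    also have "\<dots> = mult \<cdot> ((one \<boxtimes> mult) \<cdot> ((one \<boxtimes> ?x) \<cdot> Xi Y (Suc 0) (Suc (Suc 0))))"
      using xi_assoc_delta[of "Suc 0" "Suc 0" "Suc 0"] by simp
    also have "\<dots> = mult \<cdot> ((FArr Y delta_one \<boxtimes> FArr Y delta_mult) \<cdot> Xi Y (Suc 0) (Suc (Suc 0)))"
      by (simp add: cod.interchange' mult_xi)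
    also have "\<dots> = FArr Y (delta_mult \<cdot>\<^bsub>delta\<^esub> (delta_one \<boxtimes>\<^bsub>delta\<^esub> delta_mult))"
      using mult_tensor[of delta_one delta_mult] by simp
    finally show "(mult \<cdot> (mult \<boxtimes> one)) \<cdot> ?i =
        (mult \<cdot> ((one \<boxtimes> mult) \<cdot> TAssoc M (FObj Y (Suc 0)) (FObj Y (Suc 0)) (FObj Y (Suc 0)))) \<cdot> ?i"
      using 1 by (simp only: delta_mult_assoc)
  qed simp_all
  moreover have "mult \<cdot> (unit \<boxtimes> one) = TLUnit M (FObj Y (Suc 0))"
  proof (rule cod.iso_cancel_right)
    let ?i = "(Xi0 Y \<boxtimes> one) \<cdot> Xi Y 0 (Suc 0)"
    have "(mult \<cdot> (unit \<boxtimes> one)) \<cdot> ?i = mult \<cdot> ((FArr Y delta_unit \<boxtimes> FArr Y delta_one) \<cdot> Xi Y 0 (Suc 0))"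
      by (simp add: cod.interchange' unit_xi)
    also have "\<dots> = one"
      using mult_tensor[of delta_unit delta_one] by (simp add: delta_mult_lunit)
    finally show "(mult \<cdot> (unit \<boxtimes> one)) \<cdot> ?i = TLUnit M (FObj Y (Suc 0)) \<cdot> ?i"
      using xi_lunit_delta[of "Suc 0"] by simp
  qed simp_all
  moreover have "mult \<cdot> (one \<boxtimes> unit) = TRUnit M (FObj Y (Suc 0))"
  proof (rule cod.iso_cancel_right)
    let ?i = "(one \<boxtimes> Xi0 Y) \<cdot> Xi Y (Suc 0) 0"
    have "(mult \<cdot> (one \<boxtimes> unit)) \<cdot> ?i = mult \<cdot> ((FArr Y delta_one \<boxtimes> FArr Y delta_unit) \<cdot> Xi Y (Suc 0) 0)"
      by (simp add: cod.interchange' unit_xi)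
    also have "\<dots> = one"
      using mult_tensor[of delta_one delta_unit] by (simp add: delta_mult_runit)
    finally show "(mult \<cdot> (one \<boxtimes> unit)) \<cdot> ?i = TRUnit M (FObj Y (Suc 0)) \<cdot> ?i"
      using xi_runit_delta[of "Suc 0"] by simp
  qed simp_all
  ultimately show ?thesis by (simp add: is_monoid_def hom_def)
qed

end

section \<open>Transformations of strong functors and monoid homomorphisms\<close>

locale strong_delta_pair = Y: strong_delta M Y + Z: strong_delta M Z
  for M :: "('p, 'b, 'n) moncat_scheme" (structure) and Y Z :: "(nat, nat \<times> (nat \<Rightarrow> nat) \<times> nat, 'p, 'b) colax_mon"
begin

lemma monoid_hom_of_trans:
  assumes "colax_delta_trans M Y Z \<sigma>"
  shows "is_monoid_hom M (FObj Y (Suc 0), Y.mult, Y.unit) (FObj Z (Suc 0), Z.mult, Z.unit) (\<sigma> (Suc 0))"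
proof -
  interpret colax_delta_trans M Y Z \<sigma> by fact
  let ?f = "\<sigma> (Suc 0)"
  have "?f \<cdot> Y.mult = Z.mult \<cdot> (?f \<boxtimes> ?f)"
  proof (rule Y.cod.iso_cancel_right)
    have "(Z.mult \<cdot> (?f \<boxtimes> ?f)) \<cdot> Xi Y (Suc 0) (Suc 0) = Z.mult \<cdot> (Xi Z (Suc 0) (Suc 0) \<cdot> \<sigma> (Suc (Suc 0)))"
      using xi_comm[of "Suc 0" "Suc 0"] by simp
    also have "\<dots> = FArr Z delta_mult \<cdot> \<sigma> (Suc (Suc 0))"
      by (rule Y.cod.comp_reduce[OF Z.mult_xi]) simp_all
    also have "\<dots> = ?f \<cdot> FArr Y delta_mult"
      using natural_simp[of delta_mult] by simp
    finally show "(?f \<cdot> Y.mult) \<cdot> Xi Y (Suc 0) (Suc 0) = (Z.mult \<cdot> (?f \<boxtimes> ?f)) \<cdot> Xi Y (Suc 0) (Suc 0)"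
      by (simp add: Y.mult_xi)
  qed simp_all
  moreover have "?f \<cdot> Y.unit = Z.unit"
  proof (rule Y.cod.iso_cancel_right)
    have "Z.unit \<cdot> Xi0 Y = Z.unit \<cdot> (Xi0 Z \<cdot> \<sigma> 0)"
      by (simp add: xi0_comm)
    also have "\<dots> = FArr Z delta_unit \<cdot> \<sigma> 0"
      by (rule Y.cod.comp_reduce[OF Z.unit_xi]) simp_all
    also have "\<dots> = ?f \<cdot> FArr Y delta_unit"
      using natural_simp[of delta_unit] by simp
    finally show "(?f \<cdot> Y.unit) \<cdot> Xi0 Y = Z.unit \<cdot> Xi0 Y"
      by (simp add: Y.unit_xi)
  qed simp_all
  ultimately show ?thesis by (simp add: is_monoid_hom_def hom_def)
qed

text \<open>Since \<xi> of \<open>Z\<close> is invertible, compatibility with it at (n, 1)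
  determines the component at n+1 from those at n and 1, and compatibility with \<open>Xi0\<close>
  determines the one at 0.\<close>

lemma trans_determined:
  assumes "colax_delta_trans M Y Z \<sigma>" "colax_delta_trans M Y Z \<tau>" "\<sigma> (Suc 0) = \<tau> (Suc 0)"
  shows "\<sigma> = \<tau>"
proof
  interpret s: colax_delta_trans M Y Z \<sigma> by fact
  interpret t: colax_delta_trans M Y Z \<tau> by fact
  show "\<sigma> n = \<tau> n" for n
  proof (induction n)
    case 0
    show ?case
    proof (rule Y.cod.iso_cancel_left)
      show "Xi0 Z \<cdot> \<sigma> 0 = Xi0 Z \<cdot> \<tau> 0" by (simp only: s.xi0_comm t.xi0_comm)
    qed simp_all
  next
    case (Suc n)
    show ?case
    proof (rule Y.cod.iso_cancel_left)
      show "Xi Z n (Suc 0) \<cdot> \<sigma> (Suc n) = Xi Z n (Suc 0) \<cdot> \<tau> (Suc n)"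
        using s.xi_comm[of n "Suc 0"] t.xi_comm[of n "Suc 0"] Suc assms(3) by simp
    qed simp_all
  qed
qed

context
  fixes f
  assumes f: "is_monoid_hom M (FObj Y (Suc 0), Y.mult, Y.unit) (FObj Z (Suc 0), Z.mult, Z.unit) f"
begin

lemma f_simps [simp]: "f \<in> Arr M" "Dom M f = FObj Y (Suc 0)" "Cod M f = FObj Z (Suc 0)"
  and f_mult: "f \<cdot> Y.mult = Z.mult \<cdot> (f \<boxtimes> f)" and f_unit: "f \<cdot> Y.unit = Z.unit"
  using f by (auto simp: is_monoid_hom_def hom_def)

text \<open>The recursion is the one forced by \<open>trans_determined\<close>: compatibility at (n,
  1) and at the unit solved for the next component.\<close>

primrec ext where
  "ext 0 = Y.cod.inverse (Xi0 Z) \<cdot> Xi0 Y"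
| "ext (Suc n) = Y.cod.inverse (Xi Z n (Suc 0)) \<cdot> ((ext n \<boxtimes> f) \<cdot> Xi Y n (Suc 0))"

lemma ext_simps [simp]: "ext n \<in> Arr M \<and> Dom M (ext n) = FObj Y n \<and> Cod M (ext n) = FObj Z n"
  by (induction n) simp_all

lemma ext_simps' [simp]: "ext n \<in> Arr M" "Dom M (ext n) = FObj Y n" "Cod M (ext n) = FObj Z n"
  using ext_simps by blast+

lemma ext_0: "Xi0 Z \<cdot> ext 0 = Xi0 Y"
  by simp

lemma ext_Suc: "Xi Z n (Suc 0) \<cdot> ext (Suc n) = (ext n \<boxtimes> f) \<cdot> Xi Y n (Suc 0)"
  by simp

declare ext.simps [simp del]

text \<open>The recursion produces \<open>ext (Suc 0)\<close> from \<open>ext 0\<close> tensored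
  with \<open>f\<close>, so this is not immediate: left unit coherence of \<open>Z\<close> and of
  \<open>Y\<close>, linked by naturality of the left unitor, removes the extra unit factor.\<close>

lemma ext_1: "ext (Suc 0) = f"
proof -
  have "ext (Suc 0) = (TLUnit M (FObj Z (Suc 0)) \<cdot> ((Xi0 Z \<boxtimes> Z.one) \<cdot> Xi Z 0 (Suc 0))) \<cdot> ext (Suc 0)"
    using Z.xi_lunit_delta[of "Suc 0"] by simp
  also have "\<dots> = TLUnit M (FObj Z (Suc 0)) \<cdot> ((Xi0 Z \<boxtimes> Z.one) \<cdot> (Xi Z 0 (Suc 0) \<cdot> ext (Suc 0)))"
    by simp
  also have "\<dots> = TLUnit M (FObj Z (Suc 0)) \<cdot> ((Xi0 Y \<boxtimes> f) \<cdot> Xi Y 0 (Suc 0))"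
    by (simp add: ext_Suc Y.cod.interchange' ext_0)
  also have "\<dots> = (TLUnit M (FObj Z (Suc 0)) \<cdot> (Ident M \<I> \<boxtimes> f)) \<cdot> ((Xi0 Y \<boxtimes> Y.one) \<cdot> Xi Y 0 (Suc 0))"
    by (simp add: Y.cod.interchange')
  also have "\<dots> = f \<cdot> (TLUnit M (FObj Y (Suc 0)) \<cdot> ((Xi0 Y \<boxtimes> Y.one) \<cdot> Xi Y 0 (Suc 0)))"
    using Y.cod.lunit_nat[of f] by simp
  also have "\<dots> = f"
    using Y.xi_lunit_delta[of "Suc 0"] by simp
  finally show ?thesis .
qed

text \<open>Induction on \<open>n\<close> extends the compatibility from (n, 1) to all pairs. The
  base case is right unit coherence of \<open>Y\<close> and \<open>Z\<close>; the step is their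
  associativity coherence at (m, n, 1), with naturality of the associator in between.\<close>

lemma ext_xi: "Xi Z m n \<cdot> ext (m + n) = (ext m \<boxtimes> ext n) \<cdot> Xi Y m n"
proof (induction n)
  case 0
  let ?i = "TRUnit M (FObj Z m) \<cdot> (Ident M (FObj Z m) \<boxtimes> Xi0 Z)"
  show ?case
  proof (rule Y.cod.iso_cancel_left)
    have "?i \<cdot> ((ext m \<boxtimes> ext 0) \<cdot> Xi Y m 0) = TRUnit M (FObj Z m) \<cdot> ((ext m \<boxtimes> Xi0 Y) \<cdot> Xi Y m 0)"
      by (simp add: Y.cod.interchange' ext_0)
    also have "\<dots> = (TRUnit M (FObj Z m) \<cdot> (ext m \<boxtimes> Ident M \<I>)) \<cdot> ((Ident M (FObj Y m) \<boxtimes> Xi0 Y) \<cdot> Xi Y m 0)"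
      by (simp add: Y.cod.interchange')
    also have "\<dots> = ext m \<cdot> (TRUnit M (FObj Y m) \<cdot> ((Ident M (FObj Y m) \<boxtimes> Xi0 Y) \<cdot> Xi Y m 0))"
      using Y.cod.runit_nat[of "ext m"] by simp
    also have "\<dots> = ext m"
      using Y.xi_runit_delta[of m] by simp
    also have "\<dots> = (TRUnit M (FObj Z m) \<cdot> ((Ident M (FObj Z m) \<boxtimes> Xi0 Z) \<cdot> Xi Z m 0)) \<cdot> ext m"
      using Z.xi_runit_delta[of m] by simp
    also have "\<dots> = ?i \<cdot> (Xi Z m 0 \<cdot> ext (m + 0))"
      by simp
    finally show "?i \<cdot> (Xi Z m 0 \<cdot> ext (m + 0)) = ?i \<cdot> ((ext m \<boxtimes> ext 0) \<cdot> Xi Y m 0)" by simp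
  qed simp_all
next
  case (Suc n)
  let ?i = "Ident M (FObj Z m) \<boxtimes> Xi Z n (Suc 0)"
  let ?aZ = "TAssoc M (FObj Z m) (FObj Z n) (FObj Z (Suc 0))" and ?aY = "TAssoc M (FObj Y m) (FObj Y n) (FObj Y (Suc 0))"
  have Yas: "?aY \<cdot> ((Xi Y m n \<boxtimes> Y.one) \<cdot> Xi Y (m + n) (Suc 0)) = (Ident M (FObj Y m) \<boxtimes> Xi Y n (Suc 0)) \<cdot> Xi Y m (Suc n)"
    and Zas: "?aZ \<cdot> ((Xi Z m n \<boxtimes> Z.one) \<cdot> Xi Z (m + n) (Suc 0)) = ?i \<cdot> Xi Z m (Suc n)"
    using Y.xi_assoc_delta[of m n "Suc 0"] Z.xi_assoc_delta[of m n "Suc 0"] by simp_all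
  show ?case
  proof (rule Y.cod.iso_cancel_left)
    have "?i \<cdot> (Xi Z m (Suc n) \<cdot> ext (Suc (m + n))) = (?i \<cdot> Xi Z m (Suc n)) \<cdot> ext (Suc (m + n))"
      by simp
    also have "\<dots> = ?aZ \<cdot> ((Xi Z m n \<boxtimes> Z.one) \<cdot> (Xi Z (m + n) (Suc 0) \<cdot> ext (Suc (m + n))))"
      by (simp flip: Zas)
    also have "\<dots> = ?aZ \<cdot> (((Xi Z m n \<cdot> ext (m + n)) \<boxtimes> f) \<cdot> Xi Y (m + n) (Suc 0))"
      by (simp add: ext_Suc Y.cod.interchange')
    also have "\<dots> = ?aZ \<cdot> (((ext m \<boxtimes> ext n) \<boxtimes> f) \<cdot> ((Xi Y m n \<boxtimes> Y.one) \<cdot> Xi Y (m + n) (Suc 0)))"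
      by (simp add: Suc Y.cod.interchange')
    also have "\<dots> = (?aZ \<cdot> ((ext m \<boxtimes> ext n) \<boxtimes> f)) \<cdot> ((Xi Y m n \<boxtimes> Y.one) \<cdot> Xi Y (m + n) (Suc 0))"
      by simp
    also have "\<dots> = (ext m \<boxtimes> (ext n \<boxtimes> f)) \<cdot> (?aY \<cdot> ((Xi Y m n \<boxtimes> Y.one) \<cdot> Xi Y (m + n) (Suc 0)))"
      using Y.cod.tassoc_nat[of "ext m" "ext n" f] by simp
    also have "\<dots> = (ext m \<boxtimes> ((ext n \<boxtimes> f) \<cdot> Xi Y n (Suc 0))) \<cdot> Xi Y m (Suc n)"
      unfolding Yas by (simp add: Y.cod.interchange')
    also have "\<dots> = ?i \<cdot> ((ext m \<boxtimes> ext (Suc n)) \<cdot> Xi Y m (Suc n))"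
      by (simp add: Y.cod.interchange' flip: ext_Suc)
    finally show "?i \<cdot> (Xi Z m (Suc n) \<cdot> ext (m + Suc n)) = ?i \<cdot> ((ext m \<boxtimes> ext (Suc n)) \<cdot> Xi Y m (Suc n))"
      by simp
  qed simp_all
qed

text \<open>Naturality at the generators says that \<open>f\<close> preserves multiplication and
  unit. Commuting squares can be pasted along composition, and along the tensor product because
  \<xi> is natural, compatible with \<open>ext\<close> and invertible for \<open>Z\<close>.\<close>

lemma ext_natural: "x \<in> Arr delta \<Longrightarrow> ext (Cod delta x) \<cdot> FArr Y x = FArr Z x \<cdot> ext (Dom delta x)"
proof (induction x rule: delta_generated)
  case (ident n)
  show ?case by simp
next
  case mult
  have "ext (Suc 0) \<cdot> FArr Y delta_mult = (f \<cdot> Y.mult) \<cdot> Xi Y (Suc 0) (Suc 0)"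
    by (simp add: ext_1 Y.mult_xi)
  also have "\<dots> = Z.mult \<cdot> ((ext (Suc 0) \<boxtimes> ext (Suc 0)) \<cdot> Xi Y (Suc 0) (Suc 0))"
    by (simp add: f_mult ext_1)
  also have "\<dots> = Z.mult \<cdot> (Xi Z (Suc 0) (Suc 0) \<cdot> ext (Suc (Suc 0)))"
    using ext_xi[of "Suc 0" "Suc 0"] by simp
  also have "\<dots> = FArr Z delta_mult \<cdot> ext (Suc (Suc 0))"
    by (rule Y.cod.comp_reduce[OF Z.mult_xi]) simp_all
  finally show ?case by simp
next
  case unit
  have "ext (Suc 0) \<cdot> FArr Y delta_unit = (f \<cdot> Y.unit) \<cdot> Xi0 Y"
    by (simp add: ext_1 Y.unit_xi)
  also have "\<dots> = Z.unit \<cdot> (Xi0 Z \<cdot> ext 0)"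
    by (simp only: f_unit ext_0)
  also have "\<dots> = FArr Z delta_unit \<cdot> ext 0"
    by (rule Y.cod.comp_reduce[OF Z.unit_xi]) simp_all
  finally show ?case by simp
next
  case (comp x y)
  have "ext (Cod delta y) \<cdot> (FArr Y y \<cdot> FArr Y x) = FArr Z y \<cdot> (ext (Dom delta y) \<cdot> FArr Y x)"
    by (subst Y.cod.comp_reduce[OF comp.IH(2)]) (use comp.hyps in simp_all)
  then show ?case
    using comp by (simp add: Y.farr_comp_simp Z.farr_comp_simp)
next
  case (tensor x y)
  show ?case
  proof (rule Y.cod.iso_cancel_left)
    let ?i = "Xi Z (Cod delta x) (Cod delta y)"
    have "?i \<cdot> (ext (Cod delta x + Cod delta y) \<cdot> FArr Y (x \<boxtimes>\<^bsub>delta\<^esub> y)) =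
        (ext (Cod delta x) \<boxtimes> ext (Cod delta y)) \<cdot> (Xi Y (Cod delta x) (Cod delta y) \<cdot> FArr Y (x \<boxtimes>\<^bsub>delta\<^esub> y))"
      by (subst Y.cod.comp_reduce[OF ext_xi]) (use tensor.hyps in simp_all)
    also have "\<dots> = ((ext (Cod delta x) \<cdot> FArr Y x) \<boxtimes> (ext (Cod delta y) \<cdot> FArr Y y)) \<cdot> Xi Y (Dom delta x) (Dom delta y)"
      using tensor.hyps by (simp add: Y.xi_nat Y.cod.interchange')
    also have "\<dots> = (FArr Z x \<boxtimes> FArr Z y) \<cdot> ((ext (Dom delta x) \<boxtimes> ext (Dom delta y)) \<cdot> Xi Y (Dom delta x) (Dom delta y))"
      using tensor by (simp add: Y.cod.interchange')
    also have "\<dots> = ((FArr Z x \<boxtimes> FArr Z y) \<cdot> Xi Z (Dom delta x) (Dom delta y)) \<cdot> ext (Dom delta x + Dom delta y)"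
      using tensor.hyps by (simp flip: ext_xi)
    also have "\<dots> = ?i \<cdot> (FArr Z (x \<boxtimes>\<^bsub>delta\<^esub> y) \<cdot> ext (Dom delta x + Dom delta y))"
      using tensor.hyps by (simp flip: Z.xi_nat)
    finally show "?i \<cdot> (ext (Cod delta (x \<boxtimes>\<^bsub>delta\<^esub> y)) \<cdot> FArr Y (x \<boxtimes>\<^bsub>delta\<^esub> y)) =
        ?i \<cdot> (FArr Z (x \<boxtimes>\<^bsub>delta\<^esub> y) \<cdot> ext (Dom delta (x \<boxtimes>\<^bsub>delta\<^esub> y)))"
      using tensor.hyps by simp
  qed (use tensor.hyps in simp_all)
qed

lemma ext_trans: "colax_delta_trans M Y Z ext"
  by (rule colax_delta_transI[OF Y.colax_delta_axioms Z.colax_delta_axioms])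
    (simp_all add: ext_natural ext_xi ext_0)

end

lemma trans_of_monoid_hom:
  assumes "is_monoid_hom M (FObj Y (Suc 0), Y.mult, Y.unit) (FObj Z (Suc 0), Z.mult, Z.unit) f"
  shows "\<exists>\<sigma>. colax_delta_trans M Y Z \<sigma> \<and> \<sigma> (Suc 0) = f"
  using ext_trans[OF assms] ext_1[OF assms] by blast

end

section \<open>Strictness and splitting of arrows of \<open>delta\<close>\<close>

lemma delta_tensor_assoc:
  assumes "x \<in> Arr delta" "y \<in> Arr delta" "z \<in> Arr delta"
  shows "(x \<boxtimes>\<^bsub>delta\<^esub> y) \<boxtimes>\<^bsub>delta\<^esub> z = x \<boxtimes>\<^bsub>delta\<^esub> (y \<boxtimes>\<^bsub>delta\<^esub> z)"
  using delta.tassoc_nat[OF assms] assms by (simp add: add.assoc)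

lemma delta_tensor_empty: "x \<in> Arr delta \<Longrightarrow> x \<boxtimes>\<^bsub>delta\<^esub> Ident delta 0 = x"
  using delta.runit_nat[of x] by simp

lemma delta_split_arr:
  assumes "x \<in> Arr delta" "Cod delta x = a + b"
  obtains y z where "y \<in> Arr delta" "z \<in> Arr delta" "Cod delta y = a" "Cod delta z = b" "x = y \<boxtimes>\<^bsub>delta\<^esub> z"
proof -
  obtain u where u: "mono_map (Dom delta x) (a + b) u" "x = delta_arr (Dom delta x) (a + b) u"
    using assms by (metis delta_arrE)
  obtain p q f g where "mono_map p a f" "mono_map q b g" "delta_arr (Dom delta x) (a + b) u = delta_arr p a f \<boxtimes>\<^bsub>delta\<^esub> delta_arr q b g"
    using delta_split[OF u(1)] by metis
  then show ?thesis using that[of "delta_arr p a f" "delta_arr q b g"] u(2) by simp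
qed

lemma delta_terminal: "x \<in> Arr delta \<Longrightarrow> Cod delta x = Suc 0 \<Longrightarrow> x = delta_arr (Dom delta x) (Suc 0) (\<lambda>_. 0)"
proof -
  assume x: "x \<in> Arr delta" "Cod delta x = Suc 0"
  obtain f where f: "mono_map (Dom delta x) (Cod delta x) f" "x = delta_arr (Dom delta x) (Cod delta x) f"
    using x(1) by (rule delta_arrE)
  have "delta_arr (Dom delta x) (Cod delta x) f = delta_arr (Dom delta x) (Suc 0) (\<lambda>_. 0)"
    using f(1) x(2) by (auto simp: delta_arr_eq mono_map_def)
  with f(2) show ?thesis by (rule trans)
qed

section \<open>The strong monoidal functor of a monoid\<close>

locale monoid_object = monoidal_category M
  for M :: "('p, 'b, 'n) moncat_scheme" (structure) +
  fixes A \<mu> \<iota>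
  assumes monoid: "is_monoid M (A, \<mu>, \<iota>)"
begin

lemma A [simp]: "A \<in> Obj M"
  and mu_simps [simp]: "\<mu> \<in> Arr M" "Dom M \<mu> = A \<otimes> A" "Cod M \<mu> = A"
  and iota_simps [simp]: "\<iota> \<in> Arr M" "Dom M \<iota> = \<I>" "Cod M \<iota> = A"
  and mu_lunit: "\<mu> \<cdot> (\<iota> \<boxtimes> Ident M A) = TLUnit M A"
  and mu_runit: "\<mu> \<cdot> (Ident M A \<boxtimes> \<iota>) = TRUnit M A"
  using monoid by (auto simp: is_monoid_def hom_def)

lemma mu_assoc: "\<mu> \<cdot> (\<mu> \<boxtimes> Ident M A) = \<mu> \<cdot> ((Ident M A \<boxtimes> \<mu>) \<cdot> TAssoc M A A A)"
proof -
  have "\<mu> \<cdot> (\<mu> \<boxtimes> Ident M A) = \<mu> \<cdot> (Ident M A \<boxtimes> \<mu>) \<cdot> TAssoc M A A A"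
    using monoid by (auto simp: is_monoid_def)
  then show ?thesis by simp
qed

text \<open>Powers are left-nested with \<open>\<I>\<close> innermost, so the first power is
  \<open>\<I> \<otimes> A\<close> and not \<open>A\<close>; the left unitor compares the
  two.\<close>

primrec tpow where
  "tpow 0 = \<I>"
| "tpow (Suc n) = tpow n \<otimes> A"

lemma tpow_obj [simp]: "tpow n \<in> Obj M"
  by (induction n) simp_all

text \<open>The canonical rebracketing of the (m+n)-th power, which will serve as \<xi>. Recursion
  on the second argument agrees with the left nesting.\<close>

primrec tpow_split where
  "tpow_split m 0 = inverse (TRUnit M (tpow m))"
| "tpow_split m (Suc n) = TAssoc M (tpow m) (tpow n) A \<cdot> (tpow_split m n \<boxtimes> Ident M A)"

lemma tpow_split_all: "tpow_split m n \<in> isos M \<and> tpow_split m n \<in> Arr M \<and> Dom M (tpow_split m n) = tpow (m + n) \<and> Cod M (tpow_split m n) = tpow m \<otimes> tpow n"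
  by (induction n) simp_all

lemma tpow_split_simps [simp]: "tpow_split m n \<in> isos M" "tpow_split m n \<in> Arr M" "Dom M (tpow_split m n) = tpow (m + n)"
  "Cod M (tpow_split m n) = tpow m \<otimes> tpow n"
  using tpow_split_all by blast+

declare tpow_split.simps [simp del]

lemma tpow_split_0: "TRUnit M (tpow m) \<cdot> tpow_split m 0 = Ident M (tpow m)"
  by (simp add: tpow_split.simps)

text \<open>The recursion is adapted to the right unit, so the left one needs an induction:
  \<open>lunit_runit_unit\<close> starts it and \<open>lunit_tensor\<close> carries it on.\<close>

lemma tpow_split_lunit: "TLUnit M (tpow n) \<cdot> tpow_split 0 n = Ident M (tpow n)"
proof (induction n)
  case 0
  show ?case using tpow_split_0[of 0] by (simp add: lunit_runit_unit)
next
  case (Suc n)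
  have "TLUnit M (tpow n \<otimes> A) \<cdot> (TAssoc M \<I> (tpow n) A \<cdot> (tpow_split 0 n \<boxtimes> Ident M A)) =
      (TLUnit M (tpow n \<otimes> A) \<cdot> TAssoc M \<I> (tpow n) A) \<cdot> (tpow_split 0 n \<boxtimes> Ident M A)"
    by simp
  also have "\<dots> = Ident M (tpow n \<otimes> A)"
    by (subst lunit_tensor) (simp_all add: interchange Suc)
  finally show ?case by (simp add: tpow_split.simps)
qed

text \<open>Induction on \<open>k\<close>. For \<open>k = 0\<close> the associator is absorbed by
  \<open>runit_tensor\<close>; in the step the pentagon separates the last factor \<open>A\<close>,
  and naturality of the associator moves the rebracketings past it.\<close>

lemma tpow_split_assoc:
  "TAssoc M (tpow m) (tpow n) (tpow k) \<cdot> ((tpow_split m n \<boxtimes> Ident M (tpow k)) \<cdot> tpow_split (m + n) k) =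
   (Ident M (tpow m) \<boxtimes> tpow_split n k) \<cdot> tpow_split m (n + k)"
proof (induction k)
  case 0
  show ?case
  proof (rule iso_cancel_left)
    let ?i = "Ident M (tpow m) \<boxtimes> TRUnit M (tpow n)"
    have "?i \<cdot> (TAssoc M (tpow m) (tpow n) \<I> \<cdot> ((tpow_split m n \<boxtimes> Ident M \<I>) \<cdot> tpow_split (m + n) 0)) =
        TRUnit M (tpow m \<otimes> tpow n) \<cdot> ((tpow_split m n \<boxtimes> Ident M \<I>) \<cdot> tpow_split (m + n) 0)"
      by (rule comp_reduce[OF runit_tensor]) simp_all
    also have "\<dots> = (TRUnit M (tpow m \<otimes> tpow n) \<cdot> (tpow_split m n \<boxtimes> Ident M \<I>)) \<cdot> tpow_split (m + n) 0"
      by simp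
    also have "\<dots> = tpow_split m n \<cdot> (TRUnit M (tpow (m + n)) \<cdot> tpow_split (m + n) 0)"
      using runit_nat[of "tpow_split m n"] by simp
    also have "\<dots> = tpow_split m n"
      by (simp add: tpow_split_0)
    also have "\<dots> = ?i \<cdot> ((Ident M (tpow m) \<boxtimes> tpow_split n 0) \<cdot> tpow_split m n)"
      by (simp add: interchange' tpow_split_0)
    finally show "?i \<cdot> (TAssoc M (tpow m) (tpow n) (tpow 0) \<cdot> ((tpow_split m n \<boxtimes> Ident M (tpow 0)) \<cdot> tpow_split (m + n) 0)) =
        ?i \<cdot> ((Ident M (tpow m) \<boxtimes> tpow_split n 0) \<cdot> tpow_split m (n + 0))" by simp
  qed simp_all
next
  case (Suc k)
  let ?P = "tpow m" and ?Q = "tpow n" and ?R = "tpow k" and ?a = "Ident M A"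
  have "TAssoc M ?P ?Q (?R \<otimes> A) \<cdot> ((tpow_split m n \<boxtimes> Ident M (?R \<otimes> A)) \<cdot> (TAssoc M (tpow (m + n)) ?R A \<cdot> (tpow_split (m + n) k \<boxtimes> ?a))) =
      TAssoc M ?P ?Q (?R \<otimes> A) \<cdot> (((tpow_split m n \<boxtimes> Ident M (?R \<otimes> A)) \<cdot> TAssoc M (tpow (m + n)) ?R A) \<cdot> (tpow_split (m + n) k \<boxtimes> ?a))"
    by simp
  also have "\<dots> = TAssoc M ?P ?Q (?R \<otimes> A) \<cdot> ((TAssoc M (?P \<otimes> ?Q) ?R A \<cdot> ((tpow_split m n \<boxtimes> Ident M ?R) \<boxtimes> ?a)) \<cdot> (tpow_split (m + n) k \<boxtimes> ?a))"
    using assoc_lwhisker[of "tpow_split m n" ?R A] by simp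
  also have "\<dots> = (TAssoc M ?P ?Q (?R \<otimes> A) \<cdot> TAssoc M (?P \<otimes> ?Q) ?R A) \<cdot> (((tpow_split m n \<boxtimes> Ident M ?R) \<cdot> tpow_split (m + n) k) \<boxtimes> ?a)"
    by (simp add: interchange)
  also have "\<dots> = ((Ident M ?P \<boxtimes> TAssoc M ?Q ?R A) \<cdot> (TAssoc M ?P (?Q \<otimes> ?R) A \<cdot> (TAssoc M ?P ?Q ?R \<boxtimes> ?a))) \<cdot>
      (((tpow_split m n \<boxtimes> Ident M ?R) \<cdot> tpow_split (m + n) k) \<boxtimes> ?a)"
    by (subst pentagon_comp) simp_all
  also have "\<dots> = (Ident M ?P \<boxtimes> TAssoc M ?Q ?R A) \<cdot> (TAssoc M ?P (?Q \<otimes> ?R) A \<cdot>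
      ((TAssoc M ?P ?Q ?R \<cdot> ((tpow_split m n \<boxtimes> Ident M ?R) \<cdot> tpow_split (m + n) k)) \<boxtimes> ?a))"
    by (simp add: interchange)
  also have "\<dots> = (Ident M ?P \<boxtimes> TAssoc M ?Q ?R A) \<cdot> (TAssoc M ?P (?Q \<otimes> ?R) A \<cdot>
      (((Ident M ?P \<boxtimes> tpow_split n k) \<cdot> tpow_split m (n + k)) \<boxtimes> ?a))"
    by (simp only: Suc)
  also have "\<dots> = (Ident M ?P \<boxtimes> TAssoc M ?Q ?R A) \<cdot> ((TAssoc M ?P (?Q \<otimes> ?R) A \<cdot>
      ((Ident M ?P \<boxtimes> tpow_split n k) \<boxtimes> ?a)) \<cdot> (tpow_split m (n + k) \<boxtimes> ?a))"
    by (simp add: interchange)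
  also have "\<dots> = (Ident M ?P \<boxtimes> TAssoc M ?Q ?R A) \<cdot> (((Ident M ?P \<boxtimes> (tpow_split n k \<boxtimes> ?a)) \<cdot> TAssoc M ?P (tpow (n + k)) A) \<cdot>
      (tpow_split m (n + k) \<boxtimes> ?a))"
    using assoc_mwhisker[of "tpow_split n k" ?P A] by simp
  also have "\<dots> = (Ident M ?P \<boxtimes> tpow_split n (Suc k)) \<cdot> tpow_split m (n + Suc k)"
    by (simp add: tpow_split.simps interchange')
  finally show ?case by (simp add: tpow_split.simps(2)[of "m + n" k])
qed

text \<open>The k-fold multiplication, which is to become the action of k -> 1.\<close>

primrec tpow_mult where
  "tpow_mult 0 = \<iota>"
| "tpow_mult (Suc k) = \<mu> \<cdot> (tpow_mult k \<boxtimes> Ident M A)"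

lemma tpow_mult_all: "tpow_mult k \<in> Arr M \<and> Dom M (tpow_mult k) = tpow k \<and> Cod M (tpow_mult k) = A"
  by (induction k) simp_all

lemma tpow_mult_simps [simp]: "tpow_mult k \<in> Arr M" "Dom M (tpow_mult k) = tpow k" "Cod M (tpow_mult k) = A"
  using tpow_mult_all by blast+

lemma tpow_mult_1: "tpow_mult (Suc 0) = TLUnit M A"
  by (simp add: mu_lunit)

declare tpow_mult.simps(2) [simp del]

text \<open>General associativity of \<open>\<mu>\<close>, by induction on the length of the second
  block: \<open>mu_runit\<close> treats the empty block and \<open>mu_assoc\<close> one additional
  factor.\<close>

lemma tpow_mult_add: "\<mu> \<cdot> ((tpow_mult p \<boxtimes> tpow_mult q) \<cdot> tpow_split p q) = tpow_mult (p + q)"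
proof (induction q)
  case 0
  have "\<mu> \<cdot> ((tpow_mult p \<boxtimes> \<iota>) \<cdot> tpow_split p 0) = (\<mu> \<cdot> (Ident M A \<boxtimes> \<iota>)) \<cdot> ((tpow_mult p \<boxtimes> Ident M \<I>) \<cdot> tpow_split p 0)"
    by (simp add: interchange')
  also have "\<dots> = (TRUnit M A \<cdot> (tpow_mult p \<boxtimes> Ident M \<I>)) \<cdot> tpow_split p 0"
    by (simp add: mu_runit)
  also have "\<dots> = tpow_mult p \<cdot> (TRUnit M (tpow p) \<cdot> tpow_split p 0)"
    using runit_nat[of "tpow_mult p"] by simp
  finally show ?case by (simp add: tpow_split_0)
next
  case (Suc q)
  let ?a = "Ident M A"
  have "\<mu> \<cdot> ((tpow_mult p \<boxtimes> (\<mu> \<cdot> (tpow_mult q \<boxtimes> ?a))) \<cdot> (TAssoc M (tpow p) (tpow q) A \<cdot> (tpow_split p q \<boxtimes> ?a))) =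
      \<mu> \<cdot> ((?a \<boxtimes> \<mu>) \<cdot> (((tpow_mult p \<boxtimes> (tpow_mult q \<boxtimes> ?a)) \<cdot> TAssoc M (tpow p) (tpow q) A) \<cdot> (tpow_split p q \<boxtimes> ?a)))"
    by (simp add: interchange')
  also have "\<dots> = \<mu> \<cdot> ((?a \<boxtimes> \<mu>) \<cdot> ((TAssoc M A A A \<cdot> ((tpow_mult p \<boxtimes> tpow_mult q) \<boxtimes> ?a)) \<cdot> (tpow_split p q \<boxtimes> ?a)))"
    using tassoc_nat[of "tpow_mult p" "tpow_mult q" ?a] by simp
  also have "\<dots> = (\<mu> \<cdot> ((?a \<boxtimes> \<mu>) \<cdot> TAssoc M A A A)) \<cdot> (((tpow_mult p \<boxtimes> tpow_mult q) \<cdot> tpow_split p q) \<boxtimes> ?a)"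
    by (simp add: interchange)
  also have "\<dots> = \<mu> \<cdot> ((\<mu> \<cdot> ((tpow_mult p \<boxtimes> tpow_mult q) \<cdot> tpow_split p q)) \<boxtimes> ?a)"
    by (simp add: interchange flip: mu_assoc)
  also have "\<dots> = tpow_mult (p + Suc q)"
    by (simp add: Suc tpow_mult.simps)
  finally show ?case by (simp add: tpow_mult.simps tpow_split.simps)
qed

text \<open>Recursion over the codomain, detaching the fibre over its last element \<open>m\<close>:
  \<open>p\<close> counts the elements sent below \<open>m\<close>, and the other
  \<open>n - p\<close> are multiplied together. A function \<open>u\<close> is used instead of an
  arrow, so that the recursion is primitive.\<close>

primrec tpow_raw :: "nat \<Rightarrow> nat \<Rightarrow> (nat \<Rightarrow> nat) \<Rightarrow> 'b" where
  "tpow_raw 0 n u = Ident M \<I>"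
| "tpow_raw (Suc m) n u = (let p = card {i. i < n \<and> u i < m} in (tpow_raw m p u \<boxtimes> tpow_mult (n - p)) \<cdot> tpow_split p (n - p))"

text \<open>The counted sets are initial segments, so the recursion evaluates \<open>u\<close> only
  below \<open>n\<close>. Needed because \<open>delta_arr\<close> stores a restricted
  function.\<close>

lemma tpow_raw_cong: "mono_map n m u \<Longrightarrow> \<forall>i<n. u i = v i \<Longrightarrow> tpow_raw m n u = tpow_raw m n v"
proof (induction m arbitrary: n)
  case (Suc m)
  obtain p where p: "p \<le> n" "\<forall>i<n. u i < m \<longleftrightarrow> i < p" using mono_cut[OF Suc.prems(1)] by blast
  have "{i. i < n \<and> u i < m} = {..<p}" "{i. i < n \<and> v i < m} = {..<p}" using p Suc.prems(2) by auto
  moreover have "mono_map p m u" using p Suc.prems(1) by (auto simp: mono_map_def)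
  then have "tpow_raw m p u = tpow_raw m p v" using Suc.IH Suc.prems(2) p(1) by simp
  ultimately show ?case by simp
qed simp

definition tpow_map where "tpow_map = (\<lambda>(n, u, m). tpow_raw m n u)"

lemma tpow_map_delta_arr: "mono_map n m u \<Longrightarrow> tpow_map (delta_arr n m u) = tpow_raw m n u"
  unfolding tpow_map_def delta_arr_def prod.case by (rule tpow_raw_cong[symmetric]) simp_all

lemma tpow_map_empty: "tpow_map (Ident delta 0) = Ident M \<I>"
  by (simp add: delta_ident tpow_map_delta_arr)

text \<open>The recursion of \<open>tpow_raw\<close> expressed through ordinal sums. It replaces the
  cardinalities in all later arguments and fits \<open>delta_induct_last\<close>.\<close>

lemma tpow_map_tensor_last:
  assumes "x \<in> Arr delta"
  shows "tpow_map (x \<boxtimes>\<^bsub>delta\<^esub> delta_arr k (Suc 0) (\<lambda>_. 0)) = (tpow_map x \<boxtimes> tpow_mult k) \<cdot> tpow_split (Dom delta x) k"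
proof -
  obtain p m u where u: "mono_map p m u" and x: "x = delta_arr p m u" using assms by (metis delta_arrE)
  let ?v = "osum p m u (\<lambda>_. 0)"
  have "{i. i < p + k \<and> ?v i < m} = {..<p}"
    using u by (auto simp: osum_def mono_map_def split: if_splits)
  moreover have "tpow_raw m p ?v = tpow_raw m p u"
    by (rule tpow_raw_cong[symmetric, OF u]) (simp add: osum_def)
  ultimately have "tpow_raw (Suc m) (p + k) ?v = (tpow_raw m p u \<boxtimes> tpow_mult k) \<cdot> tpow_split p k" by simp
  moreover have "mono_map (p + k) (m + Suc 0) ?v" by (rule mono_map_osum[OF u]) simp
  ultimately show ?thesis using u by (simp add: x delta_tensor tpow_map_delta_arr)
qed

lemma tpow_map_all: "x \<in> Arr delta \<Longrightarrow> tpow_map x \<in> Arr M \<and> Dom M (tpow_map x) = tpow (Dom delta x) \<and> Cod M (tpow_map x) = tpow (Cod delta x)"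
  by (induction x rule: delta_induct_last) (simp_all add: tpow_map_empty tpow_map_tensor_last)

lemma tpow_map_simps [simp]:
  assumes "x \<in> Arr delta"
  shows "tpow_map x \<in> Arr M" "Dom M (tpow_map x) = tpow (Dom delta x)" "Cod M (tpow_map x) = tpow (Cod delta x)"
  using tpow_map_all[OF assms] by blast+

text \<open>Naturality of \<xi>, by detaching the last fibre of the second argument:
  \<open>tpow_split_assoc\<close> regroups the three blocks, and the empty case is naturality of the
  right unitor.\<close>

lemma tpow_map_split:
  assumes u: "u \<in> Arr delta" and "x \<in> Arr delta"
  shows "tpow_split (Cod delta u) (Cod delta x) \<cdot> tpow_map (u \<boxtimes>\<^bsub>delta\<^esub> x) = (tpow_map u \<boxtimes> tpow_map x) \<cdot> tpow_split (Dom delta u) (Dom delta x)"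
  using assms(2)
proof (induction x rule: delta_induct_last)
  case empty
  let ?i = "TRUnit M (tpow (Cod delta u))"
  have "?i \<cdot> ((tpow_map u \<boxtimes> Ident M \<I>) \<cdot> tpow_split (Dom delta u) 0) = (?i \<cdot> (tpow_map u \<boxtimes> Ident M \<I>)) \<cdot> tpow_split (Dom delta u) 0"
    using u by simp
  also have "\<dots> = tpow_map u \<cdot> (TRUnit M (tpow (Dom delta u)) \<cdot> tpow_split (Dom delta u) 0)"
    using runit_nat[of "tpow_map u"] u by simp
  also have "\<dots> = ?i \<cdot> (tpow_split (Cod delta u) 0 \<cdot> tpow_map u)"
    using comp_reduce[OF tpow_split_0[of "Cod delta u"], of "tpow_map u"] u by (simp add: tpow_split_0)
  finally have "(tpow_map u \<boxtimes> Ident M \<I>) \<cdot> tpow_split (Dom delta u) 0 = tpow_split (Cod delta u) 0 \<cdot> tpow_map u"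
    by (rule iso_cancel_left) (use u in simp_all)
  then show ?case using u by (simp add: tpow_map_empty delta_tensor_empty)
next
  case (tensor x k)
  let ?b = "delta_arr k (Suc 0) (\<lambda>_. 0)"
  let ?m = "Cod delta u" and ?n = "Dom delta u" and ?m' = "Cod delta x" and ?n' = "Dom delta x"
  have "tpow_split ?m (Suc ?m') \<cdot> tpow_map ((u \<boxtimes>\<^bsub>delta\<^esub> x) \<boxtimes>\<^bsub>delta\<^esub> ?b) =
      TAssoc M (tpow ?m) (tpow ?m') A \<cdot> (((tpow_split ?m ?m' \<cdot> tpow_map (u \<boxtimes>\<^bsub>delta\<^esub> x)) \<boxtimes> tpow_mult k) \<cdot> tpow_split (?n + ?n') k)"
    using u tensor.hyps by (simp add: tpow_map_tensor_last tpow_split.simps interchange')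
  also have "\<dots> = TAssoc M (tpow ?m) (tpow ?m') A \<cdot> ((((tpow_map u \<boxtimes> tpow_map x) \<cdot> tpow_split ?n ?n') \<boxtimes> tpow_mult k) \<cdot> tpow_split (?n + ?n') k)"
    by (simp only: tensor.IH)
  also have "\<dots> = (TAssoc M (tpow ?m) (tpow ?m') A \<cdot> ((tpow_map u \<boxtimes> tpow_map x) \<boxtimes> tpow_mult k)) \<cdot> ((tpow_split ?n ?n' \<boxtimes> Ident M (tpow k)) \<cdot> tpow_split (?n + ?n') k)"
    using u tensor.hyps by (simp add: interchange')
  also have "\<dots> = (tpow_map u \<boxtimes> (tpow_map x \<boxtimes> tpow_mult k)) \<cdot> (TAssoc M (tpow ?n) (tpow ?n') (tpow k) \<cdot> ((tpow_split ?n ?n' \<boxtimes> Ident M (tpow k)) \<cdot> tpow_split (?n + ?n') k))"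
    using tassoc_nat[of "tpow_map u" "tpow_map x" "tpow_mult k"] u tensor.hyps by simp
  also have "\<dots> = (tpow_map u \<boxtimes> (tpow_map x \<boxtimes> tpow_mult k)) \<cdot> ((Ident M (tpow ?n) \<boxtimes> tpow_split ?n' k) \<cdot> tpow_split ?n (?n' + k))"
    by (simp only: tpow_split_assoc)
  also have "\<dots> = (tpow_map u \<boxtimes> tpow_map (x \<boxtimes>\<^bsub>delta\<^esub> ?b)) \<cdot> tpow_split ?n (?n' + k)"
    using u tensor.hyps by (simp add: tpow_map_tensor_last interchange')
  finally show ?case using u tensor.hyps by (simp add: delta_tensor_assoc)
qed

text \<open>Multiplying inside the fibres and then across them is one total multiplication, by
  \<open>tpow_mult_add\<close> at each fibre. This is functoriality for composites that end in
  1.\<close>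

lemma tpow_mult_map: "x \<in> Arr delta \<Longrightarrow> tpow_mult (Cod delta x) \<cdot> tpow_map x = tpow_mult (Dom delta x)"
proof (induction x rule: delta_induct_last)
  case empty
  show ?case by (simp add: tpow_map_empty)
next
  case (tensor x k)
  then have "tpow_mult (Suc (Cod delta x)) \<cdot> ((tpow_map x \<boxtimes> tpow_mult k) \<cdot> tpow_split (Dom delta x) k) = \<mu> \<cdot> ((tpow_mult (Dom delta x) \<boxtimes> tpow_mult k) \<cdot> tpow_split (Dom delta x) k)"
    by (simp add: tpow_mult.simps interchange')
  then show ?case using tensor by (simp add: tpow_map_tensor_last tpow_mult_add)
qed

text \<open>Induction on the fibres of the outer map \<open>y\<close>. Its last fibre induces a
  splitting of \<open>x\<close> into two blocks, to which the induction hypothesis and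
  \<open>tpow_mult_map\<close> apply; \<open>tpow_map_split\<close> reassembles the blocks.\<close>

lemma tpow_map_comp: "y \<in> Arr delta \<Longrightarrow> x \<in> Arr delta \<Longrightarrow> Cod delta x = Dom delta y \<Longrightarrow> tpow_map (y \<cdot>\<^bsub>delta\<^esub> x) = tpow_map y \<cdot> tpow_map x"
proof (induction y arbitrary: x rule: delta_induct_last)
  case empty
  then show ?case by (simp add: tpow_map_empty)
next
  case (tensor y k)
  let ?b = "\<lambda>k. delta_arr k (Suc 0) (\<lambda>_. 0)"
  have "Cod delta x = Dom delta y + k" using tensor by simp
  with tensor.prems(1) obtain x1 x2 where x: "x1 \<in> Arr delta" "x2 \<in> Arr delta" "Cod delta x1 = Dom delta y"
    "Cod delta x2 = k" "x = x1 \<boxtimes>\<^bsub>delta\<^esub> x2"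
    by (rule delta_split_arr)
  \<comment> \<open>Both arrows go to 1, which is terminal.\<close>
  have b: "?b k \<cdot>\<^bsub>delta\<^esub> x2 = ?b (Dom delta x2)"
    using delta_terminal[of "?b k \<cdot>\<^bsub>delta\<^esub> x2"] x by simp
  have "tpow_map ((y \<boxtimes>\<^bsub>delta\<^esub> ?b k) \<cdot>\<^bsub>delta\<^esub> x) = tpow_map ((y \<cdot>\<^bsub>delta\<^esub> x1) \<boxtimes>\<^bsub>delta\<^esub> ?b (Dom delta x2))"
    using tensor.hyps x by (simp add: delta.interchange b)
  also have "\<dots> = ((tpow_map y \<cdot> tpow_map x1) \<boxtimes> (tpow_mult k \<cdot> tpow_map x2)) \<cdot> tpow_split (Dom delta x1) (Dom delta x2)"
    using tensor.hyps x tensor.IH[of x1] tpow_mult_map[of x2] by (simp add: tpow_map_tensor_last)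
  also have "\<dots> = (tpow_map y \<boxtimes> tpow_mult k) \<cdot> ((tpow_map x1 \<boxtimes> tpow_map x2) \<cdot> tpow_split (Dom delta x1) (Dom delta x2))"
    using tensor.hyps x by (simp add: interchange')
  also have "\<dots> = (tpow_map y \<boxtimes> tpow_mult k) \<cdot> (tpow_split (Dom delta y) k \<cdot> tpow_map x)"
    using tpow_map_split[OF x(1,2)] x by simp
  also have "\<dots> = tpow_map (y \<boxtimes>\<^bsub>delta\<^esub> ?b k) \<cdot> tpow_map x"
    using tensor.hyps x by (simp add: tpow_map_tensor_last)
  finally show ?case .
qed

text \<open>An identity is a sum of one-element fibres, each acting by
  \<open>tpow_mult (Suc 0)\<close>, the left unitor of \<open>A\<close>; the triangle cancels it
  against the associator in \<open>tpow_split\<close>.\<close>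

lemma tpow_map_ident: "tpow_map (Ident delta n) = Ident M (tpow n)"
proof (induction n)
  case (Suc n)
  have "Ident delta (Suc n) = Ident delta n \<boxtimes>\<^bsub>delta\<^esub> delta_arr (Suc 0) (Suc 0) (\<lambda>_. 0)"
    by (auto simp: delta_ident delta_tensor delta_arr_eq osum_def)
  then have "tpow_map (Ident delta (Suc n)) = (Ident M (tpow n) \<boxtimes> tpow_mult (Suc 0)) \<cdot> tpow_split n (Suc 0)"
    using Suc by (simp add: tpow_map_tensor_last)
  also have "\<dots> = ((Ident M (tpow n) \<boxtimes> TLUnit M A) \<cdot> TAssoc M (tpow n) \<I> A) \<cdot> (tpow_split n 0 \<boxtimes> Ident M A)"
    by (simp add: tpow_mult_1 tpow_split.simps(2))
  also have "\<dots> = Ident M (tpow (Suc n))"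
    by (subst triangle) (simp_all add: interchange tpow_split_0)
  finally show ?case .
qed (simp add: tpow_map_empty)

definition tpow_functor where "tpow_functor = \<lparr>FObj = tpow, FArr = (\<lambda>x \<in> Arr delta. tpow_map x), Xi = tpow_split, Xi0 = Ident M \<I>\<rparr>"

lemma tpow_functor_simps [simp]: "FObj tpow_functor = tpow" "x \<in> Arr delta \<Longrightarrow> FArr tpow_functor x = tpow_map x" "Xi tpow_functor = tpow_split" "Xi0 tpow_functor = Ident M \<I>"
  by (simp_all add: tpow_functor_def)

lemma tpow_functor_strong: "strong_delta M tpow_functor"
proof -
  have "cat_functor delta M tpow_functor"
    by (rule cat_functorI[OF delta_category category_axioms]) (simp_all add: tpow_map_ident tpow_map_comp, simp add: tpow_functor_def)
  then have "colax_delta M tpow_functor"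
    by (rule colax_deltaI) (simp_all add: monoidal_category_axioms tpow_map_split tpow_split_assoc tpow_split_lunit tpow_split_0)
  then show ?thesis by (simp add: strong_delta_def strong_delta_axioms_def)
qed

text \<open>The left unitor of \<open>A\<close> is \<open>tpow_mult (Suc 0)\<close>, so the two
  conditions are \<open>tpow_mult_map\<close> at 2 -> 1 and at 0 -> 1.\<close>

lemma tpow_functor_monoid_hom:
  "is_monoid_hom M (FObj tpow_functor (Suc 0), strong_delta.mult M tpow_functor, strong_delta.unit M tpow_functor) (A, \<mu>, \<iota>) (TLUnit M A)"
proof -
  interpret Y: strong_delta M tpow_functor by (rule tpow_functor_strong)
  have m: "Y.mult \<in> Arr M" "Dom M Y.mult = (\<I> \<otimes> A) \<otimes> (\<I> \<otimes> A)" "Cod M Y.mult = \<I> \<otimes> A"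
    and u: "Y.unit \<in> Arr M" "Dom M Y.unit = \<I>" "Cod M Y.unit = \<I> \<otimes> A"
    using Y.mult_simps Y.unit_simps by simp_all
  have "TLUnit M A \<cdot> Y.mult = \<mu> \<cdot> (TLUnit M A \<boxtimes> TLUnit M A)"
  proof (rule iso_cancel_right)
    have "(TLUnit M A \<cdot> Y.mult) \<cdot> tpow_split (Suc 0) (Suc 0) = tpow_mult (Suc 0) \<cdot> tpow_map delta_mult"
      using Y.mult_xi m by (simp add: tpow_mult_1)
    also have "\<dots> = \<mu> \<cdot> ((tpow_mult (Suc 0) \<boxtimes> tpow_mult (Suc 0)) \<cdot> tpow_split (Suc 0) (Suc 0))"
      using tpow_mult_map[of delta_mult] tpow_mult_add[of "Suc 0" "Suc 0"] by simp
    finally show "(TLUnit M A \<cdot> Y.mult) \<cdot> tpow_split (Suc 0) (Suc 0) =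
        (\<mu> \<cdot> (TLUnit M A \<boxtimes> TLUnit M A)) \<cdot> tpow_split (Suc 0) (Suc 0)"
      by (simp add: tpow_mult_1)
  qed (use m in simp_all)
  moreover have "TLUnit M A \<cdot> Y.unit = \<iota>"
    using tpow_mult_map[of delta_unit] Y.unit_xi u by (simp add: tpow_mult_1)
  ultimately show ?thesis by (simp add: is_monoid_hom_def hom_def)
qed

end

section \<open>The category of monoids and its equivalence with strong functors on
  \<open>delta\<close>\<close>

lemma monoid_hom_comp:
  assumes "monoidal_category M" "is_monoid M X" "is_monoid M Y" "is_monoid M Z"
    "is_monoid_hom M X Y f" "is_monoid_hom M Y Z g"
  shows "is_monoid_hom M X Z (g \<cdot>\<^bsub>M\<^esub> f)"
proof -
  interpret monoidal_category M by fact
  obtain A \<mu> \<iota> B \<mu>' \<iota>' D \<mu>'' \<iota>'' where X: "X = (A, \<mu>, \<iota>)" and Y: "Y = (B, \<mu>', \<iota>')" and Z: "Z = (D, \<mu>'', \<iota>'')"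
    by (metis prod_cases3)
  interpret X: monoid_object M A \<mu> \<iota> by unfold_locales (use assms X in simp)
  interpret Y: monoid_object M B \<mu>' \<iota>' by unfold_locales (use assms Y in simp)
  interpret Z: monoid_object M D \<mu>'' \<iota>'' by unfold_locales (use assms Z in simp)
  have f: "f \<in> Arr M" "Dom M f = A" "Cod M f = B" "f \<cdot>\<^bsub>M\<^esub> \<mu> = \<mu>' \<cdot>\<^bsub>M\<^esub> (f \<boxtimes>\<^bsub>M\<^esub> f)" "f \<cdot>\<^bsub>M\<^esub> \<iota> = \<iota>'"
    and g: "g \<in> Arr M" "Dom M g = B" "Cod M g = D" "g \<cdot>\<^bsub>M\<^esub> \<mu>' = \<mu>'' \<cdot>\<^bsub>M\<^esub> (g \<boxtimes>\<^bsub>M\<^esub> g)" "g \<cdot>\<^bsub>M\<^esub> \<iota>' = \<iota>''"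
    using assms by (auto simp: X Y Z is_monoid_hom_def hom_def)
  have "g \<cdot>\<^bsub>M\<^esub> (\<mu>' \<cdot>\<^bsub>M\<^esub> (f \<boxtimes>\<^bsub>M\<^esub> f)) = \<mu>'' \<cdot>\<^bsub>M\<^esub> (g \<boxtimes>\<^bsub>M\<^esub> g) \<cdot>\<^bsub>M\<^esub> (f \<boxtimes>\<^bsub>M\<^esub> f)"
    using comp_reduce[OF g(4), of "f \<boxtimes>\<^bsub>M\<^esub> f"] f(1-3) g(1-3) by simp
  then show ?thesis using f g by (simp add: X Z is_monoid_hom_def hom_def interchange)
qed

lemma monoid_hom_ident:
  assumes "monoidal_category M" "is_monoid M X"
  shows "is_monoid_hom M X X (Ident M (fst X))"
proof -
  obtain A \<mu> \<iota> where X: "X = (A, \<mu>, \<iota>)" by (metis prod_cases3)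
  interpret monoidal_category M by fact
  interpret X: monoid_object M A \<mu> \<iota> by unfold_locales (use assms X in simp)
  show ?thesis by (simp add: X is_monoid_hom_def hom_def)
qed

lemma monoid_hom_arr:
  "is_monoid_hom M X Y f \<Longrightarrow> f \<in> Arr M \<and> Dom M f = fst X \<and> Cod M f = fst Y"
  by (cases X; cases Y) (auto simp: is_monoid_hom_def hom_def)

lemma monoid_hom_inverse:
  assumes "monoidal_category M" "is_monoid M X" "is_monoid M Y" "is_monoid_hom M X Y f" "f \<in> isos M"
  shows "is_monoid_hom M Y X (category.inverse M f)"
proof -
  interpret monoidal_category M by fact
  obtain A \<mu> \<iota> B \<mu>' \<iota>' where X: "X = (A, \<mu>, \<iota>)" and Y: "Y = (B, \<mu>', \<iota>')"
    by (metis prod_cases3)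
  interpret X: monoid_object M A \<mu> \<iota> by unfold_locales (use assms X in simp)
  interpret Y: monoid_object M B \<mu>' \<iota>' by unfold_locales (use assms Y in simp)
  have f [simp]: "f \<in> Arr M" "Dom M f = A" "Cod M f = B" "f \<in> isos M"
    and f': "f \<cdot>\<^bsub>M\<^esub> \<mu> = \<mu>' \<cdot>\<^bsub>M\<^esub> (f \<boxtimes>\<^bsub>M\<^esub> f)" "f \<cdot>\<^bsub>M\<^esub> \<iota> = \<iota>'"
    using assms by (auto simp: X Y is_monoid_hom_def hom_def)
  have "inverse f \<cdot>\<^bsub>M\<^esub> \<mu>' = \<mu> \<cdot>\<^bsub>M\<^esub> (inverse f \<boxtimes>\<^bsub>M\<^esub> inverse f)"
  proof (rule iso_cancel_left)
    show "f \<cdot>\<^bsub>M\<^esub> (inverse f \<cdot>\<^bsub>M\<^esub> \<mu>') = f \<cdot>\<^bsub>M\<^esub> (\<mu> \<cdot>\<^bsub>M\<^esub> (inverse f \<boxtimes>\<^bsub>M\<^esub> inverse f))"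
      using comp_reduce[OF f'(1), of "inverse f \<boxtimes>\<^bsub>M\<^esub> inverse f"] by (simp add: interchange)
  qed simp_all
  moreover have "inverse f \<cdot>\<^bsub>M\<^esub> \<iota>' = \<iota>"
    by (simp flip: f'(2))
  ultimately show ?thesis by (simp add: X Y is_monoid_hom_def hom_def)
qed

lemma monoid_category:
  assumes M: "monoidal_category M"
  shows "category (monoid_cat M)"
proof
  interpret monoidal_category M by fact
  note [simp] = monoid_cat_def
  note homs = monoid_hom_comp[OF M] monoid_hom_ident[OF M]
  fix f X Y assume "f \<in> hom (monoid_cat M) X Y"
  then obtain f' where f: "f = (X, f', Y)" "is_monoid M X" "is_monoid M Y" "is_monoid_hom M X Y f'"
    by (auto simp: hom_def)
  note f' = monoid_hom_arr[OF f(4)]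
  show "f \<cdot>\<^bsub>monoid_cat M\<^esub> Ident (monoid_cat M) X = f" "Ident (monoid_cat M) Y \<cdot>\<^bsub>monoid_cat M\<^esub> f = f"
    using f' by (simp_all add: f(1))
  fix g Z assume "g \<in> hom (monoid_cat M) Y Z"
  then obtain g' where g: "g = (Y, g', Z)" "is_monoid M Z" "is_monoid_hom M Y Z g'"
    by (auto simp: hom_def)
  note g' = monoid_hom_arr[OF g(3)]
  show "g \<cdot>\<^bsub>monoid_cat M\<^esub> f \<in> hom (monoid_cat M) X Z"
    using f(2,3,4) g(2,3) homs(1)[of X Y Z f' g'] by (simp add: f(1) g(1) hom_def)
  fix h Z' assume "h \<in> hom (monoid_cat M) Z Z'"
  then obtain h' where h: "h = (Z, h', Z')" "is_monoid_hom M Z Z' h'"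
    by (auto simp: hom_def)
  note h' = monoid_hom_arr[OF h(2)]
  show "h \<cdot>\<^bsub>monoid_cat M\<^esub> g \<cdot>\<^bsub>monoid_cat M\<^esub> f = h \<cdot>\<^bsub>monoid_cat M\<^esub> (g \<cdot>\<^bsub>monoid_cat M\<^esub> f)"
    using f' g' h' by (simp add: f(1) g(1) h(1))
qed (auto simp: monoid_cat_def hom_def monoid_hom_ident[OF M])

lemma monoid_isoI:
  assumes M: "monoidal_category M" and "is_monoid M X" "is_monoid M Y" "is_monoid_hom M X Y f" "f \<in> isos M"
  shows "(X, f, Y) \<in> isos (monoid_cat M)"
proof -
  interpret monoidal_category M by fact
  interpret C: category "monoid_cat M" by (rule monoid_category[OF M])
  note [simp] = monoid_cat_def
  note f = monoid_hom_arr[OF assms(4)]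
  show ?thesis
    by (rule C.isosI[of _ "(Y, inverse f, X)"])
      (use assms f monoid_hom_inverse[OF assms] in simp_all)
qed

definition monoid_of where
  "monoid_of M Y = (FObj Y (Suc 0), strong_delta.mult M Y, strong_delta.unit M Y)"

lemma strong_delta_iff: "is_homotopy_monoid M (isos M) Y \<longleftrightarrow> strong_delta M Y"
  by (auto simp: homotopy_monoid_iff strong_delta_def strong_delta_axioms_def)

text \<open>Evaluation at 1 is faithful by \<open>trans_determined\<close> and full by
  \<open>trans_of_monoid_hom\<close>; a monoid is recovered from its tensor-power functor up to the
  left unitor.\<close>

lemma homotopy_monoids_monoids:
  assumes M: "monoidal_category M"
  shows "\<exists>F. weak_equivalence (homotopy_monoid_cat M (isos M)) (monoid_cat M) F"
proof -
  let ?H = "homotopy_monoid_cat M (isos M)" and ?N = "monoid_cat M"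
  interpret M: monoidal_category M by fact
  interpret H: category ?H by (rule homotopy_monoid_category)
  let ?a = "\<lambda>(Y, \<sigma>, Z). (monoid_of M Y, \<sigma> (Suc 0), monoid_of M Z)"
  have hom_H: "hom ?H X Y = {(X, \<sigma>, Y) |\<sigma>. strong_delta M X \<and> strong_delta M Y \<and> colax_delta_trans M X Y \<sigma>}" for X Y
    by (auto simp: hom_def homotopy_monoid_cat_def monoidal_nat_trans_iff strong_delta_iff)
  have obj: "Obj ?H = {Y. strong_delta M Y}" "Obj ?N = {X. is_monoid M X}"
    by (simp_all add: homotopy_monoid_cat_def strong_delta_iff monoid_cat_def)
  have hom_N: "hom ?N X Y = {(X, f, Y) |f. is_monoid M X \<and> is_monoid M Y \<and> is_monoid_hom M X Y f}" for X Y
    by (auto simp: hom_def monoid_cat_def)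
  have comp: "Comp ?N (X', g, Z) (W, f, X) = (W, g \<cdot>\<^bsub>M\<^esub> f, Z)"
    "Comp ?H (Y', \<tau>', Z') (X'', \<sigma>', Y) = (X'', \<lambda>n. \<tau>' n \<cdot>\<^bsub>M\<^esub> \<sigma>' n, Z')"
    "Ident ?N X = (X, Ident M (fst X), X)" "Ident ?H V = (V, \<lambda>n. Ident M (FObj V n), V)"
    for X' g Z W f X Y' \<tau>' Z' X'' \<sigma>' Y V
    by (simp_all add: monoid_cat_def homotopy_monoid_cat_def)
  have "weak_equivalence ?H ?N
      \<lparr>FObj = (\<lambda>A \<in> Obj ?H. monoid_of M A), FArr = (\<lambda>f \<in> Arr ?H. ?a f)\<rparr>"
  proof (rule weak_equivalenceI[OF monoid_category[OF M]])
    fix f assume "f \<in> Arr ?H"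
    then show "Dom ?H f \<in> Obj ?H \<and> Cod ?H f \<in> Obj ?H" by simp
  next
    fix A assume A: "A \<in> Obj ?H"
    then show "Ident ?H A \<in> hom ?H A A \<and> ?a (Ident ?H A) = Ident ?N (monoid_of M A)"
      using H.ident_hom[OF A] by (simp add: comp monoid_of_def)
    show "monoid_of M A \<in> Obj ?N"
      using A strong_delta.is_monoid by (simp add: obj monoid_of_def)
  next
    fix f g X Y Z assume f: "f \<in> hom ?H X Y" and g: "g \<in> hom ?H Y Z"
    show "g \<cdot>\<^bsub>?H\<^esub> f \<in> hom ?H X Z \<and> ?a (g \<cdot>\<^bsub>?H\<^esub> f) = ?a g \<cdot>\<^bsub>?N\<^esub> ?a f"
      using H.comp_hom[OF f g] f g by (auto simp: hom_H comp)
  next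
    fix X Y assume "X \<in> Obj ?H" "Y \<in> Obj ?H"
    then have XY: "strong_delta M X" "strong_delta M Y" by (simp_all add: obj)
    interpret strong_delta_pair M X Y using XY by (simp add: strong_delta_pair_def)
    show "bij_betw ?a (hom ?H X Y) (hom ?N (monoid_of M X) (monoid_of M Y))"
    proof (rule bij_betwI')
      show "?a f = ?a g \<longleftrightarrow> f = g" if "f \<in> hom ?H X Y" "g \<in> hom ?H X Y" for f g
        using that trans_determined by (auto simp: hom_H)
      show "?a f \<in> hom ?N (monoid_of M X) (monoid_of M Y)" if "f \<in> hom ?H X Y" for f
        using that monoid_hom_of_trans Y.is_monoid Z.is_monoid by (auto simp: hom_H hom_N monoid_of_def)
      show "\<exists>f \<in> hom ?H X Y. g = ?a f" if "g \<in> hom ?N (monoid_of M X) (monoid_of M Y)" for g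
      proof -
        obtain g' where g: "g = (monoid_of M X, g', monoid_of M Y)" "is_monoid_hom M (monoid_of M X) (monoid_of M Y) g'"
          using \<open>g \<in> _\<close> by (auto simp: hom_N)
        obtain \<sigma> where "colax_delta_trans M X Y \<sigma>" "\<sigma> (Suc 0) = g'"
          using trans_of_monoid_hom g(2) unfolding monoid_of_def by blast
        then show ?thesis using XY g(1) by (intro bexI[of _ "(X, \<sigma>, Y)"]) (auto simp: hom_H)
      qed
    qed
  next
    fix X assume "X \<in> Obj ?N"
    then have X: "is_monoid M X" by (simp add: obj)
    obtain A \<mu> \<iota> where simp_arr: "X = (A, \<mu>, \<iota>)" by (metis prod_cases3)
    interpret monoid_object M A \<mu> \<iota> by unfold_locales (use X simp_arr in simp)
    have Y: "strong_delta M tpow_functor" by (rule tpow_functor_strong)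
    have "(monoid_of M tpow_functor, TLUnit M A, X) \<in> isos ?N"
      using monoid_isoI[OF M _ X, of "monoid_of M tpow_functor" "TLUnit M A"] strong_delta.is_monoid[OF Y] tpow_functor_monoid_hom
      by (simp add: monoid_of_def simp_arr)
    moreover have "Dom ?N (monoid_of M tpow_functor, TLUnit M A, X) = monoid_of M tpow_functor" "Cod ?N (monoid_of M tpow_functor, TLUnit M A, X) = X"
      by (simp_all add: monoid_cat_def)
    moreover have "tpow_functor \<in> Obj ?H" using Y by (simp add: obj)
    ultimately show "\<exists>A \<in> Obj ?H. \<exists>i \<in> isos ?N. Dom ?N i = monoid_of M A \<and> Cod ?N i = X" by blast
  qed
  then show ?thesis by blast
qed

section \<open>Cartesian monoidal categories\<close>


context finite_products
begin

abbreviation pr where "pr \<equiv> pairing C P p q"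

abbreviation K where "K \<equiv> cartesian_moncat C T P p q"

lemma pq_simps [simp]:
  assumes "A \<in> Obj C" "B \<in> Obj C"
  shows "P A B \<in> Obj C" "p A B \<in> Arr C" "Dom C (p A B) = P A B" "Cod C (p A B) = A"
    "q A B \<in> Arr C" "Dom C (q A B) = P A B" "Cod C (q A B) = B"
  using product[OF assms] by (auto simp: is_product_def hom_def)

lemma terminal_obj [simp]: "T \<in> Obj C"
  using terminal by (simp add: is_terminal_def)

lemma terminal_unique:
  assumes "f \<in> Arr C" "g \<in> Arr C" "Dom C f = Dom C g" "Cod C f = T" "Cod C g = T"
  shows "f = g"
proof -
  have "\<exists>!h. h \<in> hom C (Dom C f) T" using terminal assms(1) by (simp add: is_terminal_def)
  then show ?thesis using assms by (auto simp: hom_def)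
qed

definition bang where "bang A = (SOME f. f \<in> hom C A T)"

lemma bang_simps [simp]:
  assumes "A \<in> Obj C"
  shows "bang A \<in> Arr C" "Dom C (bang A) = A" "Cod C (bang A) = T"
proof -
  have "\<exists>h. h \<in> hom C A T" using terminal assms unfolding is_terminal_def by blast
  from someI_ex[OF this, folded bang_def]
  show "bang A \<in> Arr C" "Dom C (bang A) = A" "Cod C (bang A) = T" by (simp_all add: hom_def)
qed

lemma pr_all:
  assumes "f \<in> Arr C" "g \<in> Arr C" "Dom C f = Dom C g"
  shows "pr f g \<in> hom C (Dom C f) (P (Cod C f) (Cod C g)) \<and>
     p (Cod C f) (Cod C g) \<cdot> pr f g = f \<and> q (Cod C f) (Cod C g) \<cdot> pr f g = g"
proof -
  have "is_product C (Cod C f) (Cod C g) (P (Cod C f) (Cod C g)) (p (Cod C f) (Cod C g)) (q (Cod C f) (Cod C g))"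
    using assms by (intro product) simp_all
  moreover have "Dom C f \<in> Obj C" "f \<in> hom C (Dom C f) (Cod C f)" "g \<in> hom C (Dom C f) (Cod C g)"
    using assms by (simp_all add: hom_def)
  ultimately have "\<exists>!h. h \<in> hom C (Dom C f) (P (Cod C f) (Cod C g)) \<and>
     p (Cod C f) (Cod C g) \<cdot> h = f \<and> q (Cod C f) (Cod C g) \<cdot> h = g"
    unfolding is_product_def by blast
  from theI'[OF this] show ?thesis by (simp only: pairing_def)
qed

lemma pr_simps [simp]:
  assumes "f \<in> Arr C" "g \<in> Arr C" "Dom C f = Dom C g"
  shows "pr f g \<in> Arr C" "Dom C (pr f g) = Dom C g" "Cod C (pr f g) = P (Cod C f) (Cod C g)"
    "A = Cod C f \<Longrightarrow> B = Cod C g \<Longrightarrow> p A B \<cdot> pr f g = f"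
    "A = Cod C f \<Longrightarrow> B = Cod C g \<Longrightarrow> q A B \<cdot> pr f g = g"
  using pr_all[OF assms] assms(3) by (simp_all add: hom_def)

lemma pr_reduce [simp]:
  assumes "f \<in> Arr C" "g \<in> Arr C" "Dom C f = Dom C g" "h \<in> Arr C" "Cod C h = Dom C g"
    "A = Cod C f" "B = Cod C g"
  shows "p A B \<cdot> (pr f g \<cdot> h) = f \<cdot> h" "q A B \<cdot> (pr f g \<cdot> h) = g \<cdot> h"
proof -
  show "p A B \<cdot> (pr f g \<cdot> h) = f \<cdot> h"
    by (rule comp_reduce) (use assms in simp_all)
  show "q A B \<cdot> (pr f g \<cdot> h) = g \<cdot> h"
    by (rule comp_reduce) (use assms in simp_all)
qed

lemma pr_ext:
  assumes "p A B \<cdot> f = p A B \<cdot> g" "q A B \<cdot> f = q A B \<cdot> g" "f \<in> Arr C" "g \<in> Arr C" "Dom C f = Dom C g"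
    "Cod C f = P A B" "Cod C g = P A B" "A \<in> Obj C" "B \<in> Obj C"
  shows "f = g"
proof -
  have "p A B \<cdot> g \<in> hom C (Dom C g) A" "q A B \<cdot> g \<in> hom C (Dom C g) B" "Dom C g \<in> Obj C"
    using assms(4-) by (simp_all add: hom_def)
  then have "\<exists>!h. h \<in> hom C (Dom C g) (P A B) \<and> p A B \<cdot> h = p A B \<cdot> g \<and> q A B \<cdot> h = q A B \<cdot> g"
    using product[OF assms(8,9)] unfolding is_product_def by blast
  moreover have "f \<in> hom C (Dom C g) (P A B)" "g \<in> hom C (Dom C g) (P A B)"
    using assms(3-) by (simp_all add: hom_def)
  ultimately show ?thesis using assms(1,2) by blast
qed

text \<open>As a rewrite rule it pushes composition into pairings. With the projection rules this
  normalises the arrows built from products, and the coherence laws of the cartesian structure hold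
  by simplification.\<close>

lemma pr_comp [simp]:
  assumes "f \<in> Arr C" "g \<in> Arr C" "Dom C f = Dom C g" "h \<in> Arr C" "Cod C h = Dom C g"
  shows "pr f g \<cdot> h = pr (f \<cdot> h) (g \<cdot> h)"
  by (rule pr_ext[where A = "Cod C f" and B = "Cod C g"]) (use assms in simp_all)

lemma pr_proj [simp]: "A \<in> Obj C \<Longrightarrow> B \<in> Obj C \<Longrightarrow> pr (p A B) (q A B) = Ident C (P A B)"
  by (rule pr_ext[where A = A and B = B]) simp_all

lemma pr_eta:
  assumes "h \<in> Arr C" "Cod C h = P A B" "A \<in> Obj C" "B \<in> Obj C"
  shows "pr (p A B \<cdot> h) (q A B \<cdot> h) = h"
  by (rule pr_ext[where A = A and B = B]) (use assms in simp_all)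

lemma K_simps [simp]:
  "Obj K = Obj C" "Arr K = Arr C" "Dom K = Dom C" "Cod K = Cod C" "Ident K = Ident C" "Comp K = Comp C"
  "TObj K = P" "TUnit K = T"
  "TArr K f g = pr (f \<cdot> p (Dom C f) (Dom C g)) (g \<cdot> q (Dom C f) (Dom C g))"
  "TAssoc K A B E = pr (p A B \<cdot> p (P A B) E) (pr (q A B \<cdot> p (P A B) E) (q (P A B) E))"
  "TLUnit K A = q T A" "TRUnit K A = p A T"
  by (simp_all add: cartesian_moncat_def)

lemma K_hom [simp]: "hom K = hom C"
  by (intro ext) (simp only: hom_def K_simps)

lemma K_isos [simp]: "isos K = isos C"
  by (simp only: isos_def K_hom K_simps)

lemma K_monoidal: "monoidal_category K"
proof -
  have "category K"
    by unfold_locales (simp_all add: comp_hom comp_ident ident_comp comp_assoc ident_hom)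
  moreover have "monoidal_category_axioms K"
  proof
    fix A B E assume A [simp]: "A \<in> Obj K" and B [simp]: "B \<in> Obj K" and E [simp]: "E \<in> Obj K"
    have [simp]: "A \<in> Obj C" "B \<in> Obj C" "E \<in> Obj C" using A B E by simp_all
    have "pr (p A B \<cdot> p (P A B) E) (pr (q A B \<cdot> p (P A B) E) (q (P A B) E)) \<in> isos C"
    proof (rule isosI)
      \<comment> \<open>The inverse associator: the three projections of the right-nested product,
        paired in the left-nested way.\<close>
      show "pr (pr (p A (P B E)) (p B E \<cdot> q A (P B E))) (q B E \<cdot> q A (P B E)) \<in> Arr C" by simp
    qed (simp_all add: pr_eta)
    then show "TAssoc K A B E \<in> hom K ((A \<otimes>\<^bsub>K\<^esub> B) \<otimes>\<^bsub>K\<^esub> E) (A \<otimes>\<^bsub>K\<^esub> B \<otimes>\<^bsub>K\<^esub> E) \<inter> isos K"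
      by (simp add: hom_def)
    \<comment> \<open>Arrows into \<open>T\<close> are unique, so pairing the identity with
      \<open>bang A\<close> inverts the projection away from \<open>T\<close>.\<close>
    have "bang A \<cdot> q T A = p T A" "bang A \<cdot> p A T = q A T"
      by (rule terminal_unique; simp)+
    then have "q T A \<in> isos C" "p A T \<in> isos C"
      by (intro isosI[of _ "pr (bang A) (Ident C A)"] isosI[of _ "pr (Ident C A) (bang A)"]; simp)+
    then show "TLUnit K A \<in> hom K (\<I>\<^bsub>K\<^esub> \<otimes>\<^bsub>K\<^esub> A) A \<inter> isos K" "TRUnit K A \<in> hom K (A \<otimes>\<^bsub>K\<^esub> \<I>\<^bsub>K\<^esub>) A \<inter> isos K"
      by (simp_all add: hom_def)
  qed (auto simp: hom_def)
  ultimately show ?thesis by (simp add: monoidal_category_def)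
qed

end

section \<open>Colax functors into a cartesian category\<close>

locale cart_colax = finite_products C T P p q + colax_delta K Y
  for C :: "('o, 'a, 'm) cat_scheme" (structure) and T P p q Y
begin

text \<open>\<open>L m n\<close> takes the front m-face of an (m+n)-simplex and \<open>R m n\<close>
  the back n-face; the two faces share the vertex \<open>m\<close>.\<close>

definition L where "L m n = p (FObj Y m) (FObj Y n) \<cdot> Xi Y m n"
definition R where "R m n = q (FObj Y m) (FObj Y n) \<cdot> Xi Y m n"

lemma Y_simps [simp]: "FObj Y n \<in> Obj C" "Xi Y m n \<in> Arr C" "Dom C (Xi Y m n) = FObj Y (m + n)"
  "Cod C (Xi Y m n) = P (FObj Y m) (FObj Y n)"
  "FArr Y (Ident delta n) = Ident C (FObj Y n)"
  using fobj_delta[of n] xi_simps[of m n] farr_ident_delta[of n] by simp_all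

lemma Y_farr [simp]:
  "x \<in> Arr delta \<Longrightarrow> FArr Y x \<in> Arr C" "x \<in> Arr delta \<Longrightarrow> Dom C (FArr Y x) = FObj Y (Dom delta x)"
  "x \<in> Arr delta \<Longrightarrow> Cod C (FArr Y x) = FObj Y (Cod delta x)"
  using farr_simps[of x] by simp_all

lemma Y_comp:
  assumes "x \<in> Arr delta" "y \<in> Arr delta" "Cod delta x = Dom delta y"
  shows "FArr Y (y \<cdot>\<^bsub>delta\<^esub> x) = FArr Y y \<cdot> FArr Y x"
  using farr_comp_simp[OF assms] by simp

lemma LR_simps [simp]:
  "L m n \<in> Arr C" "Dom C (L m n) = FObj Y (m + n)" "Cod C (L m n) = FObj Y m"
  "R m n \<in> Arr C" "Dom C (R m n) = FObj Y (m + n)" "Cod C (R m n) = FObj Y n"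
  by (simp_all add: L_def R_def)

lemma Xi_eq: "Xi Y m n = pr (L m n) (R m n)"
  by (simp add: L_def R_def pr_eta)

lemma pr_inject:
  assumes "pr f g = pr f' g'" "f \<in> Arr C" "g \<in> Arr C" "f' \<in> Arr C" "g' \<in> Arr C"
    "Dom C f = Dom C g" "Dom C f' = Dom C g'" "Cod C f = Cod C f'" "Cod C g = Cod C g'"
  shows "f = f'" "g = g'"
proof -
  have "f = p (Cod C f) (Cod C g) \<cdot> pr f g" "g = q (Cod C f) (Cod C g) \<cdot> pr f g"
    "f' = p (Cod C f) (Cod C g) \<cdot> pr f' g'" "g' = q (Cod C f) (Cod C g) \<cdot> pr f' g'"
    using assms(2-) by simp_all
  then show "f = f'" "g = g'" using assms(1) by simp_all
qed

lemma LR_nat: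
  assumes "x \<in> Arr delta" "y \<in> Arr delta"
  shows "L (Cod delta x) (Cod delta y) \<cdot> FArr Y (x \<boxtimes>\<^bsub>delta\<^esub> y) = FArr Y x \<cdot> L (Dom delta x) (Dom delta y)"
    "R (Cod delta x) (Cod delta y) \<cdot> FArr Y (x \<boxtimes>\<^bsub>delta\<^esub> y) = FArr Y y \<cdot> R (Dom delta x) (Dom delta y)"
proof -
  have "pr (L (Cod delta x) (Cod delta y) \<cdot> FArr Y (x \<boxtimes>\<^bsub>delta\<^esub> y)) (R (Cod delta x) (Cod delta y) \<cdot> FArr Y (x \<boxtimes>\<^bsub>delta\<^esub> y)) =
      pr (FArr Y x \<cdot> L (Dom delta x) (Dom delta y)) (FArr Y y \<cdot> R (Dom delta x) (Dom delta y))"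
    using xi_nat[OF assms] assms by (simp add: Xi_eq)
  from pr_inject[OF this]
  show "L (Cod delta x) (Cod delta y) \<cdot> FArr Y (x \<boxtimes>\<^bsub>delta\<^esub> y) = FArr Y x \<cdot> L (Dom delta x) (Dom delta y)"
    "R (Cod delta x) (Cod delta y) \<cdot> FArr Y (x \<boxtimes>\<^bsub>delta\<^esub> y) = FArr Y y \<cdot> R (Dom delta x) (Dom delta y)"
    using assms by simp_all
qed

text \<open>The unitors of the cartesian structure are projections, so unit coherence places no
  condition on \<open>Xi0\<close> and only says that these faces are the whole simplex.\<close>

lemma LR_unit: "L n 0 = Ident C (FObj Y n)" "R 0 n = Ident C (FObj Y n)"
  using xi_lunit_delta[of n] xi_runit_delta[of n] xi0_simps by (simp_all add: Xi_eq)

text \<open>The three components of the associativity axiom, read off from an equation of nested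
  pairings. They are the relations between inclusions of initial and final intervals.\<close>

lemma LR_assoc:
  "L m n \<cdot> L (m + n) k = L m (n + k)"
  "R m n \<cdot> L (m + n) k = L n k \<cdot> R m (n + k)"
  "R (m + n) k = R n k \<cdot> R m (n + k)"
proof -
  have *: "pr (L m n \<cdot> L (m + n) k) (pr (R m n \<cdot> L (m + n) k) (R (m + n) k)) =
      pr (L m (n + k)) (pr (L n k \<cdot> R m (n + k)) (R n k \<cdot> R m (n + k)))"
    using xi_assoc_delta[of m n k] by (simp add: Xi_eq add.assoc)
  show "L m n \<cdot> L (m + n) k = L m (n + k)"
    by (rule pr_inject(1)[OF *]) (simp_all add: add.assoc)
  have **: "pr (R m n \<cdot> L (m + n) k) (R (m + n) k) = pr (L n k \<cdot> R m (n + k)) (R n k \<cdot> R m (n + k))"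
    by (rule pr_inject(2)[OF *]) (simp_all add: add.assoc)
  show "R m n \<cdot> L (m + n) k = L n k \<cdot> R m (n + k)"
    by (rule pr_inject(1)[OF **]) (simp_all add: add.assoc)
  show "R (m + n) k = R n k \<cdot> R m (n + k)"
    by (rule pr_inject(2)[OF **]) (simp_all add: add.assoc)
qed

text \<open>The face of an (a+b+c)-simplex spanned by the vertices from \<open>a\<close> to
  \<open>a + b\<close>: the operator of a general interval inclusion.\<close>

definition mid where "mid a b c = R a b \<cdot> L (a + b) c"

lemma mid_simps [simp]: "mid a b c \<in> Arr C" "Dom C (mid a b c) = FObj Y (a + b + c)" "Cod C (mid a b c) = FObj Y b"
  by (simp_all add: mid_def)

lemma mid_L: "mid 0 m n = L m n" and mid_R: "mid m n 0 = R m n"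
  by (simp_all add: mid_def LR_unit)

text \<open>Naturality of \<open>L\<close> discards the third summand and naturality of
  \<open>R\<close> the first.\<close>

lemma mid_nat:
  assumes [simp]: "x \<in> Arr delta" "y \<in> Arr delta" "z \<in> Arr delta"
  shows "mid (Cod delta x) (Cod delta y) (Cod delta z) \<cdot> FArr Y ((x \<boxtimes>\<^bsub>delta\<^esub> y) \<boxtimes>\<^bsub>delta\<^esub> z) =
    FArr Y y \<cdot> mid (Dom delta x) (Dom delta y) (Dom delta z)"
proof -
  have "mid (Cod delta x) (Cod delta y) (Cod delta z) \<cdot> FArr Y ((x \<boxtimes>\<^bsub>delta\<^esub> y) \<boxtimes>\<^bsub>delta\<^esub> z) =
      R (Cod delta x) (Cod delta y) \<cdot> (FArr Y (x \<boxtimes>\<^bsub>delta\<^esub> y) \<cdot> L (Dom delta x + Dom delta y) (Dom delta z))"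
    using LR_nat(1)[of "x \<boxtimes>\<^bsub>delta\<^esub> y" z] by (simp add: mid_def)
  also have "\<dots> = (FArr Y y \<cdot> R (Dom delta x) (Dom delta y)) \<cdot> L (Dom delta x + Dom delta y) (Dom delta z)"
    by (rule comp_reduce[OF LR_nat(2)]) simp_all
  finally show ?thesis by (simp add: mid_def)
qed

text \<open>An interval inside an interval is an interval. The mixed relation in
  \<open>LR_assoc\<close> exchanges the inner \<open>L\<close> with the outer \<open>R\<close>,
  after which both kinds of faces merge.\<close>

lemma mid_mid: "mid a1 b1 c1 \<cdot> mid a (a1 + b1 + c1) c = mid (a + a1) b1 (c1 + c)"
proof -
  have "mid a1 b1 c1 \<cdot> mid a (a1 + b1 + c1) c =
      R a1 b1 \<cdot> ((L (a1 + b1) c1 \<cdot> R a (a1 + b1 + c1)) \<cdot> L (a + (a1 + b1 + c1)) c)"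
    by (simp add: mid_def)
  also have "\<dots> = R a1 b1 \<cdot> ((R a (a1 + b1) \<cdot> L (a + (a1 + b1)) c1) \<cdot> L (a + (a1 + b1 + c1)) c)"
    by (simp only: LR_assoc(2))
  also have "\<dots> = (R a1 b1 \<cdot> R a (a1 + b1)) \<cdot> (L (a + (a1 + b1)) c1 \<cdot> L (a + (a1 + b1) + c1) c)"
    by (simp add: add.assoc)
  also have "\<dots> = R (a + a1) b1 \<cdot> L (a + (a1 + b1)) (c1 + c)"
    by (simp only: LR_assoc(1) LR_assoc(3)[symmetric])
  finally show ?thesis by (simp add: mid_def add.assoc)
qed

end

context finite_products
begin

text \<open>Converse to \<open>LR_nat\<close>, \<open>LR_unit\<close> and \<open>LR_assoc\<close>:
  arbitrary families with these properties can be paired to give \<xi>.\<close>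

lemma cart_colaxI:
  assumes "cat_functor delta C Y" "Xi0 Y \<in> Arr C" "Dom C (Xi0 Y) = FObj Y 0" "Cod C (Xi0 Y) = T"
    and Xi: "\<And>m n. Xi Y m n = pr (L m n) (R m n)"
    and LR: "\<And>m n. L m n \<in> Arr C \<and> Dom C (L m n) = FObj Y (m + n) \<and> Cod C (L m n) = FObj Y m"
      "\<And>m n. R m n \<in> Arr C \<and> Dom C (R m n) = FObj Y (m + n) \<and> Cod C (R m n) = FObj Y n"
    and nat: "\<And>x y. x \<in> Arr delta \<Longrightarrow> y \<in> Arr delta \<Longrightarrow>
      L (Cod delta x) (Cod delta y) \<cdot> FArr Y (x \<boxtimes>\<^bsub>delta\<^esub> y) = FArr Y x \<cdot> L (Dom delta x) (Dom delta y)"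
      "\<And>x y. x \<in> Arr delta \<Longrightarrow> y \<in> Arr delta \<Longrightarrow>
      R (Cod delta x) (Cod delta y) \<cdot> FArr Y (x \<boxtimes>\<^bsub>delta\<^esub> y) = FArr Y y \<cdot> R (Dom delta x) (Dom delta y)"
    and units: "\<And>n. L n 0 = Ident C (FObj Y n)" "\<And>n. R 0 n = Ident C (FObj Y n)"
    and assocs: "\<And>m n k. L m n \<cdot> L (m + n) k = L m (n + k)"
      "\<And>m n k. R m n \<cdot> L (m + n) k = L n k \<cdot> R m (n + k)"
      "\<And>m n k. R n k \<cdot> R m (n + k) = R (m + n) k"
  shows "cart_colax C T P p q Y"
proof -
  interpret Y: cat_functor delta C Y by fact
  have [simp]: "L m n \<in> Arr C" "Dom C (L m n) = FObj Y (m + n)" "Cod C (L m n) = FObj Y m"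
    "R m n \<in> Arr C" "Dom C (R m n) = FObj Y (m + n)" "Cod C (R m n) = FObj Y n" for m n
    using LR by blast+
  have [simp]: "FObj Y n \<in> Obj C" for n using Y.fobj_simp[of n] by simp
  have "cat_functor delta K Y"
  proof (rule cat_functorI)
    show "category K" using K_monoidal by (simp add: monoidal_category_def)
    show "FObj Y \<in> extensional (Obj delta)" by (simp add: extensional_def)
    show "FArr Y \<in> extensional (Arr delta)" by (rule Y.farr_ext)
  qed (simp_all add: delta_category Y.farr_ident Y.farr_comp_simp)
  then have "colax_delta K Y"
    by (rule colax_deltaI[OF _ K_monoidal]) (simp_all add: Xi assms(2-4) nat units assocs add.assoc)
  then show ?thesis by (simp add: cart_colax_def finite_products_axioms)
qed

end

section \<open>Duality between ordinals and intervals\<close>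

text \<open>An element \<open>j\<close> of m+1 stands for the cut of m into the elements below
  \<open>j\<close> and the rest; the dual map takes preimages of cuts under \<open>u\<close>. It
  preserves the two trivial cuts, which are the endpoints.\<close>

definition interval_dual :: "nat \<Rightarrow> (nat \<Rightarrow> nat) \<Rightarrow> nat \<Rightarrow> nat" where
  "interval_dual n u j = card {i. i < n \<and> u i < j}"

text \<open>The way back: for \<open>f 0 + i < f m\<close>, the gap at \<open>f 0 + i\<close> is
  sent to the unique \<open>j\<close> with \<open>f j \<le> f 0 + i < f (Suc j)\<close>. The offset
  \<open>f 0\<close> allows for maps that miss the lower endpoint.\<close>

definition interval_codual :: "nat \<Rightarrow> (nat \<Rightarrow> nat) \<Rightarrow> nat \<Rightarrow> nat" where
  "interval_codual m f i = card {j. j < m \<and> f (Suc j) \<le> f 0 + i}"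

lemma card_cut:
  assumes "c \<le> n" "\<And>i. i < n \<Longrightarrow> i < c \<longleftrightarrow> Q i"
  shows "card {i. i < n \<and> Q i} = c"
proof -
  have "i < n \<and> Q i \<longleftrightarrow> i < c" for i
    using assms(1) assms(2)[of i] by (cases "i < n") auto
  then have "{i. i < n \<and> Q i} = {..<c}" by auto
  then show ?thesis by simp
qed

lemma interval_dual_eqI: "c \<le> n \<Longrightarrow> (\<And>i. i < n \<Longrightarrow> i < c \<longleftrightarrow> u i < j) \<Longrightarrow> interval_dual n u j = c"
  unfolding interval_dual_def by (rule card_cut)

text \<open>\<open>mono_cut\<close> identifies the cardinality with an actual cut. This Galois
  relation characterises the dual, and with \<open>interval_dual_eqI\<close> it replaces most
  counting.\<close>

lemma interval_dual_galois:
  assumes "mono_map n m u"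
  shows "interval_dual n u j \<le> n" "i < n \<Longrightarrow> i < interval_dual n u j \<longleftrightarrow> u i < j"
proof -
  obtain c where c: "c \<le> n" "\<forall>i<n. u i < j \<longleftrightarrow> i < c" using mono_cut[OF assms] by blast
  then have "interval_dual n u j = c" by (intro interval_dual_eqI) auto
  then show "interval_dual n u j \<le> n" "i < n \<Longrightarrow> i < interval_dual n u j \<longleftrightarrow> u i < j" using c by auto
qed

lemma interval_dual_mono_map:
  assumes "mono_map n m u"
  shows "mono_map (Suc m) (Suc n) (interval_dual n u)"
proof (rule mono_mapI)
  show "interval_dual n u j < Suc n" for j using interval_dual_galois(1)[OF assms, of j] by simp
  show "interval_dual n u i \<le> interval_dual n u j" if "i \<le> j" for i j
    unfolding interval_dual_def by (rule card_mono) (use that in auto)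
qed

text \<open>The values \<open>f (Suc j)\<close> are cut at \<open>f 0 + i\<close>. The case
  \<open>j = 0\<close> lies outside this cut, but there both sides are false.\<close>

lemma interval_codual_galois:
  assumes f: "mono_map (Suc m) (Suc n) f" and j: "j \<le> m"
  shows "interval_codual m f i < j \<longleftrightarrow> f 0 + i < f j"
proof -
  have "mono_map m (Suc n) (\<lambda>j. f (Suc j))" using f by (simp add: mono_map_def)
  from mono_cut[OF this, of "Suc (f 0 + i)"]
  obtain c where c: "c \<le> m" "\<forall>j<m. f (Suc j) \<le> f 0 + i \<longleftrightarrow> j < c" by (auto simp: less_Suc_eq_le)
  then have "interval_codual m f i = c" unfolding interval_codual_def by (intro card_cut) auto
  then show ?thesis using c(2) j by (cases j) (auto simp: not_less not_le less_Suc_eq_le Suc_le_eq)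
qed

lemma interval_codual_mono_map:
  assumes "mono_map (Suc m) (Suc n) f"
  shows "mono_map (f m - f 0) m (interval_codual m f)"
proof (rule mono_mapI)
  show "interval_codual m f i < m" if "i < f m - f 0" for i
    using interval_codual_galois[OF assms, of m i] that by simp
  show "interval_codual m f i \<le> interval_codual m f j" if "i \<le> j" for i j
    unfolding interval_codual_def by (rule card_mono) (use that in auto)
qed

text \<open>A nondecreasing map \<open>f\<close> between nonempty ordinals is an endpoint-preserving map followed by an
  inclusion of an interval of \<open>b + 1\<close> elements with \<open>a\<close> elements below and \<open>c\<close> above; \<open>u\<close> is the dual
  of the endpoint-preserving part.\<close>

definition factors where
  "factors l m f a b c u \<longleftrightarrow> mono_map (Suc l) (Suc m) f \<and> m = a + b + c \<and> f 0 = a \<and> f l = a + b \<and> mono_map b l u \<and>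
     (\<forall>i<b. \<forall>j\<le>l. u i < j \<longleftrightarrow> a + i < f j)"

lemma factors_exists:
  assumes "mono_map (Suc l) (Suc m) f"
  shows "factors l m f (f 0) (f l - f 0) (m - f l) (interval_codual l f)"
proof -
  have "f 0 \<le> f l" "f l \<le> m" using mono_map_mono[OF assms, of 0 l] mono_map_less[OF assms, of l] by auto
  then show ?thesis using interval_codual_mono_map[OF assms] interval_codual_galois[OF assms] assms by (auto simp: factors_def)
qed

text \<open>Both functions satisfy the same strict inequalities against every
  \<open>j \<le> l\<close>; testing them at \<open>j = u i\<close> and \<open>j = v i\<close> forces
  equality.\<close>

lemma factors_unique:
  assumes "factors l m f a b c u" "mono_map b l v" "\<And>i j. i < b \<Longrightarrow> j \<le> l \<Longrightarrow> v i < j \<longleftrightarrow> a + i < f j" "i < b"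
  shows "u i = v i"
proof -
  have lt: "u i < l" "v i < l" using assms by (auto simp: factors_def mono_map_less)
  have "u i < j \<longleftrightarrow> v i < j" if "j \<le> l" for j using assms that by (auto simp: factors_def)
  from this[of "u i"] this[of "v i"] lt show ?thesis by auto
qed

text \<open>The dual of the second map splits as an ordinal sum along the interval hit by the first.\<close>

lemma factors_comp:
  assumes f: "factors l (a + b + c) f a b c u" and g: "factors (a + b + c) n g a' b' c' v"
    and v: "delta_arr b' (a + b + c) v = (delta_arr a1 a v1 \<boxtimes>\<^bsub>delta\<^esub> delta_arr b1 b v2) \<boxtimes>\<^bsub>delta\<^esub> delta_arr c1 c v3"
    and m: "mono_map a1 a v1" "mono_map b1 b v2" "mono_map c1 c v3"
  shows "factors l n (\<lambda>i. g (f i)) (a' + a1) b1 (c1 + c') (\<lambda>i. u (v2 i))" "b' = a1 + b1 + c1"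
proof -
  note m' = mono_map_less[OF m(1)] mono_map_less[OF m(2)] mono_map_less[OF m(3)]
  show b': "b' = a1 + b1 + c1" using v by (simp add: delta_tensor delta_arr_eq)
  have v_eq: "v i = osum (a1 + b1) (a + b) (osum a1 a v1 v2) v3 i" if "i < b'" for i
    using v that by (simp add: delta_tensor delta_arr_eq)
  have v_cut: "v i < a \<longleftrightarrow> i < a1" "v i < a + b \<longleftrightarrow> i < a1 + b1" if "i < b'" for i
    using v_eq[OF that] m'(1)[of i] m'(2)[of "i - a1"] that b' by (auto simp: osum_def split: if_splits)
  have v_mid: "v (a1 + i) = a + v2 i" if "i < b1" for i
    using v_eq[of "a1 + i"] that b' by (simp add: osum_def)
  have galois: "v i < j \<longleftrightarrow> a' + i < g j" if "i < b'" "j \<le> a + b + c" for i j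
    using g that by (simp add: factors_def)
  have g_bounds: "a' \<le> g j" "g j \<le> a' + b'" if "j \<le> a + b + c" for j
    using g mono_map_mono[of "Suc (a + b + c)" "Suc n" g 0 j] mono_map_mono[of "Suc (a + b + c)" "Suc n" g j "a + b + c"] that
    by (auto simp: factors_def)
  \<comment> \<open>The Galois relation determines \<open>g\<close> completely: \<open>g j\<close>
    is \<open>a'\<close> plus the size of the initial segment that \<open>v\<close> sends below
    \<open>j\<close>.\<close>
  have cut: "g j = a' + d" if j: "j \<le> a + b + c" and d: "d \<le> b'" "\<And>i. i < b' \<Longrightarrow> v i < j \<longleftrightarrow> i < d" for j d
  proof (rule ccontr)
    assume "g j \<noteq> a' + d"
    then consider "g j - a' < d" | "d < g j - a'" using g_bounds[OF j] by linarith
    then show False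
    proof cases
      case 1
      then show False using galois[OF _ j, of "g j - a'"] d(2)[of "g j - a'"] d(1) g_bounds[OF j] by auto
    next
      case 2
      then have "d < b'" "a' + d < g j" using g_bounds[OF j] by linarith+
      then show False using galois[OF _ j, of d] d(2)[of d] by simp
    qed
  qed
  \<comment> \<open>The ends of the interval hit by \<open>f\<close> go to the ends of the interval
    hit by the composite, and these are where the three blocks of \<open>v\<close> meet.\<close>
  have g0: "g a = a' + a1" and g1: "g (a + b) = a' + (a1 + b1)"
    by (rule cut; use v_cut b' in auto)+
  have "u (v2 i) < j \<longleftrightarrow> a' + a1 + i < g (f j)" if "i < b1" "j \<le> l" for i j
  proof -
    have "u (v2 i) < j \<longleftrightarrow> a + v2 i < f j"
      using f m'(2)[OF that(1)] that(2) by (simp add: factors_def)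
    also have "\<dots> \<longleftrightarrow> v (a1 + i) < f j" by (simp add: v_mid that)
    also have "\<dots> \<longleftrightarrow> a' + (a1 + i) < g (f j)"
      using galois[of "a1 + i" "f j"] f that b' mono_map_less[of "Suc l" "Suc (a + b + c)" f j] by (simp add: factors_def)
    finally show ?thesis by (simp add: add.assoc)
  qed
  moreover have "n = a' + a1 + b1 + (c1 + c')" using g b' by (simp add: factors_def)
  ultimately show "factors l n (\<lambda>i. g (f i)) (a' + a1) b1 (c1 + c') (\<lambda>i. u (v2 i))"
    using f g g0 g1 m(2) mono_map_comp[of "Suc l" "Suc (a + b + c)" f "Suc n" g]
    by (simp add: factors_def mono_map_comp[of b1 b v2 l u])
qed

section \<open>Simplicial objects\<close>

text \<open>Arrows are those of \<open>delta\<close>, with domain and codomain exchanged; the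
  rewrite rules below move all computations into \<open>delta\<close>.\<close>

definition dplus_op where "dplus_op = opposite delta_plus"

lemma dplus_op_simps [simp]:
  "Obj dplus_op = {n. 0 < n}" "Arr dplus_op = {x \<in> Arr delta. 0 < Dom delta x \<and> 0 < Cod delta x}"
  "Dom dplus_op = Cod delta" "Cod dplus_op = Dom delta" "Ident dplus_op = Ident delta"
  "y \<cdot>\<^bsub>dplus_op\<^esub> x = x \<cdot>\<^bsub>delta\<^esub> y"
  by (auto simp: dplus_op_def opposite_def delta_plus_def full_subcat_def)

lemma dplus_op_category: "category dplus_op"
  by unfold_locales (auto simp: hom_def)

lemma dplus_op_arrE:
  assumes "x \<in> Arr dplus_op"
  obtains l m f where "mono_map (Suc l) (Suc m) f" "x = delta_arr (Suc l) (Suc m) f"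
proof -
  obtain f where f: "mono_map (Dom delta x) (Cod delta x) f" "x = delta_arr (Dom delta x) (Cod delta x) f"
    using assms by (auto elim: delta_arrE)
  obtain l m where "Dom delta x = Suc l" "Cod delta x = Suc m" using assms by (auto simp: gr0_conv_Suc)
  then show ?thesis using f that by metis
qed

text \<open>The inclusions of the first m+1 and, for \<open>incR\<close>, of the last k+1 elements
  of m+k+1; they overlap in the element \<open>m\<close>.\<close>

definition incL where "incL m k = delta_arr (Suc m) (Suc (m + k)) (\<lambda>i. i)"
definition incR where "incR m k = delta_arr (Suc k) (Suc (m + k)) (\<lambda>i. m + i)"

lemma mono_map_inc [simp]: "mono_map (Suc m) (Suc (m + k)) (\<lambda>i. i)" "mono_map (Suc k) (Suc (m + k)) (\<lambda>i. m + i)"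
  by (auto simp: mono_map_def)

lemma inc_simps [simp]:
  "incL m k \<in> Arr delta" "Dom delta (incL m k) = Suc m" "Cod delta (incL m k) = Suc (m + k)"
  "incR m k \<in> Arr delta" "Dom delta (incR m k) = Suc k" "Cod delta (incR m k) = Suc (m + k)"
  by (simp_all add: incL_def incR_def)

lemma inc_comp:
  "incL (m + n) k \<cdot>\<^bsub>delta\<^esub> incL m n = incL m (n + k)"
  "incL (m + n) k \<cdot>\<^bsub>delta\<^esub> incR m n = incR m (n + k) \<cdot>\<^bsub>delta\<^esub> incL n k"
  "incR m (n + k) \<cdot>\<^bsub>delta\<^esub> incR n k = incR (m + n) k"
  by (simp_all add: incL_def incR_def delta_comp delta_arr_eq add.assoc)

lemma inc_ident: "incL n 0 = Ident delta (Suc n)" "incR 0 n = Ident delta (Suc n)"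
  by (simp_all add: incL_def incR_def delta_ident)

definition dual_arr where "dual_arr = (\<lambda>(n, u, m). delta_arr (Suc m) (Suc n) (interval_dual n u))"

lemma dual_arr_delta_arr: "dual_arr (delta_arr n m u) = delta_arr (Suc m) (Suc n) (interval_dual n u)"
proof -
  have "interval_dual n (restrict u {..<n}) j = interval_dual n u j" for j
    unfolding interval_dual_def by (rule arg_cong[where f = card]) auto
  then show ?thesis unfolding dual_arr_def delta_arr_def[of n m u] prod.case delta_arr_eq by simp
qed

lemma dual_arr_simps [simp]:
  assumes "x \<in> Arr delta"
  shows "dual_arr x \<in> Arr delta" "Dom delta (dual_arr x) = Suc (Cod delta x)" "Cod delta (dual_arr x) = Suc (Dom delta x)"
proof -
  obtain n m u where "mono_map n m u" "x = delta_arr n m u" using assms by (metis delta_arrE)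
  then show "dual_arr x \<in> Arr delta" "Dom delta (dual_arr x) = Suc (Cod delta x)" "Cod delta (dual_arr x) = Suc (Dom delta x)"
    by (simp_all add: dual_arr_delta_arr interval_dual_mono_map)
qed

lemma dual_arr_ident: "dual_arr (Ident delta n) = Ident delta (Suc n)"
  by (auto simp: delta_ident dual_arr_delta_arr delta_arr_eq intro!: interval_dual_eqI)

text \<open>The preimage of a cut under a composite is an iterated preimage, hence the reversed
  order.\<close>

lemma dual_arr_comp:
  assumes "x \<in> Arr delta" "y \<in> Arr delta" "Cod delta x = Dom delta y"
  shows "dual_arr (y \<cdot>\<^bsub>delta\<^esub> x) = dual_arr x \<cdot>\<^bsub>delta\<^esub> dual_arr y"
proof -
  obtain n m u where u: "mono_map n m u" "x = delta_arr n m u" using assms by (metis delta_arrE)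
  obtain k v where v: "mono_map m k v" "y = delta_arr m k v" using assms u by (metis delta_arrE delta_simps(4))
  have "interval_dual n (\<lambda>i. v (u i)) j = interval_dual n u (interval_dual m v j)" for j
    by (rule interval_dual_eqI) (simp_all add: interval_dual_galois[OF u(1)] interval_dual_galois[OF v(1)] mono_map_less[OF u(1)])
  then show ?thesis using u v by (simp add: delta_comp dual_arr_delta_arr interval_dual_mono_map delta_arr_eq)
qed

text \<open>A cut inside the first summand is pulled back by \<open>x\<close> alone. A cut at
  \<open>m + j\<close> contains the whole first summand, so \<open>y\<close> pulls it back with the
  shift \<open>n\<close>. These equations yield naturality of \<xi> for the colax functor of a
  simplicial object.\<close>

lemma dual_arr_tensor:
  assumes "x \<in> Arr delta" "y \<in> Arr delta"
  shows "dual_arr (x \<boxtimes>\<^bsub>delta\<^esub> y) \<cdot>\<^bsub>delta\<^esub> incL (Cod delta x) (Cod delta y) = incL (Dom delta x) (Dom delta y) \<cdot>\<^bsub>delta\<^esub> dual_arr x"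
    "dual_arr (x \<boxtimes>\<^bsub>delta\<^esub> y) \<cdot>\<^bsub>delta\<^esub> incR (Cod delta x) (Cod delta y) = incR (Dom delta x) (Dom delta y) \<cdot>\<^bsub>delta\<^esub> dual_arr y"
proof -
  obtain n m u where u: "mono_map n m u" "x = delta_arr n m u" using assms by (metis delta_arrE)
  obtain n' m' v where v: "mono_map n' m' v" "y = delta_arr n' m' v" using assms by (metis delta_arrE)
  have "interval_dual (n + n') (osum n m u v) j = interval_dual n u j" if "j < Suc m" for j
  proof (rule interval_dual_eqI)
    show "interval_dual n u j \<le> n + n'" using interval_dual_galois(1)[OF u(1), of j] by simp
    show "i < interval_dual n u j \<longleftrightarrow> osum n m u v i < j" if "i < n + n'" for i
      using interval_dual_galois(1)[OF u(1), of j] interval_dual_galois(2)[OF u(1), of i j] \<open>j < Suc m\<close> by (auto simp: osum_def)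
  qed
  then show "dual_arr (x \<boxtimes>\<^bsub>delta\<^esub> y) \<cdot>\<^bsub>delta\<^esub> incL (Cod delta x) (Cod delta y) = incL (Dom delta x) (Dom delta y) \<cdot>\<^bsub>delta\<^esub> dual_arr x"
    using u v by (simp add: delta_tensor incL_def dual_arr_delta_arr delta_comp interval_dual_mono_map delta_arr_eq)
  have "interval_dual (n + n') (osum n m u v) (m + j) = n + interval_dual n' v j" for j
  proof (rule interval_dual_eqI)
    show "n + interval_dual n' v j \<le> n + n'" using interval_dual_galois(1)[OF v(1), of j] by simp
    show "i < n + interval_dual n' v j \<longleftrightarrow> osum n m u v i < m + j" if "i < n + n'" for i
    proof (cases "i < n")
      case True
      then show ?thesis using mono_map_less[OF u(1), of i] by (simp add: osum_def)
    next
      case False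
      then obtain k where "i = n + k" by (metis le_Suc_ex not_less)
      then show ?thesis using interval_dual_galois(2)[OF v(1), of k j] that by (simp add: osum_def)
    qed
  qed
  then show "dual_arr (x \<boxtimes>\<^bsub>delta\<^esub> y) \<cdot>\<^bsub>delta\<^esub> incR (Cod delta x) (Cod delta y) = incR (Dom delta x) (Dom delta y) \<cdot>\<^bsub>delta\<^esub> dual_arr y"
    using u v by (simp add: delta_tensor incR_def dual_arr_delta_arr delta_comp interval_dual_mono_map delta_arr_eq)
qed

text \<open>Since \<open>f j\<close> lies between \<open>a\<close> and \<open>a + b\<close>, the
  Galois relation identifies \<open>f j - a\<close> with the cut that is the preimage of
  \<open>j\<close> under \<open>u\<close>.\<close>

lemma factors_decompose:
  assumes "factors l m f a b c u"
  shows "delta_arr (Suc l) (Suc m) f = incL (a + b) c \<cdot>\<^bsub>delta\<^esub> (incR a b \<cdot>\<^bsub>delta\<^esub> dual_arr (delta_arr b l u))"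
proof -
  have u: "mono_map b l u" and f: "mono_map (Suc l) (Suc m) f" "f 0 = a" "f l = a + b" "m = a + b + c"
    and galois: "\<And>i j. i < b \<Longrightarrow> j \<le> l \<Longrightarrow> u i < j \<longleftrightarrow> a + i < f j"
    using assms by (auto simp: factors_def)
  have "f j = a + interval_dual b u j" if "j < Suc l" for j
  proof -
    have "f 0 \<le> f j" "f j \<le> f l" using mono_map_mono[OF f(1)] that by auto
    moreover from this have "interval_dual b u j = f j - a"
      using f(2,3) galois that by (intro interval_dual_eqI) auto
    ultimately show ?thesis using f(2) by simp
  qed
  then show ?thesis
    using u f(4) by (simp add: incL_def incR_def dual_arr_delta_arr delta_comp interval_dual_mono_map delta_arr_eq
        mono_map_comp[OF interval_dual_mono_map[OF u] mono_map_inc(2)[of b a]])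
qed

section \<open>The simplicial object of a colax functor\<close>

context cart_colax
begin

text \<open>The factorisation of \<open>factors_exists\<close> written out for an arrow between the
  ordinals \<open>k\<close> and \<open>l\<close>: the last vertices are \<open>k - 1\<close> and
  \<open>l - 1\<close>, so \<open>l - Suc (f (k - 1))\<close> elements lie above the
  interval.\<close>

definition simp_arr where
  "simp_arr x = (case x of (k, f, l) \<Rightarrow> FArr Y (delta_arr (f (k - 1) - f 0) (k - 1) (interval_codual (k - 1) f)) \<cdot>
     mid (f 0) (f (k - 1) - f 0) (l - Suc (f (k - 1))))"

text \<open>By \<open>factors_unique\<close> the operator may be computed from any factorisation,
  which frees later proofs from the explicit codual.\<close>

lemma simp_arr_factors:
  assumes "factors l m f a b c u"
  shows "simp_arr (delta_arr (Suc l) (Suc m) f) = FArr Y (delta_arr b l u) \<cdot> mid a b c"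
proof -
  have f: "mono_map (Suc l) (Suc m) f" "f 0 = a" "f l = a + b" "m = a + b + c" using assms by (auto simp: factors_def)
  have "interval_codual l (restrict f {..<Suc l}) i = interval_codual l f i" for i
    unfolding interval_codual_def by (rule arg_cong[where f = card]) auto
  then have "simp_arr (delta_arr (Suc l) (Suc m) f) = FArr Y (delta_arr b l (interval_codual l f)) \<cdot> mid a b c"
    using f(2-4) by (simp add: simp_arr_def delta_arr_def cong: restrict_cong)
  moreover have "delta_arr b l (interval_codual l f) = delta_arr b l u"
    using factors_unique[OF assms, of "interval_codual l f"] interval_codual_mono_map[OF f(1)] interval_codual_galois[OF f(1)] f by (simp add: delta_arr_eq)
  ultimately show ?thesis by simp
qed

lemma simp_arr_simps [simp]:
  assumes "x \<in> Arr delta" "0 < Dom delta x" "0 < Cod delta x"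
  shows "simp_arr x \<in> Arr C" "Dom C (simp_arr x) = FObj Y (Cod delta x - Suc 0)" "Cod C (simp_arr x) = FObj Y (Dom delta x - Suc 0)"
proof -
  obtain l m f where f: "mono_map (Suc l) (Suc m) f" "x = delta_arr (Suc l) (Suc m) f"
    using dplus_op_arrE[of x] assms by auto
  obtain a b c u where u: "factors l m f a b c u" using factors_exists[OF f(1)] by blast
  then have "mono_map b l u" "FObj Y (a + b + c) = FObj Y m" by (simp_all add: factors_def)
  moreover have "simp_arr x = FArr Y (delta_arr b l u) \<cdot> mid a b c" by (simp only: f(2) simp_arr_factors[OF u])
  ultimately show "simp_arr x \<in> Arr C" "Dom C (simp_arr x) = FObj Y (Cod delta x - Suc 0)"
    "Cod C (simp_arr x) = FObj Y (Dom delta x - Suc 0)"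
    by (simp_all add: f(2))
qed

text \<open>The face \<open>mid a b c\<close> has to pass the image of the dual \<open>v\<close> of
  \<open>g\<close>. Two applications of \<open>delta_split\<close> write \<open>v\<close> as a sum
  over a+b+c, so that \<open>mid_nat\<close> leaves only the middle block; \<open>mid_mid\<close>
  merges the faces, and \<open>factors_comp\<close> says that the result is the factorisation of the
  composite.\<close>

lemma simp_arr_comp:
  assumes "mono_map (Suc l) (Suc m) f" "mono_map (Suc m) (Suc n) g"
  shows "simp_arr (delta_arr (Suc m) (Suc n) g \<cdot>\<^bsub>delta\<^esub> delta_arr (Suc l) (Suc m) f) =
    simp_arr (delta_arr (Suc l) (Suc m) f) \<cdot> simp_arr (delta_arr (Suc m) (Suc n) g)"
proof -
  obtain a b c u where f: "factors l m f a b c u" using factors_exists[OF assms(1)] by blast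
  obtain a' b' c' v where g: "factors m n g a' b' c' v" using factors_exists[OF assms(2)] by blast
  have m: "m = a + b + c" and u: "mono_map b l u" and v: "mono_map b' (a + b + c) v"
    using f g by (auto simp: factors_def)
  obtain p0 c1 x v3 where x: "b' = p0 + c1" "mono_map p0 (a + b) x" "mono_map c1 c v3"
    "delta_arr b' (a + b + c) v = delta_arr p0 (a + b) x \<boxtimes>\<^bsub>delta\<^esub> delta_arr c1 c v3"
    using delta_split[OF v] .
  obtain a1 b1 v1 v2 where x12: "p0 = a1 + b1" "mono_map a1 a v1" "mono_map b1 b v2"
    "delta_arr p0 (a + b) x = delta_arr a1 a v1 \<boxtimes>\<^bsub>delta\<^esub> delta_arr b1 b v2"
    using delta_split[OF x(2)] .
  note split = x(4)[unfolded x12(4)]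
  note fg = factors_comp[OF f[unfolded m] g[unfolded m] split x12(2,3) x(3)]
  have "simp_arr (delta_arr (Suc l) (Suc m) f) \<cdot> simp_arr (delta_arr (Suc m) (Suc n) g) =
      (FArr Y (delta_arr b l u) \<cdot> mid a b c) \<cdot> (FArr Y (delta_arr b' (a + b + c) v) \<cdot> mid a' b' c')"
    unfolding simp_arr_factors[OF f] simp_arr_factors[OF g] by (simp only: m)
  also have "\<dots> = FArr Y (delta_arr b l u) \<cdot> ((mid a b c \<cdot> FArr Y (delta_arr b' (a + b + c) v)) \<cdot> mid a' b' c')"
    using u v by simp
  also have "\<dots> = FArr Y (delta_arr b l u) \<cdot> ((FArr Y (delta_arr b1 b v2) \<cdot> mid a1 b1 c1) \<cdot> mid a' b' c')"
    using mid_nat[of "delta_arr a1 a v1" "delta_arr b1 b v2" "delta_arr c1 c v3"] x12 x(3) by (simp add: split)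
  also have "\<dots> = (FArr Y (delta_arr b l u) \<cdot> FArr Y (delta_arr b1 b v2)) \<cdot> (mid a1 b1 c1 \<cdot> mid a' (a1 + b1 + c1) c')"
    using u x12 by (simp add: fg(2) add.assoc)
  also have "\<dots> = FArr Y (delta_arr b1 l (\<lambda>i. u (v2 i))) \<cdot> mid (a' + a1) b1 (c1 + c')"
    using u x12 by (simp add: mid_mid delta_comp flip: Y_comp)
  also have "\<dots> = simp_arr (delta_arr (Suc l) (Suc n) (\<lambda>i. g (f i)))"
    by (simp only: simp_arr_factors[OF fg(1)])
  finally show ?thesis using assms by (simp add: delta_comp)
qed

text \<open>For interval inclusions the endpoint-preserving part is an identity; for the image of
  \<open>dual_arr\<close> the interval is everything. In each case one factor of the operator
  disappears.\<close>

lemma simp_arr_incL: "simp_arr (incL m n) = L m n" and simp_arr_incR: "simp_arr (incR m n) = R m n"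
  and simp_arr_dual_arr: "x \<in> Arr delta \<Longrightarrow> simp_arr (dual_arr x) = FArr Y x"
proof -
  have "factors m (m + n) (\<lambda>i. i) 0 m n (\<lambda>i. i)" by (auto simp: factors_def)
  from simp_arr_factors[OF this] show "simp_arr (incL m n) = L m n"
    by (simp add: incL_def mid_L flip: delta_ident)
  have "factors n (m + n) (\<lambda>i. m + i) m n 0 (\<lambda>i. i)" by (auto simp: factors_def)
  from simp_arr_factors[OF this] show "simp_arr (incR m n) = R m n"
    by (simp add: incR_def mid_R flip: delta_ident)
  assume "x \<in> Arr delta"
  then obtain k l u where u: "mono_map k l u" and x: "x = delta_arr k l u" by (metis delta_arrE)
  have "interval_dual k u 0 = 0" "interval_dual k u l = k" using u by (auto intro!: interval_dual_eqI simp: mono_map_less)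
  then have "factors l k (interval_dual k u) 0 k 0 u" using u by (auto simp: factors_def interval_dual_mono_map interval_dual_galois)
  from simp_arr_factors[OF this] show "simp_arr (dual_arr x) = FArr Y x"
    using u by (simp add: x dual_arr_delta_arr mid_L LR_unit)
qed

definition simp_obj where "simp_obj = \<lparr>FObj = (\<lambda>n \<in> {n. 0 < n}. FObj Y (n - 1)), FArr = (\<lambda>x \<in> Arr dplus_op. simp_arr x)\<rparr>"

lemma simp_obj_simps [simp]: "0 < n \<Longrightarrow> FObj simp_obj n = FObj Y (n - Suc 0)"
  "x \<in> Arr delta \<Longrightarrow> 0 < Dom delta x \<Longrightarrow> 0 < Cod delta x \<Longrightarrow> FArr simp_obj x = simp_arr x"
  by (simp_all add: simp_obj_def)

lemma simp_obj_functor: "cat_functor dplus_op C simp_obj"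
proof (rule cat_functorI[OF dplus_op_category category_axioms])
  show "FObj simp_obj \<in> extensional (Obj dplus_op)" "FArr simp_obj \<in> extensional (Arr dplus_op)"
    by (simp_all add: simp_obj_def del: dplus_op_simps(2))
next
  fix A assume "A \<in> Obj dplus_op"
  then obtain n where A: "A = Suc n" by (auto simp: gr0_conv_Suc)
  show "FArr simp_obj (Ident dplus_op A) = Ident C (FObj simp_obj A)"
    using simp_arr_incL[of n 0] by (simp add: A LR_unit inc_ident)
next
  fix x y assume xy: "x \<in> Arr dplus_op" "y \<in> Arr dplus_op" "Cod dplus_op x = Dom dplus_op y"
  obtain m n g where g: "mono_map (Suc m) (Suc n) g" "x = delta_arr (Suc m) (Suc n) g" using dplus_op_arrE[OF xy(1)] .
  obtain l m' f where "mono_map (Suc l) (Suc m') f" "y = delta_arr (Suc l) (Suc m') f" using dplus_op_arrE[OF xy(2)] .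
  with xy(3) g(2) have f: "mono_map (Suc l) (Suc m) f" "y = delta_arr (Suc l) (Suc m) f" by simp_all
  show "FArr simp_obj (y \<cdot>\<^bsub>dplus_op\<^esub> x) = FArr simp_obj y \<cdot> FArr simp_obj x"
    using simp_arr_comp[OF f(1) g(1)] f g by simp
qed auto

end

section \<open>The equivalence with simplicial objects\<close>

context finite_products
begin

text \<open>Every operator is an image of an arrow of \<open>delta\<close> after a
  \<open>mid\<close>, and a monoidal transformation commutes with both. Conversely, naturality at
  \<open>incL\<close>, \<open>incR\<close> and the arrows \<open>dual_arr x\<close> returns the
  axioms, and compatibility with \<open>Xi0\<close> holds because \<open>T\<close> is
  terminal.\<close>

lemma trans_simp_obj:
  assumes "cart_colax C T P p q Y" "cart_colax C T P p q Z"
  shows "colax_delta_trans K Y Z \<sigma> \<longleftrightarrow>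
    nat_trans dplus_op C (cart_colax.simp_obj C p q Y) (cart_colax.simp_obj C p q Z) (\<lambda>n \<in> {n. 0 < n}. \<sigma> (n - Suc 0))"
proof
  interpret Y: cart_colax C T P p q Y by fact
  interpret Z: cart_colax C T P p q Z by fact
  assume "colax_delta_trans K Y Z \<sigma>"
  then interpret s: colax_delta_trans K Y Z \<sigma> .
  have s [simp]: "\<sigma> n \<in> Arr C" "Dom C (\<sigma> n) = FObj Y n" "Cod C (\<sigma> n) = FObj Z n" for n
    using s.component_delta[of n] by simp_all
  have "pr (Z.L m n \<cdot> \<sigma> (m + n)) (Z.R m n \<cdot> \<sigma> (m + n)) = pr (\<sigma> m \<cdot> Y.L m n) (\<sigma> n \<cdot> Y.R m n)" for m n
    using s.xi_comm[of m n] by (simp add: Y.Xi_eq Z.Xi_eq)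
  from Y.pr_inject[OF this]
  have LR: "Z.L m n \<cdot> \<sigma> (m + n) = \<sigma> m \<cdot> Y.L m n" "Z.R m n \<cdot> \<sigma> (m + n) = \<sigma> n \<cdot> Y.R m n" for m n
    by simp_all
  have mid: "Z.mid a b c \<cdot> \<sigma> (a + b + c) = \<sigma> b \<cdot> Y.mid a b c" for a b c
  proof -
    have "Z.mid a b c \<cdot> \<sigma> (a + b + c) = Z.R a b \<cdot> (\<sigma> (a + b) \<cdot> Y.L (a + b) c)"
      by (simp add: Z.mid_def LR)
    also have "\<dots> = (\<sigma> b \<cdot> Y.R a b) \<cdot> Y.L (a + b) c"
      by (rule comp_reduce[OF LR(2)]) simp_all
    finally show ?thesis by (simp add: Y.mid_def)
  qed
  show "nat_trans dplus_op C Y.simp_obj Z.simp_obj (\<lambda>n \<in> {n. 0 < n}. \<sigma> (n - Suc 0))"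
  proof (rule nat_transI[OF Y.simp_obj_functor Z.simp_obj_functor])
    fix x assume "x \<in> Arr dplus_op"
    then obtain l m f where f: "mono_map (Suc l) (Suc m) f" "x = delta_arr (Suc l) (Suc m) f" by (rule dplus_op_arrE)
    obtain a b c u where u: "factors l m f a b c u" using factors_exists[OF f(1)] by blast
    then have u': "mono_map b l u" and m: "m = a + b + c" by (simp_all add: factors_def)
    have "\<sigma> l \<cdot> Y.simp_arr x = (\<sigma> l \<cdot> FArr Y (delta_arr b l u)) \<cdot> Y.mid a b c"
      using u' unfolding f(2) Y.simp_arr_factors[OF u] by simp
    also have "\<dots> = FArr Z (delta_arr b l u) \<cdot> (\<sigma> b \<cdot> Y.mid a b c)"
      using s.natural_simp[of "delta_arr b l u"] u' by simp
    also have "\<dots> = (FArr Z (delta_arr b l u) \<cdot> Z.mid a b c) \<cdot> \<sigma> m"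
      using u' by (simp add: m mid)
    also have "\<dots> = Z.simp_arr x \<cdot> \<sigma> m"
      unfolding f(2) Z.simp_arr_factors[OF u] by simp
    finally show "(\<lambda>n \<in> {n. 0 < n}. \<sigma> (n - Suc 0)) (Cod dplus_op x) \<cdot> FArr Y.simp_obj x =
        FArr Z.simp_obj x \<cdot> (\<lambda>n \<in> {n. 0 < n}. \<sigma> (n - Suc 0)) (Dom dplus_op x)"
      using f by simp
  qed auto
next
  interpret Y: cart_colax C T P p q Y by fact
  interpret Z: cart_colax C T P p q Z by fact
  let ?t = "\<lambda>n \<in> {n. 0 < n}. \<sigma> (n - Suc 0)"
  assume "nat_trans dplus_op C Y.simp_obj Z.simp_obj ?t"
  then interpret t: nat_trans dplus_op C Y.simp_obj Z.simp_obj ?t .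
  have s [simp]: "\<sigma> n \<in> Arr C" "Dom C (\<sigma> n) = FObj Y n" "Cod C (\<sigma> n) = FObj Z n" for n
    using t.component_simps[of "Suc n"] by simp_all
  have nat: "\<sigma> (Dom delta x - Suc 0) \<cdot> Y.simp_arr x = Z.simp_arr x \<cdot> \<sigma> (Cod delta x - Suc 0)"
    if "x \<in> Arr delta" "0 < Dom delta x" "0 < Cod delta x" for x
    using t.natural_simp[of x] that by simp
  show "colax_delta_trans K Y Z \<sigma>"
  proof (rule colax_delta_transI[OF Y.colax_delta_axioms Z.colax_delta_axioms])
    fix x assume "x \<in> Arr delta"
    then show "\<sigma> (Cod delta x) \<cdot>\<^bsub>K\<^esub> FArr Y x = FArr Z x \<cdot>\<^bsub>K\<^esub> \<sigma> (Dom delta x)"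
      using nat[of "dual_arr x"] by (simp add: Y.simp_arr_dual_arr Z.simp_arr_dual_arr)
  next
    fix m n
    show "Xi Z m n \<cdot>\<^bsub>K\<^esub> \<sigma> (m + n) = (\<sigma> m \<boxtimes>\<^bsub>K\<^esub> \<sigma> n) \<cdot>\<^bsub>K\<^esub> Xi Y m n"
      using nat[of "incL m n"] nat[of "incR m n"]
      by (simp add: Y.Xi_eq Z.Xi_eq Y.simp_arr_incL Z.simp_arr_incL Y.simp_arr_incR Z.simp_arr_incR)
  next
    have "Xi0 Z \<in> Arr C" "Xi0 Y \<in> Arr C" "Dom C (Xi0 Z) = FObj Z 0" "Dom C (Xi0 Y) = FObj Y 0"
      "Cod C (Xi0 Z) = T" "Cod C (Xi0 Y) = T"
      using Y.xi0_simps Z.xi0_simps by simp_all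
    then show "Xi0 Z \<cdot>\<^bsub>K\<^esub> \<sigma> 0 = Xi0 Y"
      using terminal_unique[of "Xi0 Z \<cdot> \<sigma> 0" "Xi0 Y"] by simp
  qed simp
qed

text \<open>The witness has Y(n) equal to the value of \<open>X\<close> at n+1, acts through
  \<open>dual_arr\<close>, and pairs front and back faces to obtain \<xi>.\<close>

lemma simp_obj_surj:
  assumes "cat_functor dplus_op C X"
  shows "\<exists>Y. cart_colax C T P p q Y \<and> cart_colax.simp_obj C p q Y = X"
proof -
  interpret X: cat_functor dplus_op C X by fact
  define Y where "Y = \<lparr>FObj = (\<lambda>n. FObj X (Suc n)), FArr = (\<lambda>x \<in> Arr delta. FArr X (dual_arr x)),
    Xi = (\<lambda>m n. pr (FArr X (incL m n)) (FArr X (incR m n))), Xi0 = bang (FObj X (Suc 0))\<rparr>"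
  have Y [simp]: "FObj Y n = FObj X (Suc n)" "x \<in> Arr delta \<Longrightarrow> FArr Y x = FArr X (dual_arr x)"
    "Xi Y m n = pr (FArr X (incL m n)) (FArr X (incR m n))" "Xi0 Y = bang (FObj X (Suc 0))" for n m x
    by (simp_all add: Y_def)
  have X_obj [simp]: "FObj X (Suc n) \<in> Obj C" for n using X.fobj_simp[of "Suc n"] by simp
  have X_arr [simp]: "FArr X x \<in> Arr C" "Dom C (FArr X x) = FObj X (Cod delta x)" "Cod C (FArr X x) = FObj X (Dom delta x)"
    if "x \<in> Arr delta" "0 < Dom delta x" "0 < Cod delta x" for x
    using X.farr_simps[of x] that by simp_all
  have X_comp: "FArr X x \<cdot> FArr X y = FArr X (y \<cdot>\<^bsub>delta\<^esub> x)"
    if "x \<in> Arr delta" "y \<in> Arr delta" "Cod delta x = Dom delta y" "0 < Dom delta x" "0 < Cod delta x" "0 < Cod delta y" for x y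
    using X.farr_comp_simp[of y x] that by simp
  have X_ident: "FArr X (Ident delta (Suc n)) = Ident C (FObj X (Suc n))" for n
    using X.farr_ident[of "Suc n"] by simp
  have "cart_colax C T P p q Y"
  proof (rule cart_colaxI[where L = "\<lambda>m n. FArr X (incL m n)" and R = "\<lambda>m n. FArr X (incR m n)"])
    show "cat_functor delta C Y"
    proof (rule cat_functorI[OF delta_category category_axioms])
      show "FArr Y \<in> extensional (Arr delta)" by (simp add: Y_def)
    qed (simp_all add: dual_arr_ident X_ident dual_arr_comp X_comp)
  qed (simp_all add: X_comp X_ident inc_ident inc_comp dual_arr_tensor add.assoc)
  then interpret Y: cart_colax C T P p q Y .
  have L: "Y.L m n = FArr X (incL m n)" and R: "Y.R m n = FArr X (incR m n)" for m n
    by (simp_all add: Y.L_def Y.R_def)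
  \<comment> \<open>By construction the two agree on interval inclusions and on duals;
    \<open>factors_decompose\<close> shows that every arrow is composed of these.\<close>
  have simp_arr: "Y.simp_arr x = FArr X x" if "x \<in> Arr dplus_op" for x
  proof -
    obtain l m f where f: "mono_map (Suc l) (Suc m) f" "x = delta_arr (Suc l) (Suc m) f" using dplus_op_arrE[OF \<open>x \<in> _\<close>] .
    obtain a b c u where u: "factors l m f a b c u" using factors_exists[OF f(1)] by blast
    then have u': "mono_map b l u" by (simp add: factors_def)
    have "Y.simp_arr x = FArr X (dual_arr (delta_arr b l u)) \<cdot> (FArr X (incR a b) \<cdot> FArr X (incL (a + b) c))"
      using u' unfolding f(2) Y.simp_arr_factors[OF u] Y.mid_def L R by simp
    also have "\<dots> = FArr X (incL (a + b) c \<cdot>\<^bsub>delta\<^esub> (incR a b \<cdot>\<^bsub>delta\<^esub> dual_arr (delta_arr b l u)))"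
      using u' by (simp add: X_comp)
    finally show ?thesis by (simp only: f(2) factors_decompose[OF u])
  qed
  have "(\<lambda>n \<in> {n. 0 < n}. FObj Y (n - 1)) = FObj X"
    using X.fobj by (auto simp: fun_eq_iff PiE_def extensional_def restrict_def)
  moreover have "(\<lambda>x \<in> Arr dplus_op. Y.simp_arr x) = FArr X"
    using X.farr_ext simp_arr by (auto simp: fun_eq_iff extensional_def restrict_def simp del: dplus_op_simps(2))
  ultimately have "Y.simp_obj = X" by (simp add: Y.simp_obj_def del: dplus_op_simps(2))
  with \<open>cart_colax C T P p q Y\<close> show ?thesis by blast
qed

lemma homotopy_monoids_simplicial:
  "\<exists>F. weak_equivalence (homotopy_monoid_cat K (Arr C)) (functor_cat dplus_op C) F"
proof -
  let ?H = "homotopy_monoid_cat K (Arr C)" and ?S = "functor_cat dplus_op C"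
  interpret H: category ?H by (rule homotopy_monoid_category)
  interpret S: category ?S by (rule functor_category)
  define simp_of where "simp_of = cart_colax.simp_obj C p q"
  let ?r = "\<lambda>\<sigma>. \<lambda>n \<in> {n. 0 < n}. \<sigma> (n - Suc 0)"
  let ?a = "\<lambda>(Y, \<sigma>, Z). (simp_of Y, ?r \<sigma>, simp_of Z)"
  \<comment> \<open>The structure maps of a colax functor lie in \<open>Arr C\<close> automatically,
    so these homotopy monoids are all the colax functors on \<open>delta\<close>.\<close>
  have hm: "is_homotopy_monoid K (Arr C) Y \<longleftrightarrow> cart_colax C T P p q Y" for Y
    using cart_colax.Y_simps(2)[of C T P p q Y] colax_delta.xi0_simps(1)[of K Y]
    by (auto simp: homotopy_monoid_iff cart_colax_def finite_products_axioms)
  have hom_H: "hom ?H X Y = {(X, \<sigma>, Y) |\<sigma>. cart_colax C T P p q X \<and> cart_colax C T P p q Y \<and> colax_delta_trans K X Y \<sigma>}" for X Y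
    by (auto simp: hom_def homotopy_monoid_cat_def monoidal_nat_trans_iff hm)
  have obj: "Obj ?H = {Y. cart_colax C T P p q Y}" "Obj ?S = {X. cat_functor dplus_op C X}"
    by (simp_all add: homotopy_monoid_cat_def hm functor_cat_def)
  have hom_S: "hom ?S X Y = {(X, \<sigma>, Y) |\<sigma>. nat_trans dplus_op C X Y \<sigma>}" for X Y
    by (auto simp: hom_def functor_cat_def)
  have comp: "Comp ?H (Y', \<tau>', Z') (X'', \<sigma>', Y) = (X'', \<lambda>n. \<tau>' n \<cdot> \<sigma>' n, Z')"
    "Ident ?H V = (V, \<lambda>n. Ident C (FObj V n), V)"
    "Comp ?S (A', \<alpha>, A) (B', \<beta>, B) = (B', \<lambda>n \<in> {n. 0 < n}. \<alpha> n \<cdot> \<beta> n, A)"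
    "Ident ?S D = (D, \<lambda>n \<in> {n. 0 < n}. Ident C (FObj D n), D)"
    for Y' \<tau>' Z' X'' \<sigma>' Y V A' \<alpha> A B' \<beta> B D
    by (simp_all add: homotopy_monoid_cat_def functor_cat_def)
  have sx_functor: "cat_functor dplus_op C (simp_of Y)" if "cart_colax C T P p q Y" for Y
    using cart_colax.simp_obj_functor[OF that] by (simp add: simp_of_def)
  have trans: "colax_delta_trans K Y Z \<sigma> \<longleftrightarrow> nat_trans dplus_op C (simp_of Y) (simp_of Z) (?r \<sigma>)"
    if "cart_colax C T P p q Y" "cart_colax C T P p q Z" for Y Z \<sigma>
    using trans_simp_obj[OF that] by (simp add: simp_of_def)
  have "weak_equivalence ?H ?S
      \<lparr>FObj = (\<lambda>A \<in> Obj ?H. simp_of A), FArr = (\<lambda>f \<in> Arr ?H. ?a f)\<rparr>"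
  proof (rule weak_equivalenceI[OF functor_category])
    fix f assume "f \<in> Arr ?H"
    then show "Dom ?H f \<in> Obj ?H \<and> Cod ?H f \<in> Obj ?H" by simp
  next
    fix A assume A: "A \<in> Obj ?H"
    then interpret A: cart_colax C T P p q A by (simp add: obj)
    show "Ident ?H A \<in> hom ?H A A \<and> ?a (Ident ?H A) = Ident ?S (simp_of A)"
      using H.ident_hom[OF A] by (auto simp: comp simp_of_def fun_eq_iff)
    show "simp_of A \<in> Obj ?S"
      using A sx_functor by (simp add: obj)
  next
    fix f g X Y Z assume f: "f \<in> hom ?H X Y" and g: "g \<in> hom ?H Y Z"
    show "g \<cdot>\<^bsub>?H\<^esub> f \<in> hom ?H X Z \<and> ?a (g \<cdot>\<^bsub>?H\<^esub> f) = ?a g \<cdot>\<^bsub>?S\<^esub> ?a f"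
      using H.comp_hom[OF f g] f g by (auto simp: hom_H comp fun_eq_iff)
  next
    fix X Y assume "X \<in> Obj ?H" "Y \<in> Obj ?H"
    then have XY: "cart_colax C T P p q X" "cart_colax C T P p q Y" by (simp_all add: obj)
    have r_inj: "\<sigma> = \<tau>" if "?r \<sigma> = ?r \<tau>" for \<sigma> \<tau> :: "nat \<Rightarrow> 'a"
    proof
      show "\<sigma> n = \<tau> n" for n using fun_cong[OF that, of "Suc n"] by simp
    qed
    show "bij_betw ?a (hom ?H X Y) (hom ?S (simp_of X) (simp_of Y))"
    proof (rule bij_betwI')
      show "?a f = ?a g \<longleftrightarrow> f = g" if "f \<in> hom ?H X Y" "g \<in> hom ?H X Y" for f g
        using that r_inj by (auto simp: hom_H)
      show "?a f \<in> hom ?S (simp_of X) (simp_of Y)" if "f \<in> hom ?H X Y" for f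
        using that trans[OF XY] by (auto simp: hom_H hom_S)
      show "\<exists>f \<in> hom ?H X Y. g = ?a f" if "g \<in> hom ?S (simp_of X) (simp_of Y)" for g
      proof -
        obtain \<tau> where g: "g = (simp_of X, \<tau>, simp_of Y)" "nat_trans dplus_op C (simp_of X) (simp_of Y) \<tau>"
          using \<open>g \<in> _\<close> by (auto simp: hom_S)
        have "?r (\<lambda>n. \<tau> (Suc n)) = \<tau>"
          using nat_trans.component_ext[OF g(2)] by (auto simp: fun_eq_iff extensional_def restrict_def)
        then show ?thesis using g XY trans[OF XY, of "\<lambda>n. \<tau> (Suc n)"]
          by (intro bexI[of _ "(X, \<lambda>n. \<tau> (Suc n), Y)"]) (auto simp: hom_H)
      qed
    qed
  next
    fix X assume X: "X \<in> Obj ?S"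
    then obtain Y where Y: "cart_colax C T P p q Y" "simp_of Y = X"
      using simp_obj_surj by (auto simp: obj simp_of_def)
    then show "\<exists>A \<in> Obj ?H. \<exists>i \<in> isos ?S. Dom ?S i = simp_of A \<and> Cod ?S i = X"
      using X by (intro bexI[of _ Y] bexI[of _ "Ident ?S X"]) (simp_all add: obj(1))
  qed
  then show ?thesis by blast
qed

end

section \<open>The three equivalences\<close>

theorem proposition9:
  fixes M :: "('o, 'a) moncat"
  assumes "monoidal_category M"
  shows "equivalent_cats (point_cat one_cat (one_object_bicat M) (isos M)) (monoid_cat M) \<and>
    (\<forall>W. base_of_enrichment (one_object_bicat M) W \<longrightarrow>
       equivalent_cats (point_cat one_cat (one_object_bicat M) W) (homotopy_monoid_cat M W)) \<and>
    (\<forall>(C :: ('o, 'a) cat) T P p q. finite_products C T P p q \<longrightarrow>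
       equivalent_cats
         (point_cat one_cat (one_object_bicat (cartesian_moncat C T P p q)) (Arr C))
         (simplicial_cat C))"
proof (intro conjI allI impI)
  show "equivalent_cats (point_cat one_cat (one_object_bicat M) (isos M)) (monoid_cat M)"
    using points_weakly_equivalent[OF assms] homotopy_monoids_monoids[OF assms]
      weak_equivalence_comp weak_equivalence_equivalent by metis
  show "equivalent_cats (point_cat one_cat (one_object_bicat M) W) (homotopy_monoid_cat M W)" for W
    using points_weakly_equivalent[OF assms] weak_equivalence_equivalent by metis
  fix C :: "('o, 'a) cat" and T P p q
  assume C: "finite_products C T P p q"
  show "equivalent_cats (point_cat one_cat (one_object_bicat (cartesian_moncat C T P p q)) (Arr C))
      (simplicial_cat C)"
    using points_weakly_equivalent[OF finite_products.K_monoidal[OF C]]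
      finite_products.homotopy_monoids_simplicial[OF C]
      weak_equivalence_comp weak_equivalence_equivalent unfolding dplus_op_def by metis
qed

end
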